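(* Let $k\ge 1$ be an integer, $\rho>0$, $\kappa=-1/\rho^2$, $\delta\in(0,\infty)$, and consider, in the $(k+1)$-dimensional hyperbolic space $B^{k+1}_\rho$ of constant sectional curvature $\kappa$, the Dirichlet eigenvalue problem on the hyperbolic disc of radius $\delta$ centered at the origin: find all real $\lambda$ and nontrivial functions $\varphi_\lambda(\upsilon,r)$ such that $$\triangle\varphi_\lambda(\upsilon,r)+\lambda\varphi_\lambda(\upsilon,r)=0\ \text{ for every } r\in[0,\delta],\qquad \varphi_\lambda(\upsilon,\delta)=0,$$ where $(\upsilon,r)$ are geodesic polar coordinates about the origin. Let $\lambda_{\min}$ be the minimal such $\lambda$. Then: (A) If $k=1$, then $$-\kappa\frac{k^2}{4}+\left(\frac{\pi}{2\delta}\right)^2<\lambda_{\min}<-\kappa\frac{k^2}{4}+\left(\frac{\pi}{\delta}\right)^2.$$ (B) If $k\ge 3$, then $$\lambda_{\min}>-\kappa\frac{k^2}{4}+\left(\frac{\pi}{\delta}\right)^2.$$ (C) If $k=2$, then $$\lambda_{\min}=-\kappa+\left(\frac{\pi}{\delta}\right)^2.$$ Moreover, for $k=2$, all radial eigenvalues are given by $$\lambda_j=-\kappa+\left(\frac{\pi j}{\delta}\right)^2,\qquad j=1,2,3,\dots,$$ and for each $\lambda_j$ there is a unique radial eigenfunction assuming the value one at the origin, namely $$\varphi_{\lambda_j}(r)=\frac{\delta(\rho^2-\eta^2)}{2\pi\rho^2\eta j}\sin\left(\frac{\pi jr}{\delta}\right)=\frac{\delta}{\pi j\rho\sinh(r/\rho)}\sin\left(\frac{\pi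 jr}{\delta}\right),\qquad 0\le r\le\delta,$$ where $\eta=\rho\tanh(r/(2\rho))$.
   Context: $B^{k+1}_\rho$ is the ball model of hyperbolic space: the Euclidean ball $\{|m|<\rho\}\subset\mathbb{R}^{k+1}$ with line element $2\rho^2|ds|/(\rho^2-|m|^2)$, which has constant sectional curvature $\kappa=-1/\rho^2$. In geodesic polar coordinates about the origin, $\upsilon$ is a point of the unit sphere $S^k\subset\mathbb{R}^{k+1}$ and $r$ is the geodesic (hyperbolic) distance to the origin; the Laplacian is $\triangle=\frac{\partial^2}{\partial r^2}+\frac{k}{\rho}\coth\left(\frac r\rho\right)\frac{\partial}{\partial r}+\triangle_{S(0,r)}$, with $\triangle_{S(0,r)}$ the Laplacian of the geodesic sphere of radius $r$. A radial eigenfunction is an eigenfunction depending only on $r$; a radial eigenvalue is an eigenvalue $\lambda$ of the Dirichlet problem $\triangle\varphi+\lambda\varphi=0$ for $r\in[0,\delta]$, $\varphi(\upsilon,\delta)=0$, on the hyperbolic disc of radius $\delta$ centered at the origin of $B^{k+1}_\rho$, possessing a radial eigenfunction (nonzero at the origin). The explicit formula for $\varphi_{\lambda_j}$ at $r=0$ is understood as the limit $r\to0$. *)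

theory Defs
  imports "HOL-Analysis.Analysis"
begin

definition partial_deriv :: "'n \<Rightarrow> (real ^ 'n \<Rightarrow> real) \<Rightarrow> real ^ 'n \<Rightarrow> real"
  where "partial_deriv i u x = deriv (\<lambda>t. u (x + t *\<^sub>R axis i 1)) 0"

definition C1_on :: "(real ^ 'n::finite) set \<Rightarrow> (real ^ 'n \<Rightarrow> real) \<Rightarrow> bool"
  where "C1_on U u \<longleftrightarrow> u differentiable_on U \<and> (\<forall>i. continuous_on U (partial_deriv i u))"

definition C2_on :: "(real ^ 'n::finite) set \<Rightarrow> (real ^ 'n \<Rightarrow> real) \<Rightarrow> bool"
  where "C2_on U u \<longleftrightarrow> C1_on U u \<and> (\<forall>i. C1_on U (partial_deriv i u))"

text \<open>A Riemannian metric on an open subset of Euclidean space is given by its matrix field.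
  The Laplace-Beltrami operator has the sign convention under which it is the usual
  Laplacian for the flat metric.\<close>

definition laplace_beltrami ::
  "(real ^ 'n::finite \<Rightarrow> real ^ 'n ^ 'n) \<Rightarrow> (real ^ 'n \<Rightarrow> real) \<Rightarrow> real ^ 'n \<Rightarrow> real"
  where "laplace_beltrami g u x =
    (1 / sqrt (det (g x))) *
      (\<Sum>i\<in>UNIV. partial_deriv i
         (\<lambda>y. sqrt (det (g y)) * (\<Sum>j\<in>UNIV. matrix_inv (g y) $ i $ j * partial_deriv j u y)) x)"

definition riem_length ::
  "(real ^ 'n::finite \<Rightarrow> real ^ 'n ^ 'n) \<Rightarrow> (real \<Rightarrow> real ^ 'n) \<Rightarrow> real"
  where "riem_length g \<gamma> = integral {0..1} (\<lambda>t.
    sqrt (vector_derivative \<gamma> (at t within {0..1}) \<bullet>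
          (g (\<gamma> t) *v vector_derivative \<gamma> (at t within {0..1}))))"

text \<open>The paths are C^1 on all of [0, 1] because \<^const>\<open>valid_path\<close> also admits paths of infinite
  length, whose length integral has the value 0 by convention.\<close>

definition riem_dist ::
  "(real ^ 'n::finite \<Rightarrow> real ^ 'n ^ 'n) \<Rightarrow> (real ^ 'n) set \<Rightarrow> real ^ 'n \<Rightarrow> real ^ 'n \<Rightarrow> real"
  where "riem_dist g M x y = Inf {riem_length g \<gamma> | \<gamma>.
    \<gamma> C1_differentiable_on {0..1} \<and> path_image \<gamma> \<subseteq> M \<and> pathstart \<gamma> = x \<and> pathfinish \<gamma> = y}"

text \<open>The metric of the ball model on \<open>ball 0 \<rho>\<close>, that is, the square of the line element
  \<open>2 \<rho>\<^sup>2 |ds| / (\<rho>\<^sup>2 - |m|\<^sup>2)\<close>.\<close>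

definition hyp_metric :: "real \<Rightarrow> real ^ 'n::finite \<Rightarrow> real ^ 'n ^ 'n"
  where "hyp_metric \<rho> m = mat ((2 * \<rho>\<^sup>2 / (\<rho>\<^sup>2 - (norm m)\<^sup>2))\<^sup>2)"

definition hyp_laplacian :: "real \<Rightarrow> (real ^ 'n::finite \<Rightarrow> real) \<Rightarrow> real ^ 'n \<Rightarrow> real"
  where "hyp_laplacian \<rho> = laplace_beltrami (hyp_metric \<rho>)"

definition hyp_dist :: "real \<Rightarrow> real ^ 'n::finite \<Rightarrow> real ^ 'n \<Rightarrow> real"
  where "hyp_dist \<rho> = riem_dist (hyp_metric \<rho>) (ball 0 \<rho>)"

definition hyp_disc :: "real \<Rightarrow> real \<Rightarrow> (real ^ 'n::finite) set"
  where "hyp_disc \<rho> \<delta> = {m \<in> ball 0 \<rho>. hyp_dist \<rho> 0 m \<le> \<delta>}"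

text \<open>The equation is required on the closed disc, boundary included, so an eigenfunction is
  C^2 on an open neighbourhood of it.  Only the values on the closed disc matter:
  second-order derivatives at boundary points are limits of those at interior points, and
  nontriviality refers to the disc.\<close>

definition dirichlet_eigenfunction ::
  "real \<Rightarrow> real \<Rightarrow> real \<Rightarrow> (real ^ 'n::finite \<Rightarrow> real) \<Rightarrow> bool"
  where "dirichlet_eigenfunction \<rho> \<delta> \<mu> \<phi> \<longleftrightarrow>
    (\<exists>U. open U \<and> hyp_disc \<rho> \<delta> \<subseteq> U \<and> U \<subseteq> ball 0 \<rho> \<and> C2_on U \<phi>) \<and>
    (\<forall>m\<in>hyp_disc \<rho> \<delta>. hyp_laplacian \<rho> \<phi> m + \<mu> * \<phi> m = 0) \<and>
    (\<forall>m\<in>hyp_disc \<rho> \<delta>. hyp_dist \<rho> 0 m = \<delta> \<longrightarrow> \<phi> m = 0) \<and>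
    (\<exists>m\<in>hyp_disc \<rho> \<delta>. \<phi> m \<noteq> 0)"

text \<open>The index type \<open>'n\<close>, hence the dimension of the hyperbolic space, occurs only in the
  eigenfunctions, so it is passed explicitly.\<close>

definition dirichlet_eigenvalue :: "'n::finite itself \<Rightarrow> real \<Rightarrow> real \<Rightarrow> real \<Rightarrow> bool"
  where "dirichlet_eigenvalue _ \<rho> \<delta> \<mu> \<longleftrightarrow>
    (\<exists>\<phi> :: real ^ 'n \<Rightarrow> real. dirichlet_eigenfunction \<rho> \<delta> \<mu> \<phi>)"

definition is_min_eigenvalue :: "'n::finite itself \<Rightarrow> real \<Rightarrow> real \<Rightarrow> real \<Rightarrow> bool"
  where "is_min_eigenvalue T \<rho> \<delta> \<mu> \<longleftrightarrow>
    dirichlet_eigenvalue T \<rho> \<delta> \<mu> \<and> (\<forall>\<nu>. dirichlet_eigenvalue T \<rho> \<delta> \<nu> \<longrightarrow> \<mu> \<le> \<nu>)"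

definition radial_eigenfunction ::
  "real \<Rightarrow> real \<Rightarrow> real \<Rightarrow> (real ^ 'n::finite \<Rightarrow> real) \<Rightarrow> bool"
  where "radial_eigenfunction \<rho> \<delta> \<mu> \<phi> \<longleftrightarrow>
    dirichlet_eigenfunction \<rho> \<delta> \<mu> \<phi> \<and>
    (\<exists>f. \<forall>m\<in>hyp_disc \<rho> \<delta>. \<phi> m = f (hyp_dist \<rho> 0 m))"

definition radial_eigenvalue :: "'n::finite itself \<Rightarrow> real \<Rightarrow> real \<Rightarrow> real \<Rightarrow> bool"
  where "radial_eigenvalue _ \<rho> \<delta> \<mu> \<longleftrightarrow>
    (\<exists>\<phi> :: real ^ 'n \<Rightarrow> real. radial_eigenfunction \<rho> \<delta> \<mu> \<phi> \<and> \<phi> 0 \<noteq> 0)"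

end

theory Submission
  imports Defs "HOL-Real_Asymp.Real_Asymp"
begin

text \<open>The paths of the ball model are no shorter than their projections to a diameter, so the distance
from the centre is \<open>2 \<rho> artanh (|m| / \<rho>)\<close> and a geodesic disc is a Euclidean ball.  The metric is
conformally flat; for a radial function written through \<open>t = |m|\<^sup>2 / \<rho>\<^sup>2 = tanh\<^sup>2 (r / 2\<rho>)\<close> the eigenvalue
equation becomes a linear equation in \<open>t\<close> with analytic coefficients, whose singular points are 0, 1
and infinity.  Its solution regular at 0 is a power series converging for \<open>|t| < 1\<close>, that is, on the
whole ball, and it is smooth at the centre because it is a function of \<open>|m|\<^sup>2\<close>.  In the normalised
distance \<open>s = r / \<rho>\<close> and with \<open>\<mu> = \<rho>\<^sup>2 \<lambda>\<close> it solves \<open>f'' + k coth s f' + \<mu> f = 0\<close>, \<open>f 0 = 1\<close>, and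
it depends jointly continuously on \<open>\<mu>\<close> and \<open>s\<close>.

Let \<open>\<mu>\<close> be the supremum of the parameters for which this solution is positive on \<open>[0, \<delta> / \<rho>]\<close>
(\<open>exists_first_dirichlet_profile\<close>).  By continuity the solution for \<open>\<mu>\<close> vanishes first at the end
point, so it is an eigenfunction.  No eigenvalue \<open>\<nu>\<close>, radial or not, lies below: otherwise there is a
solution \<open>\<phi>\<close> positive on the closed disc for some parameter larger than \<open>\<rho>\<^sup>2 \<nu>\<close>, and the smallest multiple of \<open>\<phi>\<close>
lying above the eigenfunction touches it at an interior point, where comparing the two Laplacians
gives a contradiction (\<open>eigenfunction_nonpositive\<close>).

The estimates come from Liouville's substitution \<open>g = sinh\<^sup>k\<^sup>/\<^sup>2 f\<close>, which gives
\<open>g'' + (\<mu> - k\<^sup>2 / 4 - k (k - 2) / (4 sinh\<^sup>2)) g = 0\<close>.  The sign of \<open>k - 2\<close> is the sign of the extra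
potential, so comparison with \<open>sin (\<pi> s / d)\<close>, \<open>d = \<delta> / \<rho>\<close>, separates the cases \<open>k = 1\<close>, \<open>k = 2\<close> and
\<open>k \<ge> 3\<close> (\<open>dirichlet_comparison_sin\<close>).  For the lower bound with \<open>k = 1\<close> the comparison function is
\<open>\<surd>s cos (\<pi> s / 2d)\<close>, whose factor \<open>\<surd>s\<close> produces the potential \<open>1 / (4 s\<^sup>2)\<close> that dominates \<open>1 / (4 sinh\<^sup>2 s)\<close>
(\<open>dirichlet_planar_lower_bound\<close>).  For \<open>k = 2\<close> the potential vanishes: \<open>sinh s f\<close> solves a constant
coefficient equation, which yields the explicit radial eigenvalues and eigenfunctions and their uniqueness.\<close>

section \<open>Geodesic distance to the centre of the ball model\<close>

lemma tanh_artanh_real: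
  fixes x :: real
  assumes "\<bar>x\<bar> < 1"
  shows "tanh (artanh x) = x"
proof -
  have pos: "1 + x > 0" "1 - x > 0" using assms by auto
  have e: "exp (- 2 * artanh x) = (1 - x) / (1 + x)"
    using pos by (simp add: artanh_def exp_minus)
  show ?thesis unfolding tanh_real_altdef e using pos by (simp add: field_simps)
qed

lemma sqrt_hyp_metric_form:
  fixes m v :: "real ^ 'n::finite"
  assumes "\<rho> > 0" "norm m < \<rho>"
  shows "sqrt (v \<bullet> (hyp_metric \<rho> m *v v)) = 2 * \<rho>\<^sup>2 / (\<rho>\<^sup>2 - (norm m)\<^sup>2) * norm v"
proof -
  have "mat a *v v = a *\<^sub>R v" for a :: real
    by (simp add: vec_eq_iff matrix_vector_mult_def mat_def if_distrib[where f = "\<lambda>x. x * _"]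
        sum.delta cong: if_cong)
  then have "v \<bullet> (hyp_metric \<rho> m *v v) = (2 * \<rho>\<^sup>2 / (\<rho>\<^sup>2 - (norm m)\<^sup>2))\<^sup>2 * (norm v)\<^sup>2"
    by (simp add: hyp_metric_def dot_square_norm)
  then have "v \<bullet> (hyp_metric \<rho> m *v v) = (2 * \<rho>\<^sup>2 / (\<rho>\<^sup>2 - (norm m)\<^sup>2) * norm v)\<^sup>2"
    by (simp add: power_mult_distrib power_divide)
  moreover have "(norm m)\<^sup>2 < \<rho>\<^sup>2" using assms by (intro power_strict_mono) auto
  ultimately show ?thesis by simp
qed

lemma riem_length_hyp_metric:
  fixes \<gamma> :: "real \<Rightarrow> real ^ 'n::finite"
  assumes "\<rho> > 0" and D: "\<And>t. t \<in> {0..1} \<Longrightarrow> (\<gamma> has_vector_derivative D t) (at t)"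
    and ball: "\<And>t. t \<in> {0..1} \<Longrightarrow> norm (\<gamma> t) < \<rho>"
  shows "riem_length (hyp_metric \<rho>) \<gamma> =
    integral {0..1} (\<lambda>t. 2 * \<rho>\<^sup>2 / (\<rho>\<^sup>2 - (norm (\<gamma> t))\<^sup>2) * norm (D t))"
  unfolding riem_length_def
proof (rule integral_cong)
  fix t :: real assume t: "t \<in> {0..1}"
  have "vector_derivative \<gamma> (at t within {0..1}) = D t"
    using t by (intro vector_derivative_at_within_ivl D) auto
  then show "sqrt (vector_derivative \<gamma> (at t within {0..1}) \<bullet>
      (hyp_metric \<rho> (\<gamma> t) *v vector_derivative \<gamma> (at t within {0..1}))) =
    2 * \<rho>\<^sup>2 / (\<rho>\<^sup>2 - (norm (\<gamma> t))\<^sup>2) * norm (D t)"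
    using sqrt_hyp_metric_form[OF assms(1) ball[OF t]] by simp
qed

lemma artanh_scaled_has_vector_derivative:
  fixes g :: "real \<Rightarrow> real"
  assumes "\<rho> > 0" "\<bar>g t\<bar> < \<rho>" "(g has_real_derivative g') (at t within S)"
  shows "((\<lambda>t. 2 * \<rho> * artanh (g t / \<rho>)) has_vector_derivative 2 * \<rho>\<^sup>2 / (\<rho>\<^sup>2 - (g t)\<^sup>2) * g') (at t within S)"
proof -
  have "\<bar>g t / \<rho>\<bar> < 1" using assms by simp
  then have "(artanh has_real_derivative 1 / (1 - (g t / \<rho>)\<^sup>2)) (at (g t / \<rho>))"
    by (intro artanh_real_has_field_derivative) auto
  moreover have "((\<lambda>t. g t / \<rho>) has_real_derivative g' / \<rho>) (at t within S)"
    using assms by (auto intro!: derivative_eq_intros)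
  ultimately have "((\<lambda>t. artanh (g t / \<rho>)) has_real_derivative 1 / (1 - (g t / \<rho>)\<^sup>2) * (g' / \<rho>)) (at t within S)"
    by (rule DERIV_chain2)
  then have "((\<lambda>t. 2 * \<rho> * artanh (g t / \<rho>)) has_real_derivative
      2 * \<rho> * (1 / (1 - (g t / \<rho>)\<^sup>2) * (g' / \<rho>))) (at t within S)"
    by (rule DERIV_cmult)
  moreover have "(g t)\<^sup>2 < \<rho>\<^sup>2" using assms power_strict_mono[of "\<bar>g t\<bar>" \<rho> 2] by simp
  then have "2 * \<rho> * (1 / (1 - (g t / \<rho>)\<^sup>2) * (g' / \<rho>)) = 2 * \<rho>\<^sup>2 / (\<rho>\<^sup>2 - (g t)\<^sup>2) * g'"
    using assms by (simp add: divide_simps power2_eq_square)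
  ultimately show ?thesis by (simp add: has_real_derivative_iff_has_vector_derivative)
qed

text \<open>Projecting a path to the diameter through its end point does not lengthen its velocity and, since the
density \<open>2 \<rho>\<^sup>2 / (\<rho>\<^sup>2 - |m|\<^sup>2)\<close> grows with \<open>|m|\<close>, does not increase the density either.  The projected
path is one-dimensional, so its length is at least the difference of the primitive of the density at the end points.  Using
the projection instead of \<open>|m|\<close> avoids the lack of smoothness of the norm at the origin.\<close>

lemma hyp_length_lower_bound:
  fixes \<gamma> :: "real \<Rightarrow> real ^ 'n::finite"
  assumes \<rho>: "\<rho> > 0" and C1: "\<gamma> C1_differentiable_on {0..1}" and img: "path_image \<gamma> \<subseteq> ball 0 \<rho>"
    and start: "pathstart \<gamma> = 0"
  shows "2 * \<rho> * artanh (norm (pathfinish \<gamma>) / \<rho>) \<le> riem_length (hyp_metric \<rho>) \<gamma>"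
proof -
  obtain D where D: "\<And>t. t \<in> {0..1} \<Longrightarrow> (\<gamma> has_vector_derivative D t) (at t)"
    and Dc: "continuous_on {0..1} D"
    using C1 unfolding C1_differentiable_on_def by blast
  have ball: "norm (\<gamma> t) < \<rho>" if "t \<in> {0..1}" for t
    using img that by (auto simp: path_image_def image_subset_iff)
  have gc: "continuous_on {0..1} \<gamma>"
    using D by (meson continuous_at_imp_continuous_on has_vector_derivative_continuous)
  have sq: "(norm (\<gamma> t))\<^sup>2 < \<rho>\<^sup>2" if "t \<in> {0..1}" for t
    using ball[OF that] by (intro power_strict_mono) auto
  have ne: "\<rho>\<^sup>2 - (norm (\<gamma> t))\<^sup>2 \<noteq> 0" if "t \<in> {0..1}" for t using sq[OF that] by simp
  \<comment> \<open>if the end point is the centre then \<open>sgn\<close> is 0, and the estimate below is trivial\<close>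
  define e where "e = sgn (pathfinish \<gamma>)"
  have e: "norm e \<le> 1" by (simp add: e_def norm_sgn)
  define x where "x t = \<gamma> t \<bullet> e" for t
  have x_le: "\<bar>v \<bullet> e\<bar> \<le> norm v" for v
    using Cauchy_Schwarz_ineq2[of v e] e mult_left_mono[of "norm e" 1 "norm v"] by simp
  define L where "L t = 2 * \<rho>\<^sup>2 / (\<rho>\<^sup>2 - (norm (\<gamma> t))\<^sup>2) * norm (D t)" for t
  define l where "l t = 2 * \<rho>\<^sup>2 / (\<rho>\<^sup>2 - (x t)\<^sup>2) * (D t \<bullet> e)" for t
  have "continuous_on {0..1} L" unfolding L_def
    using gc Dc by (intro continuous_intros ballI ne)
  then have Lint: "(L has_integral integral {0..1} L) {0..1}"
    by (intro integrable_integral integrable_continuous_real)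
  have "(l has_integral 2 * \<rho> * artanh (x 1 / \<rho>) - 2 * \<rho> * artanh (x 0 / \<rho>)) {0..1}"
  proof (rule fundamental_theorem_of_calculus)
    fix t :: real assume t: "t \<in> {0..1}"
    have "((\<lambda>t. \<gamma> t \<bullet> e) has_vector_derivative D t \<bullet> e) (at t within {0..1})"
      by (rule bounded_linear.has_vector_derivative[OF bounded_linear_inner_left])
        (rule has_vector_derivative_at_within[OF D[OF t]])
    then have "(x has_real_derivative D t \<bullet> e) (at t within {0..1})"
      by (simp add: x_def[abs_def] has_real_derivative_iff_has_vector_derivative)
    moreover have "\<bar>x t\<bar> < \<rho>" using x_le[of "\<gamma> t"] ball[OF t] by (simp add: x_def)
    ultimately show "((\<lambda>t. 2 * \<rho> * artanh (x t / \<rho>)) has_vector_derivative l t) (at t within {0..1})"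
      unfolding l_def using \<rho> by (intro artanh_scaled_has_vector_derivative)
  qed simp
  moreover have "l t \<le> L t" if t: "t \<in> {0..1}" for t
  proof -
    have "(x t)\<^sup>2 \<le> (norm (\<gamma> t))\<^sup>2" using x_le[of "\<gamma> t"] by (simp add: x_def abs_le_square_iff[symmetric])
    then have "2 * \<rho>\<^sup>2 / (\<rho>\<^sup>2 - (x t)\<^sup>2) \<le> 2 * \<rho>\<^sup>2 / (\<rho>\<^sup>2 - (norm (\<gamma> t))\<^sup>2)"
      using sq[OF t] by (intro divide_left_mono mult_pos_pos) auto
    moreover have "D t \<bullet> e \<le> norm (D t)" using x_le[of "D t"] by simp
    moreover have "0 \<le> 2 * \<rho>\<^sup>2 / (\<rho>\<^sup>2 - (x t)\<^sup>2)"
      using sq[OF t] \<open>(x t)\<^sup>2 \<le> (norm (\<gamma> t))\<^sup>2\<close> by (intro divide_nonneg_nonneg) auto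
    ultimately show ?thesis unfolding l_def L_def
      by (smt (verit, ccfv_SIG) mult_left_mono mult_right_mono norm_ge_zero)
  qed
  ultimately have "2 * \<rho> * artanh (x 1 / \<rho>) - 2 * \<rho> * artanh (x 0 / \<rho>) \<le> integral {0..1} L"
    using has_integral_le[OF _ Lint] by blast
  moreover have "x 0 = 0" using start by (simp add: x_def pathstart_def)
  moreover have "v \<bullet> sgn v = norm v" for v :: "real ^ 'n"
    by (cases "v = 0") (simp_all add: sgn_div_norm dot_square_norm power2_eq_square)
  then have "x 1 = norm (pathfinish \<gamma>)" by (simp add: x_def e_def pathfinish_def)
  moreover have "riem_length (hyp_metric \<rho>) \<gamma> = integral {0..1} L"
    unfolding L_def by (rule riem_length_hyp_metric[OF \<rho> D ball])
  ultimately show ?thesis by simp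
qed

lemma hyp_length_radial_segment:
  fixes m :: "real ^ 'n::finite"
  assumes \<rho>: "\<rho> > 0" and m: "norm m < \<rho>"
  shows "riem_length (hyp_metric \<rho>) (\<lambda>t. t *\<^sub>R m) = 2 * \<rho> * artanh (norm m / \<rho>)"
proof -
  have ball: "norm (t *\<^sub>R m) < \<rho>" if "t \<in> {0..1}" for t :: real
    using m that mult_right_mono[of "\<bar>t\<bar>" 1 "norm m"] by simp
  have "riem_length (hyp_metric \<rho>) (\<lambda>t. t *\<^sub>R m) =
      integral {0..1} (\<lambda>t. 2 * \<rho>\<^sup>2 / (\<rho>\<^sup>2 - (norm (t *\<^sub>R m))\<^sup>2) * norm m)"
    by (rule riem_length_hyp_metric[OF \<rho> _ ball]) (auto intro!: derivative_eq_intros)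
  also have "\<dots> = integral {0..1} (\<lambda>t. 2 * \<rho>\<^sup>2 / (\<rho>\<^sup>2 - (t * norm m)\<^sup>2) * norm m)"
    by (simp add: power_mult_distrib)
  also have "\<dots> = 2 * \<rho> * artanh (1 * norm m / \<rho>) - 2 * \<rho> * artanh (0 * norm m / \<rho>)"
  proof (rule integral_unique, rule fundamental_theorem_of_calculus)
    fix t :: real assume "t \<in> {0..1}"
    then show "((\<lambda>t. 2 * \<rho> * artanh (t * norm m / \<rho>)) has_vector_derivative
        2 * \<rho>\<^sup>2 / (\<rho>\<^sup>2 - (t * norm m)\<^sup>2) * norm m) (at t within {0..1})"
      using ball[of t] by (intro artanh_scaled_has_vector_derivative \<rho>)
        (auto intro!: derivative_eq_intros simp: abs_mult)
  qed simp
  finally show ?thesis by simp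
qed

lemma hyp_dist_0:
  fixes m :: "real ^ 'n::finite"
  assumes \<rho>: "\<rho> > 0" and m: "norm m < \<rho>"
  shows "hyp_dist \<rho> 0 m = 2 * \<rho> * artanh (norm m / \<rho>)"
  unfolding hyp_dist_def riem_dist_def
proof (rule cInf_eq_minimum)
  have "(\<lambda>t. t *\<^sub>R m) C1_differentiable_on {0..1}"
    unfolding C1_differentiable_on_def
    by (intro exI[of _ "\<lambda>_. m"]) (auto intro!: derivative_eq_intros)
  moreover have "path_image (\<lambda>t. t *\<^sub>R m) \<subseteq> ball 0 \<rho>"
  proof -
    have "norm (t *\<^sub>R m) < \<rho>" if "t \<in> {0..1}" for t :: real
      using m that mult_right_mono[of "\<bar>t\<bar>" 1 "norm m"] by simp
    then show ?thesis by (auto simp: path_image_def)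
  qed
  ultimately show "2 * \<rho> * artanh (norm m / \<rho>) \<in> {riem_length (hyp_metric \<rho>) \<gamma> |\<gamma>.
      \<gamma> C1_differentiable_on {0..1} \<and> path_image \<gamma> \<subseteq> ball 0 \<rho> \<and> pathstart \<gamma> = 0 \<and> pathfinish \<gamma> = m}"
    using hyp_length_radial_segment[OF assms]
    by (intro CollectI exI[of _ "\<lambda>t. t *\<^sub>R m"]) (auto simp: pathstart_def pathfinish_def)
qed (use hyp_length_lower_bound[OF \<rho>] in auto)

lemma norm_eq_tanh_hyp_dist:
  fixes m :: "real ^ 'n::finite"
  assumes "\<rho> > 0" "norm m < \<rho>"
  shows "norm m = \<rho> * tanh (hyp_dist \<rho> 0 m / (2 * \<rho>))"
  using assms tanh_artanh_real[of "norm m / \<rho>"] by (simp add: hyp_dist_0)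

lemma hyp_disc_eq_cball:
  assumes \<rho>: "\<rho> > 0"
  shows "(hyp_disc \<rho> \<delta> :: (real ^ 'n::finite) set) = cball 0 (\<rho> * tanh (\<delta> / (2 * \<rho>)))"
proof -
  have "hyp_dist \<rho> 0 m \<le> \<delta> \<longleftrightarrow> norm m \<le> \<rho> * tanh (\<delta> / (2 * \<rho>))"
    if "norm m < \<rho>" for m :: "real ^ 'n"
    using norm_eq_tanh_hyp_dist[OF \<rho> that] \<rho> by (simp add: divide_le_cancel)
  moreover have "\<rho> * tanh (\<delta> / (2 * \<rho>)) < \<rho>"
    using tanh_real_lt_1[of "\<delta> / (2 * \<rho>)"] \<rho> by simp
  ultimately show ?thesis by (auto simp: hyp_disc_def)
qed

section \<open>The Laplacian of the ball model\<close>

lemma has_derivative_axis_line: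
  fixes u :: "real ^ 'n::finite \<Rightarrow> real"
  assumes D: "(u has_derivative D) (at (x + s *\<^sub>R axis i 1))"
  shows "((\<lambda>t. u (x + t *\<^sub>R axis i 1)) has_real_derivative D (axis i 1)) (at s)"
proof -
  interpret D: bounded_linear D using D by (rule has_derivative_bounded_linear)
  have "((\<lambda>t. x + t *\<^sub>R axis i 1) has_derivative (\<lambda>t. t *\<^sub>R axis i 1)) (at s)"
    by (auto intro!: derivative_eq_intros)
  then have "((\<lambda>t. u (x + t *\<^sub>R axis i 1)) has_derivative (\<lambda>t. D (t *\<^sub>R axis i 1))) (at s)"
    using has_derivative_compose[of "\<lambda>t. x + t *\<^sub>R axis i 1" _ s UNIV u D] D by simp
  then show ?thesis by (simp add: has_field_derivative_def D.scaleR mult_commute_abs)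
qed

lemma partial_deriv_eq:
  assumes "(u has_derivative D) (at (x :: real ^ 'n::finite))"
  shows "partial_deriv i u x = D (axis i 1)"
  using has_derivative_axis_line[of u D x 0 i] assms
  by (simp add: partial_deriv_def DERIV_imp_deriv)

lemma partial_deriv_axis_line:
  fixes u :: "real ^ 'n::finite \<Rightarrow> real"
  assumes "u differentiable (at (x + s *\<^sub>R axis i 1))"
  shows "((\<lambda>t. u (x + t *\<^sub>R axis i 1)) has_real_derivative partial_deriv i u (x + s *\<^sub>R axis i 1)) (at s)"
  using assms unfolding differentiable_def
  by (auto simp: partial_deriv_eq intro: has_derivative_axis_line)

lemma C2_onD:
  assumes "C2_on U u" "open U" "x \<in> U"
  shows "u differentiable (at x)" "partial_deriv i u differentiable (at x)"
    "continuous (at x) (partial_deriv i u)" "continuous (at x) (partial_deriv j (partial_deriv i u))"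
  using assms unfolding C2_on_def C1_on_def
  by (auto simp: differentiable_on_eq_differentiable_at continuous_on_eq_continuous_at)

lemma C2_on_subset:
  fixes u :: "real ^ 'n::finite \<Rightarrow> real"
  assumes "C2_on U u" "W \<subseteq> U"
  shows "C2_on W u"
proof -
  have "v differentiable_on W" if "v differentiable_on U" for v :: "real ^ 'n \<Rightarrow> real"
    using that assms(2) by (rule differentiable_on_subset)
  moreover have "continuous_on W v" if "continuous_on U v" for v :: "real ^ 'n \<Rightarrow> real"
    using that assms(2) by (rule continuous_on_subset)
  ultimately show ?thesis using assms(1) unfolding C2_on_def C1_on_def by simp
qed

definition conformal_factor :: "real \<Rightarrow> real ^ 'n::finite \<Rightarrow> real" where
  "conformal_factor \<rho> x = 2 * \<rho>\<^sup>2 / (\<rho>\<^sup>2 - (norm x)\<^sup>2)"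

lemma conformal_factor_pos:
  assumes "\<rho> > 0" "norm x < \<rho>"
  shows "conformal_factor \<rho> x > 0"
proof -
  have "(norm x)\<^sup>2 < \<rho>\<^sup>2" using assms by (intro power_strict_mono) auto
  then show ?thesis using assms by (simp add: conformal_factor_def)
qed

lemma conformal_factor_partial:
  assumes "\<rho> > 0" "norm x < \<rho>"
  shows "((\<lambda>t. conformal_factor \<rho> (x + t *\<^sub>R axis i 1)) has_real_derivative
    conformal_factor \<rho> x * (2 * x $ i / (\<rho>\<^sup>2 - (norm x)\<^sup>2))) (at 0)"
proof -
  have sq: "(norm x)\<^sup>2 < \<rho>\<^sup>2" using assms by (intro power_strict_mono) auto
  have n: "(norm (x + t *\<^sub>R axis i 1))\<^sup>2 = (norm x)\<^sup>2 + 2 * t * x $ i + t\<^sup>2" for t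
    unfolding power2_norm_eq_inner
    by (simp add: inner_simps inner_axis inner_axis' inner_axis_axis power2_eq_square algebra_simps)
  show ?thesis unfolding conformal_factor_def n
    using sq by (auto intro!: derivative_eq_intros simp: divide_simps power2_eq_square)
qed

lemma sqrt_det_hyp_metric:
  fixes x :: "real ^ 'n::finite"
  assumes "\<rho> > 0" "norm x < \<rho>"
  shows "sqrt (det (hyp_metric \<rho> x)) = conformal_factor \<rho> x ^ CARD('n)"
proof -
  have "det (hyp_metric \<rho> x) = ((conformal_factor \<rho> x) ^ CARD('n))\<^sup>2"
    unfolding hyp_metric_def conformal_factor_def
    by (subst det_diagonal) (auto simp: mat_def mult.commute simp flip: power_mult)
  then show ?thesis using conformal_factor_pos[OF assms] by simp
qed

lemma matrix_inv_eqI: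
  fixes A B :: "real ^ 'n::finite ^ 'n"
  assumes "A ** B = mat 1" "B ** A = mat 1"
  shows "matrix_inv A = B"
  unfolding matrix_inv_def
proof (rule some_equality)
  fix C assume "A ** C = mat 1 \<and> C ** A = mat 1"
  then have "C = C ** (A ** B)" "(C ** A) ** B = B" using assms by (simp_all add: matrix_mul_lid matrix_mul_rid)
  then show "C = B" by (simp add: matrix_mul_assoc)
qed (use assms in simp)

lemma matrix_inv_hyp_metric:
  fixes x :: "real ^ 'n::finite"
  assumes "\<rho> > 0" "norm x < \<rho>"
  shows "matrix_inv (hyp_metric \<rho> x) = mat (1 / (conformal_factor \<rho> x)\<^sup>2)"
proof -
  have "mat a ** (mat b :: real ^ 'n ^ 'n) = mat (a * b)" for a b
    by (simp add: vec_eq_iff matrix_matrix_mult_def mat_def if_distrib[where f = "\<lambda>x. x * _"]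
        sum.delta cong: if_cong)
  then show ?thesis using conformal_factor_pos[OF assms]
    by (intro matrix_inv_eqI) (auto simp: hyp_metric_def simp flip: conformal_factor_def)
qed

text \<open>In dimension \<open>n\<close> the metric is the square of the conformal factor \<open>l\<close> times the Euclidean one, so the divergence form
reads \<open>l\<^sup>-\<^sup>n \<Sum>\<^sub>i \<partial>\<^sub>i (l\<^sup>n\<^sup>-\<^sup>2 \<partial>\<^sub>i u)\<close>; the first order term comes from
\<open>\<partial>\<^sub>i l = 2 x\<^sub>i l / (\<rho>\<^sup>2 - |x|\<^sup>2)\<close>.\<close>

lemma hyp_laplacian_ball:
  fixes u :: "real ^ 'n::finite \<Rightarrow> real"
  assumes \<rho>: "\<rho> > 0" and n: "CARD('n) \<ge> 2"
    and U: "open U" "U \<subseteq> ball 0 \<rho>" "C2_on U u" and x: "x \<in> U"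
  shows "hyp_laplacian \<rho> u x =
    1 / (conformal_factor \<rho> x)\<^sup>2 * ((\<Sum>i\<in>UNIV. partial_deriv i (partial_deriv i u) x)
      + (real CARD('n) - 2) * (2 / (\<rho>\<^sup>2 - (norm x)\<^sup>2)) * (\<Sum>i\<in>UNIV. x $ i * partial_deriv i u x))"
proof -
  define N where "N = CARD('n) - 2"
  have N: "CARD('n) = N + 2" using n by (simp add: N_def)
  define l where "l = conformal_factor \<rho> x"
  have xb: "norm x < \<rho>" using U x by auto
  have l: "l > 0" unfolding l_def using \<rho> xb by (rule conformal_factor_pos)
  have inner: "sqrt (det (hyp_metric \<rho> y)) * (\<Sum>j\<in>UNIV. matrix_inv (hyp_metric \<rho> y) $ i $ j * partial_deriv j u y)
      = conformal_factor \<rho> y ^ N * partial_deriv i u y" if "y \<in> U" for y i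
  proof -
    have y: "norm y < \<rho>" using U that by auto
    have "(\<Sum>j\<in>UNIV. matrix_inv (hyp_metric \<rho> y) $ i $ j * partial_deriv j u y) =
        1 / (conformal_factor \<rho> y)\<^sup>2 * partial_deriv i u y"
      unfolding matrix_inv_hyp_metric[OF \<rho> y]
      by (simp add: mat_def if_distrib[where f = "\<lambda>x. x * _"] sum.delta cong: if_cong)
    then show ?thesis
      using conformal_factor_pos[OF \<rho> y] unfolding sqrt_det_hyp_metric[OF \<rho> y] N
      by (simp add: power_add power2_eq_square)
  qed
  have pd: "partial_deriv i (\<lambda>y. sqrt (det (hyp_metric \<rho> y)) *
        (\<Sum>j\<in>UNIV. matrix_inv (hyp_metric \<rho> y) $ i $ j * partial_deriv j u y)) x =
      l ^ N * (partial_deriv i (partial_deriv i u) x + real N * (2 / (\<rho>\<^sup>2 - (norm x)\<^sup>2)) * (x $ i * partial_deriv i u x))"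
    for i
  proof -
    have d1: "((\<lambda>t. partial_deriv i u (x + t *\<^sub>R axis i 1)) has_real_derivative
        partial_deriv i (partial_deriv i u) x) (at 0)"
      using partial_deriv_axis_line[of "partial_deriv i u" x 0 i] C2_onD(2)[OF U(3,1) x] by simp
    have d2: "((\<lambda>t. conformal_factor \<rho> (x + t *\<^sub>R axis i 1) ^ N) has_real_derivative
        real N * l ^ N * (2 * x $ i / (\<rho>\<^sup>2 - (norm x)\<^sup>2))) (at 0)"
      by (rule DERIV_cong[OF DERIV_power[OF conformal_factor_partial[OF \<rho> xb]]])
        (cases N, simp_all add: l_def)
    have "((\<lambda>t. conformal_factor \<rho> (x + t *\<^sub>R axis i 1) ^ N * partial_deriv i u (x + t *\<^sub>R axis i 1))
      has_real_derivative l ^ N * partial_deriv i (partial_deriv i u) x +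
        real N * l ^ N * (2 * x $ i / (\<rho>\<^sup>2 - (norm x)\<^sup>2)) * partial_deriv i u x) (at 0)"
      using DERIV_mult'[OF d2 d1] by (simp add: l_def)
    moreover have "open ((\<lambda>t. x + t *\<^sub>R axis i 1) -` U)"
      by (intro open_vimage U continuous_intros)
    ultimately have "((\<lambda>t. sqrt (det (hyp_metric \<rho> (x + t *\<^sub>R axis i 1))) *
        (\<Sum>j\<in>UNIV. matrix_inv (hyp_metric \<rho> (x + t *\<^sub>R axis i 1)) $ i $ j * partial_deriv j u (x + t *\<^sub>R axis i 1)))
       has_real_derivative l ^ N * partial_deriv i (partial_deriv i u) x +
        real N * l ^ N * (2 * x $ i / (\<rho>\<^sup>2 - (norm x)\<^sup>2)) * partial_deriv i u x) (at 0)"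
      by (rule has_field_derivative_transform_within_open) (use x inner in auto)
    note DERIV_imp_deriv[OF this]
    then show ?thesis by (subst partial_deriv_def) (simp add: algebra_simps)
  qed
  have "hyp_laplacian \<rho> u x = 1 / l ^ CARD('n) * (\<Sum>i\<in>UNIV. l ^ N * (partial_deriv i (partial_deriv i u) x
      + real N * (2 / (\<rho>\<^sup>2 - (norm x)\<^sup>2)) * (x $ i * partial_deriv i u x)))"
    unfolding hyp_laplacian_def laplace_beltrami_def pd sqrt_det_hyp_metric[OF \<rho> xb] l_def ..
  also have "\<dots> = 1 / l\<^sup>2 * (\<Sum>i\<in>UNIV. partial_deriv i (partial_deriv i u) x
      + real N * (2 / (\<rho>\<^sup>2 - (norm x)\<^sup>2)) * (x $ i * partial_deriv i u x))"
    unfolding N using l by (simp add: power_add power2_eq_square sum_distrib_left[symmetric])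
  also have "real N = real CARD('n) - 2" using n by (simp add: N_def)
  finally show ?thesis by (simp add: l_def sum.distrib sum_distrib_left)
qed

lemma radial_function_partial:
  fixes u :: "real ^ 'n::finite \<Rightarrow> real"
  assumes V: "open V" "x \<in> V" and u: "\<And>y. y \<in> V \<Longrightarrow> u y = F ((norm y)\<^sup>2 / \<rho>\<^sup>2)"
    and F: "(F has_real_derivative F') (at ((norm x)\<^sup>2 / \<rho>\<^sup>2))"
  shows "(u has_derivative (\<lambda>h. F' * (2 * (x \<bullet> h) / \<rho>\<^sup>2))) (at x)"
    and "partial_deriv i u x = F' * (2 * x $ i / \<rho>\<^sup>2)"
proof -
  have "((\<lambda>y. (norm y)\<^sup>2 / \<rho>\<^sup>2) has_derivative (\<lambda>h. 2 * (x \<bullet> h) / \<rho>\<^sup>2)) (at x)"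
    unfolding power2_norm_eq_inner divide_inverse
    by (auto intro!: derivative_eq_intros simp: inner_commute)
  moreover have "(F has_derivative (*) F') (at ((norm x)\<^sup>2 / \<rho>\<^sup>2))"
    using F by (simp add: has_field_derivative_def)
  ultimately have "((\<lambda>y. F ((norm y)\<^sup>2 / \<rho>\<^sup>2)) has_derivative (\<lambda>h. F' * (2 * (x \<bullet> h) / \<rho>\<^sup>2))) (at x)"
    by (rule has_derivative_compose)
  then show "(u has_derivative (\<lambda>h. F' * (2 * (x \<bullet> h) / \<rho>\<^sup>2))) (at x)"
    by (rule has_derivative_transform_within_open[OF _ V]) (simp add: u)
  then show "partial_deriv i u x = F' * (2 * x $ i / \<rho>\<^sup>2)"
    by (simp add: partial_deriv_eq inner_axis)
qed

lemma radial_function_second_partial: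
  fixes u :: "real ^ 'n::finite \<Rightarrow> real"
  assumes V: "open V" "x \<in> V" and u: "\<And>y. y \<in> V \<Longrightarrow> u y = F ((norm y)\<^sup>2 / \<rho>\<^sup>2)"
    and F: "\<And>y. y \<in> V \<Longrightarrow> (F has_real_derivative F' ((norm y)\<^sup>2 / \<rho>\<^sup>2)) (at ((norm y)\<^sup>2 / \<rho>\<^sup>2))"
    and F': "(F' has_real_derivative F'') (at ((norm x)\<^sup>2 / \<rho>\<^sup>2))"
  shows "partial_deriv j u differentiable (at x)"
    and "partial_deriv i (partial_deriv j u) x =
      F'' * (4 * x $ i * x $ j / \<rho>^4) + F' ((norm x)\<^sup>2 / \<rho>\<^sup>2) * (if i = j then 2 / \<rho>\<^sup>2 else 0)"
proof -
  have "((\<lambda>y. F' ((norm y)\<^sup>2 / \<rho>\<^sup>2)) has_derivative (\<lambda>h. F'' * (2 * (x \<bullet> h) / \<rho>\<^sup>2))) (at x)"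
    using radial_function_partial(1)[OF open_UNIV UNIV_I refl F'] .
  moreover have "((\<lambda>y. 2 * y $ j / \<rho>\<^sup>2) has_derivative (\<lambda>h. 2 * h $ j / \<rho>\<^sup>2)) (at x)"
    unfolding divide_inverse
    by (auto intro!: derivative_eq_intros bounded_linear_imp_has_derivative[OF bounded_linear_vec_nth])
  ultimately have "((\<lambda>y. F' ((norm y)\<^sup>2 / \<rho>\<^sup>2) * (2 * y $ j / \<rho>\<^sup>2)) has_derivative
      (\<lambda>h. F' ((norm x)\<^sup>2 / \<rho>\<^sup>2) * (2 * h $ j / \<rho>\<^sup>2) + F'' * (2 * (x \<bullet> h) / \<rho>\<^sup>2) * (2 * x $ j / \<rho>\<^sup>2))) (at x)"
    by (rule has_derivative_mult)
  then have D: "(partial_deriv j u has_derivative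
      (\<lambda>h. F' ((norm x)\<^sup>2 / \<rho>\<^sup>2) * (2 * h $ j / \<rho>\<^sup>2) + F'' * (2 * (x \<bullet> h) / \<rho>\<^sup>2) * (2 * x $ j / \<rho>\<^sup>2))) (at x)"
    by (rule has_derivative_transform_within_open[OF _ V])
      (use radial_function_partial(2)[OF V(1) _ u F] in simp)
  then show "partial_deriv j u differentiable (at x)" unfolding differentiable_def by blast
  show "partial_deriv i (partial_deriv j u) x =
      F'' * (4 * x $ i * x $ j / \<rho>^4) + F' ((norm x)\<^sup>2 / \<rho>\<^sup>2) * (if i = j then 2 / \<rho>\<^sup>2 else 0)"
  proof -
    have "x \<bullet> axis i 1 = x $ i" "axis i (1 :: real) $ j = (if i = j then 1 else 0)"
      by (simp add: inner_axis) (simp add: axis_def)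
    then show ?thesis unfolding partial_deriv_eq[OF D] by (simp add: power4_eq_xxxx power2_eq_square mult_ac)
  qed
qed

text \<open>In the variable \<open>t = |x|\<^sup>2 / \<rho>\<^sup>2\<close> the Laplacian has polynomial coefficients.  The radial
representation is only required near the point, so that the lemma also applies to radial functions given
away from the origin.\<close>

lemma hyp_laplacian_radial:
  fixes u :: "real ^ 'n::finite \<Rightarrow> real"
  assumes \<rho>: "\<rho> > 0" and n: "CARD('n) \<ge> 2"
    and W: "open W" "W \<subseteq> ball 0 \<rho>" "C2_on W u"
    and V: "open V" "V \<subseteq> W" "x \<in> V" and u: "\<And>y. y \<in> V \<Longrightarrow> u y = F ((norm y)\<^sup>2 / \<rho>\<^sup>2)"
    and F: "\<And>y. y \<in> V \<Longrightarrow> (F has_real_derivative F' ((norm y)\<^sup>2 / \<rho>\<^sup>2)) (at ((norm y)\<^sup>2 / \<rho>\<^sup>2))"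
    and F': "(F' has_real_derivative F'') (at ((norm x)\<^sup>2 / \<rho>\<^sup>2))"
  defines "c \<equiv> real CARD('n) / 2" and "t \<equiv> (norm x)\<^sup>2 / \<rho>\<^sup>2"
  shows "hyp_laplacian \<rho> u x =
    (t * (1 - t)\<^sup>2 * F'' + (c - 2 * t - (c - 2) * t\<^sup>2) * F' t) / \<rho>\<^sup>2"
proof -
  have xW: "x \<in> W" using V by auto
  then have xb: "norm x < \<rho>" using W by auto
  have nx: "(\<Sum>i\<in>UNIV. x $ i * x $ i) = t * \<rho>\<^sup>2"
    using \<rho> by (simp add: t_def power2_norm_eq_inner inner_vec_def)
  have t1: "1 - t > 0"
  proof -
    have "(norm x)\<^sup>2 < \<rho>\<^sup>2" using xb by (intro power_strict_mono) auto
    then show ?thesis using \<rho> by (simp add: t_def)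
  qed
  have s1: "(\<Sum>i\<in>UNIV. partial_deriv i (partial_deriv i u) x) = (4 * t * F'' + 4 * c * F' t) / \<rho>\<^sup>2"
  proof -
    have "partial_deriv i (partial_deriv i u) x = F'' * 4 / \<rho>^4 * (x $ i * x $ i) + F' t * 2 / \<rho>\<^sup>2" for i
      using radial_function_second_partial(2)[OF V(1,3) u F F', of i i] by (simp add: t_def)
    then have "(\<Sum>i\<in>UNIV. partial_deriv i (partial_deriv i u) x) =
        F'' * 4 / \<rho>^4 * (t * \<rho>\<^sup>2) + real CARD('n) * (F' t * 2 / \<rho>\<^sup>2)"
      by (simp only: sum.distrib sum_distrib_left[symmetric] nx) simp
    also have "\<dots> = (4 * t * F'' + 4 * c * F' t) / \<rho>\<^sup>2"
      using \<rho> by (simp add: c_def field_simps power4_eq_xxxx power2_eq_square)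
    finally show ?thesis .
  qed
  have s2: "(\<Sum>i\<in>UNIV. x $ i * partial_deriv i u x) = 2 * t * F' t"
  proof -
    have "x $ i * partial_deriv i u x = F' t * 2 / \<rho>\<^sup>2 * (x $ i * x $ i)" for i
      using radial_function_partial(2)[OF V(1,3) u F[OF V(3)], of i] by (simp add: t_def)
    then have "(\<Sum>i\<in>UNIV. x $ i * partial_deriv i u x) = F' t * 2 / \<rho>\<^sup>2 * (t * \<rho>\<^sup>2)"
      by (simp only: sum_distrib_left[symmetric] nx)
    then show ?thesis using \<rho> by simp
  qed
  have nt: "\<rho>\<^sup>2 - (norm x)\<^sup>2 = \<rho>\<^sup>2 * (1 - t)" using \<rho> by (simp add: t_def field_simps)
  have cf: "1 / (conformal_factor \<rho> x)\<^sup>2 = (1 - t)\<^sup>2 / 4"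
    unfolding conformal_factor_def nt using \<rho> t1 by (simp add: field_simps power2_eq_square)
  have "hyp_laplacian \<rho> u x = (1 - t)\<^sup>2 / 4 * ((4 * t * F'' + 4 * c * F' t) / \<rho>\<^sup>2
      + (2 * c - 2) * (2 / (\<rho>\<^sup>2 * (1 - t))) * (2 * t * F' t))"
    unfolding hyp_laplacian_ball[OF \<rho> n W xW] s1 s2 cf nt by (simp add: c_def)
  also have "\<dots> = (t * (1 - t)\<^sup>2 * F'' + (c - 2 * t - (c - 2) * t\<^sup>2) * F' t) / \<rho>\<^sup>2"
    using \<rho> t1 by (simp add: divide_simps) (simp add: algebra_simps power2_eq_square)
  finally show ?thesis .
qed

section \<open>Radial solutions as power series\<close>

text \<open>Taylor coefficients of the solution with value 1 at 0 of
\<open>t (1 - t)\<^sup>2 u'' + (c - 2 t - (c - 2) t\<^sup>2) u' + \<mu> u = 0\<close>, which is the radial eigenvalue equation in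
dimension \<open>2 c\<close>.\<close>

fun radial_coeff :: "real \<Rightarrow> real \<Rightarrow> nat \<Rightarrow> real" where
  "radial_coeff c \<mu> 0 = 1"
| "radial_coeff c \<mu> (Suc 0) = - \<mu> / c"
| "radial_coeff c \<mu> (Suc (Suc m)) =
     ((2 * (real m + 1)\<^sup>2 - \<mu>) * radial_coeff c \<mu> (Suc m)
        - real m * (real m + 1 - c) * radial_coeff c \<mu> m) / ((real m + 2) * (real m + 1 + c))"

lemma radial_coeff_recurrence:
  assumes "c > 0"
  shows "(real m + 2) * (real m + 1 + c) * radial_coeff c \<mu> (Suc (Suc m)) =
    (2 * (real m + 1)\<^sup>2 - \<mu>) * radial_coeff c \<mu> (Suc m)
      - real m * (real m + 1 - c) * radial_coeff c \<mu> m"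
proof -
  have "(real m + 2) * (real m + 1 + c) \<noteq> 0" using assms by (simp add: add_nonneg_eq_0_iff)
  then show ?thesis by simp
qed

text \<open>The limiting recurrence \<open>a\<^sub>m\<^sub>+\<^sub>2 = 2 a\<^sub>m\<^sub>+\<^sub>1 - a\<^sub>m\<close> has the double root 1, and estimating its terms separately
would only give growth like \<open>(1 + \<surd>2)\<^sup>m\<close>.  For the differences the leading factor on the right is no larger than the
one on the left, and the other terms are smaller by a factor of order \<open>1 / m\<^sup>2\<close>.\<close>

lemma radial_coeff_diff_recurrence:
  assumes "c > 0"
  shows "(real m + 2) * (real m + 1 + c) * (radial_coeff c \<mu> (Suc (Suc m)) - radial_coeff c \<mu> (Suc m)) =
    (real m + 1) * (real m - c) * (radial_coeff c \<mu> (Suc m) - radial_coeff c \<mu> m)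
      - (c + \<mu>) * radial_coeff c \<mu> (Suc m) - c * radial_coeff c \<mu> m"
  using radial_coeff_recurrence[OF assms, of m \<mu>]
  by (simp add: algebra_simps power2_eq_square del: radial_coeff.simps)

text \<open>The weight \<open>\<epsilon>\<close> balances two effects: a difference feeds into the next coefficient with weight \<open>\<epsilon>\<close>, and a coefficient
feeds into the next difference only with a factor of order \<open>1 / m\<^sup>2\<close>.\<close>

definition coeff_energy :: "real \<Rightarrow> real \<Rightarrow> real \<Rightarrow> nat \<Rightarrow> real" where
  "coeff_energy \<epsilon> c \<mu> m =
     \<bar>radial_coeff c \<mu> (Suc m) - radial_coeff c \<mu> m\<bar> + \<epsilon> * \<bar>radial_coeff c \<mu> (Suc m)\<bar>"

text \<open>The growth factor tends to \<open>1 + \<epsilon>\<close> and depends on \<open>\<mu>\<close> only through the bound \<open>\<Lambda>\<close>, which makes the resulting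
majorant uniform in \<open>\<mu>\<close>.\<close>

lemma coeff_energy_Suc:
  assumes c: "c > 0" and e: "\<epsilon> > 0" and mu: "\<bar>\<mu>\<bar> \<le> \<Lambda>"
  shows "coeff_energy \<epsilon> c \<mu> (Suc m) \<le>
    (1 + \<epsilon>) * (1 + (c + \<Lambda>) / (real m + 1)\<^sup>2 * (1 + 2 / \<epsilon>)) * coeff_energy \<epsilon> c \<mu> m"
proof -
  define a0 a1 a2 where "a0 = radial_coeff c \<mu> m" and "a1 = radial_coeff c \<mu> (Suc m)"
    and "a2 = radial_coeff c \<mu> (Suc (Suc m))"
  define \<beta> where "\<beta> = (c + \<Lambda>) / (real m + 1)\<^sup>2"
  define N where "N = (real m + 2) * (real m + 1 + c)"
  have L: "\<Lambda> \<ge> 0" using mu by simp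
  have b0: "\<beta> \<ge> 0" using c L by (simp add: \<beta>_def)
  have Npos: "N > 0" unfolding N_def using c by simp
  have N1: "(real m + 1) * \<bar>real m - c\<bar> \<le> N"
    unfolding N_def using c by (intro mult_mono) auto
  have "(real m + 1) * (real m + 1) \<le> N" unfolding N_def using c by (intro mult_mono) auto
  then have "1 \<le> N / (real m + 1)\<^sup>2" by (simp add: power2_eq_square)
  then have "(c + \<Lambda>) * 1 \<le> (c + \<Lambda>) * (N / (real m + 1)\<^sup>2)"
    using c L by (intro mult_left_mono) auto
  then have N2: "c + \<Lambda> \<le> \<beta> * N" by (simp add: \<beta>_def)
  have "N * (a2 - a1) = (real m + 1) * (real m - c) * (a1 - a0) - (c + \<mu>) * a1 - c * a0"
    unfolding N_def a0_def a1_def a2_def using radial_coeff_diff_recurrence[OF c] by simp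
  then have "N * \<bar>a2 - a1\<bar> = \<bar>(real m + 1) * (real m - c) * (a1 - a0) - (c + \<mu>) * a1 - c * a0\<bar>"
    using Npos by (metis abs_mult abs_of_pos)
  also have "\<dots> \<le> \<bar>(real m + 1) * (real m - c) * (a1 - a0)\<bar> + \<bar>(c + \<mu>) * a1\<bar> + \<bar>c * a0\<bar>"
    by linarith
  also have "\<dots> = ((real m + 1) * \<bar>real m - c\<bar>) * \<bar>a1 - a0\<bar> + \<bar>c + \<mu>\<bar> * \<bar>a1\<bar> + c * \<bar>a0\<bar>"
    using c by (simp add: abs_mult)
  also have "\<dots> \<le> N * \<bar>a1 - a0\<bar> + (\<beta> * N) * \<bar>a1\<bar> + (\<beta> * N) * \<bar>a0\<bar>"
    using N1 N2 mu c by (intro add_mono mult_right_mono) auto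
  also have "\<dots> = N * (\<bar>a1 - a0\<bar> + \<beta> * (\<bar>a1\<bar> + \<bar>a0\<bar>))" by (simp add: algebra_simps)
  finally have d: "\<bar>a2 - a1\<bar> \<le> \<bar>a1 - a0\<bar> + \<beta> * (\<bar>a1\<bar> + \<bar>a0\<bar>)" using Npos by simp
  have "\<beta> * (\<bar>a1\<bar> + \<bar>a0\<bar>) \<le> \<beta> * (2 * \<bar>a1\<bar> + \<bar>a1 - a0\<bar>)" using b0 by (intro mult_left_mono) auto
  with d have d': "\<bar>a2 - a1\<bar> \<le> (1 + \<beta>) * \<bar>a1 - a0\<bar> + 2 * \<beta> * \<bar>a1\<bar>" by (simp add: algebra_simps)
  have "\<bar>a2 - a1\<bar> + \<epsilon> * \<bar>a2\<bar> \<le> (1 + \<epsilon>) * \<bar>a2 - a1\<bar> + \<epsilon> * \<bar>a1\<bar>"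
  proof -
    have "\<epsilon> * \<bar>a2\<bar> \<le> \<epsilon> * (\<bar>a2 - a1\<bar> + \<bar>a1\<bar>)" using e by (intro mult_left_mono) auto
    then show ?thesis by (simp add: algebra_simps)
  qed
  also have "\<dots> \<le> (1 + \<epsilon>) * ((1 + \<beta>) * \<bar>a1 - a0\<bar> + 2 * \<beta> * \<bar>a1\<bar>) + (1 + \<epsilon>) * (\<epsilon> * \<bar>a1\<bar>)"
    using d' e by (intro add_mono mult_left_mono) (auto simp: algebra_simps)
  also have "\<dots> \<le> (1 + \<epsilon>) * ((1 + \<beta> * (1 + 2 / \<epsilon>)) * (\<bar>a1 - a0\<bar> + \<epsilon> * \<bar>a1\<bar>))"
  proof -
    have "(1 + \<beta>) * \<bar>a1 - a0\<bar> + 2 * \<beta> * \<bar>a1\<bar> + \<epsilon> * \<bar>a1\<bar> \<le>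
        (1 + \<beta> * (1 + 2 / \<epsilon>)) * (\<bar>a1 - a0\<bar> + \<epsilon> * \<bar>a1\<bar>)"
      using e b0 by (simp add: field_simps)
    then have "(1 + \<epsilon>) * ((1 + \<beta>) * \<bar>a1 - a0\<bar> + 2 * \<beta> * \<bar>a1\<bar> + \<epsilon> * \<bar>a1\<bar>) \<le>
        (1 + \<epsilon>) * ((1 + \<beta> * (1 + 2 / \<epsilon>)) * (\<bar>a1 - a0\<bar> + \<epsilon> * \<bar>a1\<bar>))"
      using e by (intro mult_left_mono) auto
    then show ?thesis by (simp add: algebra_simps)
  qed
  finally show ?thesis
    unfolding coeff_energy_def a0_def a1_def a2_def \<beta>_def by (simp add: mult.assoc)
qed

text \<open>Choosing \<open>\<epsilon>\<close> with \<open>(1 + \<epsilon>) T < 1\<close>, the product of the growth factors times \<open>T\<^sup>m\<close> is summable by the ratio test.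
The uniformity in \<open>\<mu>\<close> serves the joint continuity in \<open>\<mu>\<close> and \<open>t\<close>.\<close>

lemma radial_coeff_majorant:
  assumes c: "c > 0" and L: "\<Lambda> \<ge> 0" and T: "0 < T" "T < 1"
  obtains M where "summable M"
    "\<And>\<mu> m. \<bar>\<mu>\<bar> \<le> \<Lambda> \<Longrightarrow> \<bar>radial_coeff c \<mu> m\<bar> * T ^ m \<le> M m"
proof -
  define \<epsilon> where "\<epsilon> = (1 - T) / 2"
  have e: "\<epsilon> > 0" using T by (simp add: \<epsilon>_def)
  define F where "F m = (1 + \<epsilon>) * (1 + (c + \<Lambda>) / (real m + 1)\<^sup>2 * (1 + 2 / \<epsilon>))" for m :: nat
  define P where "P m = (1 + (1 + \<epsilon>) * (\<Lambda> / c)) * (\<Prod>i<m. F i)" for m :: nat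
  have Fpos: "F m > 0" for m unfolding F_def using e c L
    by (intro mult_pos_pos add_pos_nonneg mult_nonneg_nonneg divide_nonneg_nonneg) auto
  have Ppos: "P m > 0" for m unfolding P_def using e c L Fpos
    by (intro mult_pos_pos prod_pos) (auto intro!: add_pos_nonneg)
  have en: "coeff_energy \<epsilon> c \<mu> m \<le> P m" if mu: "\<bar>\<mu>\<bar> \<le> \<Lambda>" for \<mu> m
  proof (induction m)
    case 0
    have "\<bar>\<mu> / c\<bar> \<le> \<Lambda> / c" using mu c by (simp add: abs_divide divide_right_mono)
    moreover have "\<bar>- \<mu> / c - 1\<bar> \<le> 1 + \<Lambda> / c" using calculation by linarith
    moreover have "\<epsilon> * \<bar>\<mu> / c\<bar> \<le> \<epsilon> * (\<Lambda> / c)"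
      using calculation(1) e by (intro mult_left_mono) auto
    ultimately have "\<bar>- \<mu> / c - 1\<bar> + \<epsilon> * \<bar>- \<mu> / c\<bar> \<le> 1 + \<Lambda> / c + \<epsilon> * (\<Lambda> / c)"
      by (simp add: abs_minus_commute)
    then show ?case unfolding coeff_energy_def P_def
      by (simp add: algebra_simps add_divide_distrib)
  next
    case (Suc m)
    have "coeff_energy \<epsilon> c \<mu> (Suc m) \<le> F m * coeff_energy \<epsilon> c \<mu> m"
      using coeff_energy_Suc[OF c e mu] by (simp add: F_def)
    also have "\<dots> \<le> F m * P m" using Suc Fpos[of m] by (intro mult_left_mono) auto
    also have "\<dots> = P (Suc m)" by (simp add: P_def algebra_simps)
    finally show ?case .
  qed
  define M where "M m = (1 + 1 / \<epsilon>) * P m * T ^ m" for m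
  have bd: "\<bar>radial_coeff c \<mu> m\<bar> * T ^ m \<le> M m" if mu: "\<bar>\<mu>\<bar> \<le> \<Lambda>" for \<mu> m
  proof -
    define x y where "x = \<bar>radial_coeff c \<mu> (Suc m) - radial_coeff c \<mu> m\<bar>"
      and "y = \<bar>radial_coeff c \<mu> (Suc m)\<bar>"
    have xy: "x \<ge> 0" "y \<ge> 0" "x + \<epsilon> * y \<le> P m"
      using en[OF mu, of m] by (auto simp: coeff_energy_def x_def y_def)
    have "\<bar>radial_coeff c \<mu> m\<bar> \<le> x + y" unfolding x_def y_def by linarith
    also have "\<dots> \<le> (1 + 1 / \<epsilon>) * (x + \<epsilon> * y)" using xy(1,2) e by (simp add: field_simps)
    also have "\<dots> \<le> (1 + 1 / \<epsilon>) * P m" using xy(3) e by (intro mult_left_mono) auto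
    finally show ?thesis unfolding M_def using T by (intro mult_right_mono) auto
  qed
  have "(\<lambda>m. F m * T) \<longlonglongrightarrow> ((1 + \<epsilon>) * (1 + 0 * (1 + 2 / \<epsilon>))) * T"
    unfolding F_def by (intro tendsto_intros) real_asymp
  moreover have "((1 + \<epsilon>) * (1 + 0 * (1 + 2 / \<epsilon>))) * T < (1 + T) / 2"
  proof -
    have "(1 - T) * (1 - T) > 0" using T by simp
    moreover have "(1 + \<epsilon>) * T = T + (1 - T) * T / 2" by (simp add: \<epsilon>_def algebra_simps)
    moreover have "(1 - T) * T < 1 - T" using calculation(1) by (simp add: algebra_simps)
    ultimately show ?thesis by simp
  qed
  ultimately have "eventually (\<lambda>m. F m * T < (1 + T) / 2) sequentially"
    by (rule order_tendstoD(2))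
  then obtain N where N: "\<And>m. m \<ge> N \<Longrightarrow> F m * T < (1 + T) / 2"
    by (auto simp: eventually_sequentially)
  have "summable M"
  proof (rule summable_ratio_test[of "(1 + T) / 2" N])
    show "(1 + T) / 2 < 1" using T by simp
    fix m assume "N \<le> m"
    then have "F m * T \<le> (1 + T) / 2" using N by fastforce
    moreover have "M m > 0" unfolding M_def using e Ppos[of m] T
      by (intro mult_pos_pos add_pos_pos divide_pos_pos) auto
    moreover have "M (Suc m) = (F m * T) * M m" by (simp add: M_def P_def)
    moreover have "F m * T > 0" using Fpos[of m] T by simp
    ultimately show "norm (M (Suc m)) \<le> (1 + T) / 2 * norm (M m)"
      by (simp add: abs_mult mult_right_mono)
  qed
  then show thesis using bd that by blast
qed

definition radial_fps :: "real \<Rightarrow> real \<Rightarrow> real fps" where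
  "radial_fps c \<mu> = Abs_fps (radial_coeff c \<mu>)"

lemma fps_conv_radius_radial_fps:
  assumes "c > 0"
  shows "fps_conv_radius (radial_fps c \<mu>) \<ge> 1"
  unfolding fps_conv_radius_def
proof (rule conv_radius_geI_ex')
  fix r :: real assume r: "0 < r" "ereal r < 1"
  then have r1: "r < 1" by (simp add: one_ereal_def)
  obtain M where M: "summable M" "\<And>\<nu> m. \<bar>\<nu>\<bar> \<le> \<bar>\<mu>\<bar> \<Longrightarrow> \<bar>radial_coeff c \<nu> m\<bar> * r ^ m \<le> M m"
    using radial_coeff_majorant[OF assms _ r(1) r1, of "\<bar>\<mu>\<bar>"] by auto
  show "summable (\<lambda>n. fps_nth (radial_fps c \<mu>) n * of_real r ^ n)"
    by (rule summable_comparison_test'[OF M(1), of 0])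
      (use M(2)[of \<mu>] r in \<open>auto simp: radial_fps_def abs_mult\<close>)
qed

lemma radial_fps_ode:
  assumes "c > 0"
  shows "fps_X * (1 - fps_X)\<^sup>2 * fps_deriv (fps_deriv (radial_fps c \<mu>))
    + (fps_const c - 2 * fps_X - fps_const (c - 2) * fps_X\<^sup>2) * fps_deriv (radial_fps c \<mu>)
    + fps_const \<mu> * radial_fps c \<mu> = 0" (is "?F = 0")
proof (rule fps_ext)
  fix m
  have eq: "?F = fps_X * fps_deriv (fps_deriv (radial_fps c \<mu>))
     - 2 * (fps_X ^ 2 * fps_deriv (fps_deriv (radial_fps c \<mu>)))
     + fps_X ^ 3 * fps_deriv (fps_deriv (radial_fps c \<mu>))
     + fps_const c * fps_deriv (radial_fps c \<mu>) - 2 * (fps_X * fps_deriv (radial_fps c \<mu>))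
     - fps_const (c - 2) * (fps_X ^ 2 * fps_deriv (radial_fps c \<mu>)) + fps_const \<mu> * radial_fps c \<mu>"
    by (simp add: algebra_simps power2_eq_square power3_eq_cube)
  have two: "(2 :: real fps) = fps_const 2" by (simp add: numeral_fps_const)
  show "fps_nth ?F m = fps_nth 0 m"
  proof (cases m)
    case 0
    then show ?thesis using assms unfolding eq two by (simp add: fps_X_power_mult_nth radial_fps_def)
  next
    case (Suc l)
    note rec = radial_coeff_recurrence[OF assms, of l \<mu>]
    show ?thesis
    proof (cases "l \<ge> 2")
      case True
      then obtain i where l: "l = Suc (Suc i)" by (metis add_2_eq_Suc le_Suc_ex)
      show ?thesis using rec unfolding eq two Suc l
        by (simp add: fps_X_power_mult_nth radial_fps_def algebra_simps power2_eq_square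
            del: radial_coeff.simps)
    next
      case False
      then have "l = 0 \<or> l = 1" by auto
      then show ?thesis using rec unfolding eq two Suc
        by (auto simp: fps_X_power_mult_nth radial_fps_def algebra_simps power2_eq_square
            simp del: radial_coeff.simps)
    qed
  qed
qed

definition ball_profile :: "real \<Rightarrow> real \<Rightarrow> real \<Rightarrow> real" where
  "ball_profile c \<mu> = eval_fps (radial_fps c \<mu>)"

definition ball_profile' :: "real \<Rightarrow> real \<Rightarrow> real \<Rightarrow> real" where
  "ball_profile' c \<mu> = eval_fps (fps_deriv (radial_fps c \<mu>))"

definition ball_profile'' :: "real \<Rightarrow> real \<Rightarrow> real \<Rightarrow> real" where
  "ball_profile'' c \<mu> = eval_fps (fps_deriv (fps_deriv (radial_fps c \<mu>)))"

lemma less_conv_radius_radial_fps_derivs: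
  fixes t :: real
  assumes "c > 0" "\<bar>t\<bar> < 1"
  shows "ereal (norm t) < fps_conv_radius (radial_fps c \<mu>)"
    and "ereal (norm t) < fps_conv_radius (fps_deriv (radial_fps c \<mu>))"
    and "ereal (norm t) < fps_conv_radius (fps_deriv (fps_deriv (radial_fps c \<mu>)))"
proof -
  have "ereal (norm t) < 1" using assms by (simp add: one_ereal_def)
  then show 1: "ereal (norm t) < fps_conv_radius (radial_fps c \<mu>)"
    using fps_conv_radius_radial_fps[OF assms(1)] by (rule less_le_trans)
  show 2: "ereal (norm t) < fps_conv_radius (fps_deriv (radial_fps c \<mu>))"
    using 1 fps_conv_radius_deriv less_le_trans by blast
  show "ereal (norm t) < fps_conv_radius (fps_deriv (fps_deriv (radial_fps c \<mu>)))"
    using 2 fps_conv_radius_deriv less_le_trans by blast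
qed

lemma ball_profile_has_derivative:
  assumes "c > 0" "\<bar>t\<bar> < 1"
  shows "(ball_profile c \<mu> has_real_derivative ball_profile' c \<mu> t) (at t within A)"
    and "(ball_profile' c \<mu> has_real_derivative ball_profile'' c \<mu> t) (at t within A)"
    and "continuous (at t) (ball_profile'' c \<mu>)"
  using less_conv_radius_radial_fps_derivs[OF assms]
  unfolding ball_profile_def ball_profile'_def ball_profile''_def
  by (auto intro!: has_field_derivative_eval_fps DERIV_isCont)

lemma ball_profile_ode:
  assumes c: "c > 0" and t: "\<bar>t\<bar> < 1"
  shows "t * (1 - t)\<^sup>2 * ball_profile'' c \<mu> t
    + (c - 2 * t - (c - 2) * t\<^sup>2) * ball_profile' c \<mu> t + \<mu> * ball_profile c \<mu> t = 0"
proof -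
  define F where "F = radial_fps c \<mu>"
  define G where "G = fps_deriv F"
  define H where "H = fps_deriv G"
  have r: "ereal (norm t) < fps_conv_radius F" "ereal (norm t) < fps_conv_radius G"
    "ereal (norm t) < fps_conv_radius H"
    using less_conv_radius_radial_fps_derivs[OF assms] by (simp_all add: F_def G_def H_def)
  define p where "p = fps_of_poly [:0, 1, -2, 1 :: real:]"
  define q where "q = fps_of_poly [:c, -2, - (c - 2):]"
  have p: "fps_X * (1 - fps_X)\<^sup>2 = p"
    unfolding p_def by (simp add: fps_of_poly_pCons algebra_simps power2_eq_square numeral_fps_const)
  have q: "fps_const c - 2 * fps_X - fps_const (c - 2) * fps_X\<^sup>2 = q"
    unfolding q_def by (simp add: fps_of_poly_pCons algebra_simps power2_eq_square numeral_fps_const)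
  have "p * H + q * G + fps_const \<mu> * F = 0"
    using radial_fps_ode[OF c, of \<mu>] unfolding p q H_def G_def F_def .
  then have "eval_fps (p * H + q * G + fps_const \<mu> * F) t = 0" by simp
  moreover have rp: "fps_conv_radius p = \<infinity>" "fps_conv_radius q = \<infinity>" by (simp_all add: p_def q_def)
  have rr: "ereal (norm t) < fps_conv_radius (p * H)" "ereal (norm t) < fps_conv_radius (q * G)"
     "ereal (norm t) < fps_conv_radius (fps_const \<mu> * F)"
    using r rp fps_conv_radius_mult[of p H] fps_conv_radius_mult[of q G]
      fps_conv_radius_mult[of "fps_const \<mu>" F]
    by (auto intro: less_le_trans)
  moreover have "ereal (norm t) < fps_conv_radius (p * H + q * G)"
    using rr fps_conv_radius_add[of "p * H" "q * G"] by (meson less_le_trans min_less_iff_conj)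
  ultimately have "eval_fps p t * eval_fps H t + eval_fps q t * eval_fps G t + \<mu> * eval_fps F t = 0"
    using r rp by (simp add: eval_fps_add eval_fps_mult)
  moreover have "eval_fps p t = t * (1 - t)\<^sup>2"
    unfolding p_def by (simp add: algebra_simps power2_eq_square)
  moreover have "eval_fps q t = c - 2 * t - (c - 2) * t\<^sup>2"
    unfolding q_def by (simp add: algebra_simps power2_eq_square)
  ultimately show ?thesis
    by (simp add: ball_profile_def ball_profile'_def ball_profile''_def F_def G_def H_def)
qed

lemma ball_profile_at_0 [simp]: "ball_profile c \<mu> 0 = 1"
  by (simp add: ball_profile_def eval_fps_at_0 radial_fps_def)

lemma ball_profile_eigenvalue_0 [simp]: "ball_profile c 0 t = 1"
proof -
  have "radial_coeff c 0 m = (if m = 0 then 1 else 0)" for m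
  proof (induction c "0 :: real" m rule: radial_coeff.induct)
    case (3 c m)
    then show ?case by (cases m) auto
  qed auto
  then have "radial_fps c 0 = 1" by (auto simp: radial_fps_def fps_eq_iff)
  then show ?thesis by (simp add: ball_profile_def)
qed

lemma continuous_on_radial_coeff: "continuous_on A (\<lambda>\<mu>. radial_coeff c \<mu> m)"
proof (cases "c = 0")
  case True
  then show ?thesis
    by (induction c "0 :: real" m rule: radial_coeff.induct) (auto intro!: continuous_intros)
next
  case False
  have "continuous_on A (\<lambda>\<mu>. radial_coeff c \<mu> m) \<and> continuous_on A (\<lambda>\<mu>. radial_coeff c \<mu> (Suc m))"
    by (induction m) (auto simp: divide_inverse intro!: continuous_intros)
  then show ?thesis ..
qed

lemma continuous_on_ball_profile:
  assumes c: "c > 0" and T: "T < 1"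
  shows "continuous_on ({- \<Lambda>..\<Lambda>} \<times> {-T..T}) (\<lambda>(\<mu>, t). ball_profile c \<mu> t)"
proof (cases "\<Lambda> \<ge> 0 \<and> T > 0")
  case True
  obtain M where M: "summable M" "\<And>\<mu> m. \<bar>\<mu>\<bar> \<le> \<Lambda> \<Longrightarrow> \<bar>radial_coeff c \<mu> m\<bar> * T ^ m \<le> M m"
    using radial_coeff_majorant[OF c _ _ T, of \<Lambda>] True by blast
  have "uniform_limit ({- \<Lambda>..\<Lambda>} \<times> {-T..T}) (\<lambda>n x. \<Sum>i<n. radial_coeff c (fst x) i * snd x ^ i)
      (\<lambda>x. \<Sum>i. radial_coeff c (fst x) i * snd x ^ i) sequentially"
  proof (rule Weierstrass_m_test[OF _ M(1)])
    fix n x assume x: "x \<in> {- \<Lambda>..\<Lambda>} \<times> {-T..T}"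
    have "norm (radial_coeff c (fst x) n * snd x ^ n) = \<bar>radial_coeff c (fst x) n\<bar> * \<bar>snd x\<bar> ^ n"
      by (simp add: abs_mult power_abs)
    also have "\<dots> \<le> \<bar>radial_coeff c (fst x) n\<bar> * T ^ n"
      using x by (intro mult_left_mono power_mono) auto
    also have "\<dots> \<le> M n" using x by (intro M(2)) auto
    finally show "norm (radial_coeff c (fst x) n * snd x ^ n) \<le> M n" .
  qed
  then have "continuous_on ({- \<Lambda>..\<Lambda>} \<times> {-T..T}) (\<lambda>x. \<Sum>i. radial_coeff c (fst x) i * snd x ^ i)"
    by (rule uniform_limit_theorem[rotated])
      (auto intro!: always_eventually continuous_intros
        continuous_on_compose2[OF continuous_on_radial_coeff[of UNIV]])
  then show ?thesis
    by (simp add: ball_profile_def eval_fps_def radial_fps_def case_prod_beta)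
next
  case False
  then consider "\<Lambda> < 0" | "T < 0" | "T = 0" by linarith
  then show ?thesis
  proof cases
    case 3
    have "continuous_on ({- \<Lambda>..\<Lambda>} \<times> {-T..T}) (\<lambda>_. 1 :: real)" by simp
    then show ?thesis by (rule continuous_on_eq) (auto simp: 3)
  qed auto
qed

text \<open>The same solution in the normalised distance \<open>s\<close> from the centre: it solves
\<open>f'' + (2 c - 1) coth s f' + \<mu> f = 0\<close> with \<open>f 0 = 1\<close> and \<open>f' 0 = 0\<close>.\<close>

definition geodesic_profile :: "real \<Rightarrow> real \<Rightarrow> real \<Rightarrow> real" where
  "geodesic_profile c \<mu> s = ball_profile c \<mu> ((tanh (s / 2))\<^sup>2)"

text \<open>The substitution \<open>t = tanh\<^sup>2 (s / 2)\<close> has \<open>dt/ds = \<tau> (1 - \<tau>\<^sup>2)\<close> with \<open>\<tau> = tanh (s / 2)\<close>, and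
\<open>coth s = (1 + \<tau>\<^sup>2) / (2 \<tau>)\<close>; it turns the equation in \<open>t\<close> into the one in geodesic distance.  It is stated
for an arbitrary solution because it is also applied to radial eigenfunctions that are not known to be power series.\<close>

lemma geodesic_chain_rule:
  fixes U U1 :: "real \<Rightarrow> real" and U2 c \<mu> y s :: real
  defines "\<tau> \<equiv> tanh (s / 2)"
  shows "(U has_real_derivative U1 (\<tau>\<^sup>2)) (at (\<tau>\<^sup>2)) \<Longrightarrow>
      ((\<lambda>s. U ((tanh (s / 2))\<^sup>2)) has_real_derivative U1 (\<tau>\<^sup>2) * (\<tau> * (1 - \<tau>\<^sup>2))) (at s)"
    and "(U1 has_real_derivative U2) (at (\<tau>\<^sup>2)) \<Longrightarrow>
      s \<noteq> 0 \<Longrightarrow>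
      \<tau>\<^sup>2 * (1 - \<tau>\<^sup>2)\<^sup>2 * U2 + (c - 2 * \<tau>\<^sup>2 - (c - 2) * (\<tau>\<^sup>2)\<^sup>2) * U1 (\<tau>\<^sup>2) + \<mu> * y = 0 \<Longrightarrow>
      ((\<lambda>s. U1 ((tanh (s / 2))\<^sup>2) * (tanh (s / 2) * (1 - (tanh (s / 2))\<^sup>2))) has_real_derivative
         - (2 * c - 1) * (cosh s / sinh s) * (U1 (\<tau>\<^sup>2) * (\<tau> * (1 - \<tau>\<^sup>2))) - \<mu> * y) (at s)"
proof -
  have d0: "((\<lambda>s. tanh (s / 2)) has_real_derivative (1 - \<tau>\<^sup>2) / 2) (at s)"
    unfolding \<tau>_def by (auto intro!: derivative_eq_intros)
  have d: "((\<lambda>s. (tanh (s / 2))\<^sup>2) has_real_derivative \<tau> * (1 - \<tau>\<^sup>2)) (at s)"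
    unfolding \<tau>_def by (auto intro!: derivative_eq_intros)
  show "((\<lambda>s. U ((tanh (s / 2))\<^sup>2)) has_real_derivative U1 (\<tau>\<^sup>2) * (\<tau> * (1 - \<tau>\<^sup>2))) (at s)"
    if "(U has_real_derivative U1 (\<tau>\<^sup>2)) (at (\<tau>\<^sup>2))"
    using DERIV_chain2[OF that[unfolded \<tau>_def] d] by (simp add: \<tau>_def)
  assume 1: "(U1 has_real_derivative U2) (at (\<tau>\<^sup>2))" and "s \<noteq> 0"
    and ode: "\<tau>\<^sup>2 * (1 - \<tau>\<^sup>2)\<^sup>2 * U2 + (c - 2 * \<tau>\<^sup>2 - (c - 2) * (\<tau>\<^sup>2)\<^sup>2) * U1 (\<tau>\<^sup>2) + \<mu> * y = 0"
  have tau0: "\<tau> \<noteq> 0" using \<open>s \<noteq> 0\<close> by (simp add: \<tau>_def)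
  have tau1: "1 - \<tau>\<^sup>2 \<noteq> 0"
    using tanh_real_bounds[of "s / 2"] by (auto simp: \<tau>_def power2_eq_1_iff)
  have coth: "cosh s / sinh s = (1 + \<tau>\<^sup>2) / (2 * \<tau>)"
  proof -
    have "cosh s = (cosh (s/2))\<^sup>2 + (sinh (s/2))\<^sup>2" "sinh s = 2 * sinh (s/2) * cosh (s/2)"
      using cosh_double[of "s/2"] sinh_double[of "s/2"] by auto
    then show ?thesis
      using \<open>s \<noteq> 0\<close> by (simp add: \<tau>_def tanh_def field_simps power2_eq_square)
  qed
  have d1: "((\<lambda>s. U1 ((tanh (s / 2))\<^sup>2)) has_real_derivative U2 * (\<tau> * (1 - \<tau>\<^sup>2))) (at s)"
    using DERIV_chain2[OF 1[unfolded \<tau>_def] d] by (simp add: \<tau>_def)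
  have d2: "((\<lambda>s. tanh (s / 2) * (1 - (tanh (s / 2))\<^sup>2)) has_real_derivative
     (1 - \<tau>\<^sup>2) * (1 - 3 * \<tau>\<^sup>2) / 2) (at s)"
    using DERIV_mult'[OF d0 DERIV_diff[OF DERIV_const[of 1] d]]
    by (simp add: \<tau>_def[symmetric] field_simps power2_eq_square)
  have "U1 (\<tau>\<^sup>2) * ((1 - \<tau>\<^sup>2) * (1 - 3 * \<tau>\<^sup>2) / 2) + U2 * (\<tau> * (1 - \<tau>\<^sup>2)) * (\<tau> * (1 - \<tau>\<^sup>2)) =
     - (2 * c - 1) * (cosh s / sinh s) * (U1 (\<tau>\<^sup>2) * (\<tau> * (1 - \<tau>\<^sup>2))) - \<mu> * y"
  proof -
    have e1: "- (2 * c - 1) * (cosh s / sinh s) * (U1 (\<tau>\<^sup>2) * (\<tau> * (1 - \<tau>\<^sup>2))) =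
        - (2 * c - 1) * (1 + \<tau>\<^sup>2) * (1 - \<tau>\<^sup>2) / 2 * U1 (\<tau>\<^sup>2)"
      unfolding coth using tau0 by (simp add: field_simps)
    have e2: "\<mu> * y = - (\<tau>\<^sup>2 * (1 - \<tau>\<^sup>2)\<^sup>2 * U2 + (c - 2 * \<tau>\<^sup>2 - (c - 2) * (\<tau>\<^sup>2)\<^sup>2) * U1 (\<tau>\<^sup>2))"
      using ode by linarith
    show ?thesis unfolding e1 e2 by (simp add: field_simps power2_eq_square)
  qed
  then show "((\<lambda>s. U1 ((tanh (s / 2))\<^sup>2) * (tanh (s / 2) * (1 - (tanh (s / 2))\<^sup>2))) has_real_derivative
         - (2 * c - 1) * (cosh s / sinh s) * (U1 (\<tau>\<^sup>2) * (\<tau> * (1 - \<tau>\<^sup>2))) - \<mu> * y) (at s)"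
    using DERIV_mult'[OF d1 d2] by (simp add: \<tau>_def)
qed

definition geodesic_profile' :: "real \<Rightarrow> real \<Rightarrow> real \<Rightarrow> real" where
  "geodesic_profile' c \<mu> s =
     ball_profile' c \<mu> ((tanh (s / 2))\<^sup>2) * (tanh (s / 2) * (1 - (tanh (s / 2))\<^sup>2))"

lemma tanh_square_less_1: "\<bar>(tanh (x :: real))\<^sup>2\<bar> < 1"
  using tanh_real_bounds[of x] by (simp add: abs_square_less_1 abs_less_iff)

lemma geodesic_profile_deriv:
  assumes "c > 0"
  shows "(geodesic_profile c \<mu> has_real_derivative geodesic_profile' c \<mu> s) (at s)"
  using geodesic_chain_rule(1)[where U = "ball_profile c \<mu>" and ?U1.0 = "ball_profile' c \<mu>" and s = s, OF ball_profile_has_derivative(1)[OF assms tanh_square_less_1[of "s / 2"]]]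
  unfolding geodesic_profile_def[abs_def] geodesic_profile'_def by simp

lemma geodesic_profile'_deriv:
  assumes "c > 0" "s \<noteq> 0"
  shows "(geodesic_profile' c \<mu> has_real_derivative
    - (2 * c - 1) * (cosh s / sinh s) * geodesic_profile' c \<mu> s - \<mu> * geodesic_profile c \<mu> s) (at s)"
  using geodesic_chain_rule(2)[where ?U1.0 = "ball_profile' c \<mu>" and ?U2.0 = "ball_profile'' c \<mu> ((tanh (s / 2))\<^sup>2)" and s = s, OF ball_profile_has_derivative(2)[OF assms(1) tanh_square_less_1[of "s / 2"]] assms(2)
    ball_profile_ode[OF assms(1) tanh_square_less_1[of "s / 2"]]]
  unfolding geodesic_profile_def[abs_def] geodesic_profile'_def[abs_def] by simp

lemma continuous_on_geodesic_profile:
  assumes "c > 0"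
  shows "continuous_on A (geodesic_profile c \<mu>)" "continuous_on A (geodesic_profile' c \<mu>)"
proof -
  show "continuous_on A (geodesic_profile c \<mu>)"
    using geodesic_profile_deriv[OF assms] by (meson DERIV_isCont continuous_at_imp_continuous_on)
  have "continuous_on {-1<..<1} (ball_profile' c \<mu>)"
    by (intro continuous_at_imp_continuous_on ballI DERIV_isCont)
      (rule ball_profile_has_derivative(2)[OF assms], auto)
  moreover have sq: "-1 < (tanh x)\<^sup>2" for x :: real
    using zero_le_power2[of "tanh x"] by linarith
  ultimately have "continuous_on A (\<lambda>s. ball_profile' c \<mu> ((tanh (s / 2))\<^sup>2))"
    using tanh_square_less_1
    by (elim continuous_on_compose2) (auto intro!: continuous_intros simp: abs_less_iff intro: sq)
  then show "continuous_on A (geodesic_profile' c \<mu>)"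
    unfolding geodesic_profile'_def[abs_def] by (auto intro!: continuous_intros)
qed

lemma geodesic_profile_at_0 [simp]:
  "geodesic_profile c \<mu> 0 = 1" "geodesic_profile' c \<mu> 0 = 0" "geodesic_profile c 0 s = 1"
  by (simp_all add: geodesic_profile_def geodesic_profile'_def)

lemma continuous_on_geodesic_profile2:
  assumes "c > 0"
  shows "continuous_on ({- \<Lambda>..\<Lambda>} \<times> {0..d}) (\<lambda>(\<mu>, s). geodesic_profile c \<mu> s)"
proof -
  define T where "T = (tanh (d / 2))\<^sup>2"
  have T: "T < 1" using tanh_square_less_1[of "d / 2"] by (simp add: T_def)
  have "continuous_on ({- \<Lambda>..\<Lambda>} \<times> {0..d})
     (\<lambda>x. (\<lambda>(\<mu>, t). ball_profile c \<mu> t) (fst x, (tanh (snd x / 2))\<^sup>2))"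
  proof (rule continuous_on_compose2[OF continuous_on_ball_profile[OF assms T, of \<Lambda>]])
    have "(tanh (s / 2))\<^sup>2 \<le> T" if "0 \<le> s" "s \<le> d" for s
      unfolding T_def using that by (intro power_mono) auto
    then show "(\<lambda>x. (fst x, (tanh (snd x / 2))\<^sup>2)) ` ({- \<Lambda>..\<Lambda>} \<times> {0..d}) \<subseteq> {- \<Lambda>..\<Lambda>} \<times> {- T..T}"
      by (auto simp: T_def intro: order_trans[of _ 0])
  qed (auto intro!: continuous_intros)
  then show ?thesis by (simp add: geodesic_profile_def case_prod_beta)
qed

section \<open>Sturm comparison and the first Dirichlet zero\<close>

text \<open>The Wronskian \<open>g' h - g h'\<close> of \<open>g = sinh\<^sup>k\<^sup>/\<^sup>2 f\<close> and \<open>h\<close>, written in terms of \<open>f\<close>.\<close>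

definition liouville_wronskian ::
  "real \<Rightarrow> (real \<Rightarrow> real) \<Rightarrow> (real \<Rightarrow> real) \<Rightarrow> (real \<Rightarrow> real) \<Rightarrow> (real \<Rightarrow> real) \<Rightarrow> real \<Rightarrow> real" where
  "liouville_wronskian k f f' h h' s =
     sinh s powr (k / 2) * (f' s * h s + f s * (k / 2 * (cosh s / sinh s) * h s - h' s))"

lemma liouville_wronskian_deriv:
  assumes s: "s > 0"
    and f: "(f has_real_derivative f' s) (at s)"
    and f': "(f' has_real_derivative - k * (cosh s / sinh s) * f' s - \<mu> * f s) (at s)"
    and h: "(h has_real_derivative h' s) (at s)"
    and h': "(h' has_real_derivative h'') (at s)"
  shows "(liouville_wronskian k f f' h h' has_real_derivative
    sinh s powr (k / 2) * f s * ((k\<^sup>2 / 4 - \<mu> + k * (k - 2) / (4 * (sinh s)\<^sup>2)) * h s - h'')) (at s)"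
proof -
  define S C where "S = sinh s" and "C = cosh s"
  have S: "S > 0" using s by (simp add: S_def)
  have CS: "C\<^sup>2 = 1 + S\<^sup>2" unfolding C_def S_def by (simp add: cosh_square_eq)
  have p: "((\<lambda>s. sinh s powr (k / 2)) has_real_derivative S powr (k / 2) * (k / 2 * (C / S))) (at s)"
  proof -
    have "((\<lambda>s. sinh s powr (k / 2)) has_real_derivative k / 2 * S powr (k / 2 - 1) * C) (at s)"
      unfolding S_def C_def
      by (rule DERIV_chain2[OF has_real_derivative_powr])
        (use S in \<open>auto intro!: derivative_eq_intros simp: S_def\<close>)
    moreover have "S powr (k / 2 - 1) = S powr (k / 2) / S" using S by (simp add: powr_diff)
    ultimately show ?thesis by (simp add: mult_ac)
  qed
  have coth: "((\<lambda>s. cosh s / sinh s) has_real_derivative - 1 / S\<^sup>2) (at s)"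
    using S CS unfolding S_def C_def
    by (auto intro!: derivative_eq_intros simp: power2_eq_square)
  have V: "((\<lambda>s. f' s * h s + f s * (k / 2 * (cosh s / sinh s) * h s - h' s)) has_real_derivative
     (- k * (C / S) * f' s - \<mu> * f s) * h s + h' s * f' s
     + (f' s * (k / 2 * (C / S) * h s - h' s)
       + f s * (k / 2 * (- 1 / S\<^sup>2) * h s + k / 2 * (C / S) * h' s - h''))) (at s)"
    unfolding S_def C_def
    by (rule derivative_eq_intros f f' h h' coth refl)+
      (simp add: S_def C_def algebra_simps)
  have eq: "k / 2 * (C / S) * (f' s * h s + f s * (k / 2 * (C / S) * h s - h' s))
     + ((- k * (C / S) * f' s - \<mu> * f s) * h s + h' s * f' s
     + (f' s * (k / 2 * (C / S) * h s - h' s)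
       + f s * (k / 2 * (- 1 / S\<^sup>2) * h s + k / 2 * (C / S) * h' s - h'')))
     = f s * ((k\<^sup>2 / 4 - \<mu> + k * (k - 2) / (4 * S\<^sup>2)) * h s - h'')"
  proof -
    have c2: "(C / S)\<^sup>2 = 1 + 1 / S\<^sup>2" using S CS by (simp add: power_divide field_simps)
    have "k / 2 * (C / S) * (f' s * h s + f s * (k / 2 * (C / S) * h s - h' s))
     + ((- k * (C / S) * f' s - \<mu> * f s) * h s + h' s * f' s
     + (f' s * (k / 2 * (C / S) * h s - h' s)
       + f s * (k / 2 * (- 1 / S\<^sup>2) * h s + k / 2 * (C / S) * h' s - h'')))
     = f s * ((k\<^sup>2 / 4 * (C / S)\<^sup>2 - \<mu> - k / 2 * (1 / S\<^sup>2)) * h s - h'')"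
      by (simp add: algebra_simps power2_eq_square)
    also have "\<dots> = f s * ((k\<^sup>2 / 4 - \<mu> + k * (k - 2) / (4 * S\<^sup>2)) * h s - h'')"
      unfolding c2 using S by (simp add: field_simps power2_eq_square)
    finally show ?thesis .
  qed
  have "(liouville_wronskian k f f' h h' has_real_derivative
     S powr (k / 2) * (k / 2 * (C / S) * (f' s * h s + f s * (k / 2 * (C / S) * h s - h' s))
     + ((- k * (C / S) * f' s - \<mu> * f s) * h s + h' s * f' s
     + (f' s * (k / 2 * (C / S) * h s - h' s)
       + f s * (k / 2 * (- 1 / S\<^sup>2) * h s + k / 2 * (C / S) * h' s - h''))))) (at s)"
    unfolding liouville_wronskian_def[abs_def]
    using DERIV_mult'[OF p V] by (simp add: S_def C_def algebra_simps)
  then show ?thesis unfolding eq by (simp add: S_def mult.assoc)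
qed

text \<open>The Wronskians have a removable singularity at 0, hence only a one-sided limit is assumed there.\<close>

lemma positive_if_increasing_from_0:
  fixes W :: "real \<Rightarrow> real"
  assumes d: "d > 0" and lim: "(W \<longlongrightarrow> 0) (at_right 0)"
    and der: "\<And>s. 0 < s \<Longrightarrow> s < d \<Longrightarrow> \<exists>y. (W has_real_derivative y) (at s) \<and> y > 0"
    and cont: "continuous_on {0<..d} W"
  shows "W d > 0"
proof -
  have "W s < W (d / 2)" if "0 < s" "s < d / 2" for s
    by (rule DERIV_pos_imp_increasing_open[OF that(2)])
      (use that d der in \<open>auto intro: continuous_on_subset[OF cont]\<close>)
  then have "eventually (\<lambda>s. W s \<le> W (d / 2)) (at_right 0)"
    unfolding eventually_at_right_field using d by (intro exI[of _ "d / 2"]) (auto intro: less_imp_le)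
  then have "0 \<le> W (d / 2)" using lim by (intro tendsto_upperbound[of W 0]) auto
  also have "\<dots> < W d"
    by (rule DERIV_pos_imp_increasing_open)
      (use d der in \<open>auto intro: continuous_on_subset[OF cont]\<close>)
  finally show ?thesis .
qed

lemma geodesic_profile_tendsto_0:
  assumes "c > 0"
  shows "(geodesic_profile c \<mu> \<longlongrightarrow> 1) (at_right 0)" "(geodesic_profile' c \<mu> \<longlongrightarrow> 0) (at_right 0)"
  using continuous_on_geodesic_profile[OF assms, of UNIV \<mu>]
  by (auto simp: continuous_on_def dest!: spec[of _ 0] intro: tendsto_within_subset)

lemma liouville_wronskian_continuous:
  assumes "c > 0" "continuous_on {0<..d} h" "continuous_on {0<..d} h'"
  shows "continuous_on {0<..d}
    (liouville_wronskian k (geodesic_profile c \<mu>) (geodesic_profile' c \<mu>) h h')"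
  unfolding liouville_wronskian_def[abs_def]
  by (intro continuous_intros assms continuous_on_geodesic_profile) auto

text \<open>Comparison with \<open>h s = sin (\<pi> s / d)\<close>: the Wronskian vanishes at both ends, so its derivative
\<open>sinh\<^sup>k\<^sup>/\<^sup>2 f h (k\<^sup>2 / 4 + (\<pi> / d)\<^sup>2 - \<mu> + k (k - 2) / (4 sinh\<^sup>2))\<close> cannot have a strict sign.  The sign
\<open>\<sigma>\<close> treats both possibilities at once.\<close>

lemma dirichlet_comparison_sin:
  assumes c: "c \<ge> 1" and k: "k = 2 * c - 1" and d: "d > 0"
    and pos: "\<And>s. 0 < s \<Longrightarrow> s < d \<Longrightarrow> geodesic_profile c \<mu> s > 0"
    and zero: "geodesic_profile c \<mu> d = 0"
    and \<sigma>: "\<sigma> = 1 \<or> \<sigma> = -1"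
  shows "\<exists>s. 0 < s \<and> s < d \<and> \<sigma> * (k\<^sup>2 / 4 + (pi / d)\<^sup>2 - \<mu> + k * (k - 2) / (4 * (sinh s)\<^sup>2)) \<le> 0"
proof (rule ccontr)
  assume "\<not> ?thesis"
  then have sgn: "\<sigma> * (k\<^sup>2 / 4 + (pi / d)\<^sup>2 - \<mu> + k * (k - 2) / (4 * (sinh s)\<^sup>2)) > 0"
    if "0 < s" "s < d" for s
    using that by force
  have c0: "c > 0" using c by simp
  define \<omega> where "\<omega> = pi / d"
  have w: "\<omega> > 0" using d by (simp add: \<omega>_def)
  define h h' where "h s = \<sigma> * sin (\<omega> * s)" and "h' s = \<sigma> * (\<omega> * cos (\<omega> * s))" for s
  define W where "W = liouville_wronskian k (geodesic_profile c \<mu>) (geodesic_profile' c \<mu>) h h'"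
  have dh: "(h has_real_derivative h' s) (at s)" for s
    unfolding h_def[abs_def] h'_def by (auto intro!: derivative_eq_intros)
  have dh': "(h' has_real_derivative - \<omega>\<^sup>2 * h s) (at s)" for s
    unfolding h_def h'_def[abs_def] by (auto intro!: derivative_eq_intros simp: power2_eq_square)
  have "W d > 0"
  proof (rule positive_if_increasing_from_0[OF d])
    have l1: "((\<lambda>s. sinh s powr (k / 2)) \<longlongrightarrow> 0) (at_right 0)"
      using c k by real_asymp
    have l2: "((\<lambda>s. k / 2 * (cosh s / sinh s) * h s) \<longlongrightarrow> k / 2 * (\<sigma> * \<omega>)) (at_right 0)"
    proof -
      have "((\<lambda>s. cosh s / sinh s * sin (\<omega> * s)) \<longlongrightarrow> \<omega>) (at_right 0)" using w by real_asymp
      from tendsto_mult[OF tendsto_const[of "k / 2 * \<sigma>"] this] show ?thesis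
        by (simp add: h_def mult_ac)
    qed
    have l3: "(h \<longlongrightarrow> \<sigma> * sin (\<omega> * 0)) (at_right 0)" "(h' \<longlongrightarrow> \<sigma> * (\<omega> * cos (\<omega> * 0))) (at_right 0)"
      unfolding h_def[abs_def] h'_def[abs_def] by (intro tendsto_intros)+
    have "(W \<longlongrightarrow> 0 * (0 * (\<sigma> * sin (\<omega> * 0)) + 1 * (k / 2 * (\<sigma> * \<omega>) - \<sigma> * (\<omega> * cos (\<omega> * 0))))) (at_right 0)"
      unfolding W_def liouville_wronskian_def[abs_def]
      by (intro tendsto_intros l1 l2 l3 geodesic_profile_tendsto_0 c0)
    then show "(W \<longlongrightarrow> 0) (at_right 0)" by simp
  next
    fix s assume s: "0 < s" "s < d"
    have "(W has_real_derivative sinh s powr (k / 2) * geodesic_profile c \<mu> s *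
        ((k\<^sup>2 / 4 - \<mu> + k * (k - 2) / (4 * (sinh s)\<^sup>2)) * h s - (- \<omega>\<^sup>2 * h s))) (at s)"
      unfolding W_def
      by (rule liouville_wronskian_deriv, rule s(1), rule geodesic_profile_deriv[OF c0],
          use s c0 geodesic_profile'_deriv[of c s \<mu>] in \<open>simp add: k\<close>, rule dh, rule dh')
    moreover have "(k\<^sup>2 / 4 - \<mu> + k * (k - 2) / (4 * (sinh s)\<^sup>2)) * h s - (- \<omega>\<^sup>2 * h s) =
        \<sigma> * (k\<^sup>2 / 4 + (pi / d)\<^sup>2 - \<mu> + k * (k - 2) / (4 * (sinh s)\<^sup>2)) * sin (\<omega> * s)"
      by (simp add: h_def \<omega>_def algebra_simps)
    moreover have "sin (\<omega> * s) > 0"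
      using s d by (intro sin_gt_zero) (auto simp: \<omega>_def field_simps)
    ultimately show "\<exists>y. (W has_real_derivative y) (at s) \<and> y > 0"
      using sgn[OF s] pos[OF s] s by (auto intro!: exI mult_pos_pos)
  next
    show "continuous_on {0<..d} W"
      unfolding W_def h_def[abs_def] h'_def[abs_def]
      by (intro liouville_wronskian_continuous c0 continuous_intros)
  qed
  moreover have "W d = 0"
    unfolding W_def liouville_wronskian_def h_def using d zero by (simp add: \<omega>_def)
  ultimately show False by simp
qed

lemma self_le_sinh:
  assumes "x \<ge> 0"
  shows "x \<le> sinh (x :: real)"
proof -
  have "sinh 0 - 0 \<le> sinh x - x"
    by (rule DERIV_nonneg_imp_nondecreasing[OF assms])
      (auto intro!: exI derivative_eq_intros simp: cosh_real_ge_1)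
  then show ?thesis by simp
qed

text \<open>The function \<open>h s = \<surd>s cos (\<omega> s)\<close> with \<open>\<omega> = \<pi> / (2 d)\<close> satisfies
\<open>h'' = - (\<omega>\<^sup>2 + 1 / (4 s\<^sup>2)) h - \<omega> sin (\<omega> s) / \<surd>s\<close>.  As \<open>s \<le> sinh s\<close>, it is a strict supersolution of the
Liouville form of the planar equation for every \<open>\<mu> \<le> 1 / 4 + \<omega>\<^sup>2\<close>, and it vanishes at \<open>d\<close>.\<close>

lemma dirichlet_planar_lower_bound:
  assumes d: "d > 0"
    and pos: "\<And>s. 0 < s \<Longrightarrow> s < d \<Longrightarrow> geodesic_profile 1 \<mu> s > 0"
    and zero: "geodesic_profile 1 \<mu> d = 0"
  shows "1 / 4 + (pi / (2 * d))\<^sup>2 < \<mu>"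
proof (rule ccontr)
  assume "\<not> ?thesis"
  then have mu: "\<mu> \<le> 1 / 4 + (pi / (2 * d))\<^sup>2" by simp
  define \<omega> where "\<omega> = pi / (2 * d)"
  have w: "\<omega> > 0" using d by (simp add: \<omega>_def)
  define h h' where "h s = sqrt s * cos (\<omega> * s)"
    and "h' s = cos (\<omega> * s) / (2 * sqrt s) - \<omega> * (sqrt s * sin (\<omega> * s))" for s
  define W where "W = liouville_wronskian 1 (geodesic_profile 1 \<mu>) (geodesic_profile' 1 \<mu>) h h'"
  have dh: "(h has_real_derivative h' s) (at s)" if "s > 0" for s
    unfolding h_def[abs_def] h'_def using that
    by (auto intro!: derivative_eq_intros simp: field_simps)
  have dh': "(h' has_real_derivative - (\<omega>\<^sup>2 + 1 / (4 * s\<^sup>2)) * h s - \<omega> * sin (\<omega> * s) / sqrt s) (at s)"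
    if "s > 0" for s
  proof -
    define r where "r = sqrt s"
    have r: "r > 0" "s = r\<^sup>2" using that by (simp_all add: r_def)
    have sq: "((\<lambda>s. sqrt s) has_real_derivative 1 / (2 * r)) (at s)"
      using that unfolding r_def by (auto intro!: derivative_eq_intros simp: field_simps)
    have cs: "((\<lambda>s. cos (\<omega> * s)) has_real_derivative - \<omega> * sin (\<omega> * s)) (at s)"
      by (auto intro!: derivative_eq_intros)
    have sn: "((\<lambda>s. sin (\<omega> * s)) has_real_derivative \<omega> * cos (\<omega> * s)) (at s)"
      by (auto intro!: derivative_eq_intros)
    have "(h' has_real_derivative
      ((- \<omega> * sin (\<omega> * s)) * (2 * sqrt s) - cos (\<omega> * s) * (2 * (1 / (2 * r)))) / (2 * sqrt s * (2 * sqrt s))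
      - \<omega> * (sqrt s * (\<omega> * cos (\<omega> * s)) + 1 / (2 * r) * sin (\<omega> * s))) (at s)"
      unfolding h'_def[abs_def] using that
      by (intro DERIV_diff DERIV_divide DERIV_cmult DERIV_mult' cs sn sq) auto
    moreover have "((- \<omega> * sin (\<omega> * s)) * (2 * sqrt s) - cos (\<omega> * s) * (2 * (1 / (2 * r)))) / (2 * sqrt s * (2 * sqrt s))
      - \<omega> * (sqrt s * (\<omega> * cos (\<omega> * s)) + 1 / (2 * r) * sin (\<omega> * s)) =
      - (\<omega>\<^sup>2 + 1 / (4 * s\<^sup>2)) * h s - \<omega> * sin (\<omega> * s) / sqrt s"
      unfolding h_def r_def[symmetric] using r(1)
      by (simp add: r(2) field_simps power2_eq_square)
    ultimately show ?thesis by simp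
  qed
  have "W d > 0"
  proof (rule positive_if_increasing_from_0[OF d])
    have l1: "((\<lambda>s::real. sinh s powr (1 / 2)) \<longlongrightarrow> 0) (at_right 0)" by real_asymp
    have l2: "((\<lambda>s. 1 / 2 * (cosh s / sinh s) * h s - h' s) \<longlongrightarrow> 0) (at_right 0)"
      unfolding h_def h'_def using w by real_asymp
    have l3: "(h \<longlongrightarrow> sqrt 0 * cos (\<omega> * 0)) (at_right 0)"
      unfolding h_def[abs_def] by (intro tendsto_intros)
    have "(W \<longlongrightarrow> 0 * (0 * (sqrt 0 * cos (\<omega> * 0)) + 1 * 0)) (at_right 0)"
      unfolding W_def liouville_wronskian_def[abs_def]
      by (intro tendsto_mult tendsto_add l1 l2 l3 geodesic_profile_tendsto_0) auto
    then show "(W \<longlongrightarrow> 0) (at_right 0)" by simp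
  next
    fix s assume s: "0 < s" "s < d"
    have "(W has_real_derivative sinh s powr (1 / 2) * geodesic_profile 1 \<mu> s *
        ((1\<^sup>2 / 4 - \<mu> + 1 * (1 - 2) / (4 * (sinh s)\<^sup>2)) * h s -
          (- (\<omega>\<^sup>2 + 1 / (4 * s\<^sup>2)) * h s - \<omega> * sin (\<omega> * s) / sqrt s))) (at s)"
      unfolding W_def
      by (rule liouville_wronskian_deriv, rule s(1), rule geodesic_profile_deriv, simp,
          use s geodesic_profile'_deriv[of 1 s \<mu>] in simp, rule dh[OF s(1)], rule dh'[OF s(1)])
    moreover have "(1\<^sup>2 / 4 - \<mu> + 1 * (1 - 2) / (4 * (sinh s)\<^sup>2)) * h s -
          (- (\<omega>\<^sup>2 + 1 / (4 * s\<^sup>2)) * h s - \<omega> * sin (\<omega> * s) / sqrt s) =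
       ((1 / 4 + \<omega>\<^sup>2 - \<mu>) + (1 / (4 * s\<^sup>2) - 1 / (4 * (sinh s)\<^sup>2))) * h s + \<omega> * sin (\<omega> * s) / sqrt s"
      by (simp add: algebra_simps)
    moreover have "\<dots> > 0"
    proof -
      have range: "0 < \<omega> * s" "\<omega> * s < pi / 2" using s d w by (auto simp: \<omega>_def field_simps)
      have "h s \<ge> 0" unfolding h_def using range s cos_gt_zero_pi[of "\<omega> * s"] by simp
      moreover have "s \<le> sinh s" using s by (simp add: self_le_sinh)
      then have "1 / (4 * (sinh s)\<^sup>2) \<le> 1 / (4 * s\<^sup>2)"
        using s by (intro divide_left_mono mult_left_mono power_mono) auto
      moreover have "sin (\<omega> * s) > 0" using range by (intro sin_gt_zero) auto
      ultimately show ?thesis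
        using mu w s by (intro add_nonneg_pos mult_nonneg_nonneg add_nonneg_nonneg) (auto simp: \<omega>_def)
    qed
    ultimately show "\<exists>y. (W has_real_derivative y) (at s) \<and> y > 0"
      using pos[OF s] s by (auto intro!: exI mult_pos_pos)
  next
    show "continuous_on {0<..d} W"
      unfolding W_def h_def[abs_def] h'_def[abs_def]
      by (intro liouville_wronskian_continuous continuous_intros) auto
  qed
  moreover have "W d = 0"
    unfolding W_def liouville_wronskian_def h_def using d zero by (simp add: \<omega>_def)
  ultimately show False by simp
qed

text \<open>This bounds the set whose supremum is the first eigenvalue.  The comparison takes place on
\<open>[d / 2, d]\<close>, away from the singularity of the potential, with a sine arch that vanishes at both ends of this
interval: for large \<open>\<mu>\<close> the Wronskian would decrease from a negative to a positive value.\<close>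

lemma positive_profile_eigenvalue_bound:
  assumes c: "c \<ge> 1" and k: "k = 2 * c - 1" and d: "d > 0"
    and pos: "\<And>s. 0 \<le> s \<Longrightarrow> s \<le> d \<Longrightarrow> geodesic_profile c \<mu> s > 0"
  shows "\<mu> \<le> k\<^sup>2 / 4 + (2 * pi / d)\<^sup>2 + k\<^sup>2 / (4 * (sinh (d / 2))\<^sup>2)"
proof (rule ccontr)
  assume mu: "\<not> ?thesis"
  have c0: "c > 0" using c by simp
  define \<omega> where "\<omega> = 2 * pi / d"
  have w: "\<omega> > 0" using d by (simp add: \<omega>_def)
  define h h' where "h s = - sin (\<omega> * s)" and "h' s = - (\<omega> * cos (\<omega> * s))" for s
  define W where "W = liouville_wronskian k (geodesic_profile c \<mu>) (geodesic_profile' c \<mu>) h h'"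
  have dh: "(h has_real_derivative h' s) (at s)" for s
    unfolding h_def[abs_def] h'_def by (auto intro!: derivative_eq_intros)
  have dh': "(h' has_real_derivative - \<omega>\<^sup>2 * h s) (at s)" for s
    unfolding h_def h'_def[abs_def] by (auto intro!: derivative_eq_intros simp: power2_eq_square)
  have "W (d / 2) > W d"
  proof (rule DERIV_neg_imp_decreasing_open[where f = W])
    fix s assume s: "d / 2 < s" "s < d"
    have W': "(W has_real_derivative sinh s powr (k / 2) * geodesic_profile c \<mu> s *
        ((k\<^sup>2 / 4 - \<mu> + k * (k - 2) / (4 * (sinh s)\<^sup>2)) * h s - (- \<omega>\<^sup>2 * h s))) (at s)"
      unfolding W_def
      by (rule liouville_wronskian_deriv, use s d in simp, rule geodesic_profile_deriv[OF c0],
          use s d c0 geodesic_profile'_deriv[of c s \<mu>] in \<open>simp add: k\<close>, rule dh, rule dh')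
    have "(k\<^sup>2 / 4 - \<mu> + k * (k - 2) / (4 * (sinh s)\<^sup>2)) * h s - (- \<omega>\<^sup>2 * h s) =
        - ((\<mu> - k\<^sup>2 / 4 - \<omega>\<^sup>2 - k * (k - 2) / (4 * (sinh s)\<^sup>2)) * h s)"
      by (simp add: algebra_simps)
    moreover have "h s > 0"
    proof -
      have "sin (\<omega> * s - pi) > 0"
        using s d by (intro sin_gt_zero) (auto simp: \<omega>_def field_simps)
      then show ?thesis by (simp add: h_def sin_diff)
    qed
    moreover have "\<mu> - k\<^sup>2 / 4 - \<omega>\<^sup>2 - k * (k - 2) / (4 * (sinh s)\<^sup>2) > 0"
    proof -
      have "k * (k - 2) \<le> k\<^sup>2" using c k by (simp add: power2_eq_square algebra_simps)
      then have "k * (k - 2) / (4 * (sinh s)\<^sup>2) \<le> k\<^sup>2 / (4 * (sinh s)\<^sup>2)"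
        by (intro divide_right_mono) auto
      also have "\<dots> \<le> k\<^sup>2 / (4 * (sinh (d / 2))\<^sup>2)"
        using s d by (intro divide_left_mono mult_left_mono power_mono) auto
      finally show ?thesis using mu by (simp add: \<omega>_def)
    qed
    moreover have "sinh s powr (k / 2) * geodesic_profile c \<mu> s > 0"
      using pos[of s] s d by (intro mult_pos_pos) auto
    ultimately have "sinh s powr (k / 2) * geodesic_profile c \<mu> s *
        ((k\<^sup>2 / 4 - \<mu> + k * (k - 2) / (4 * (sinh s)\<^sup>2)) * h s - (- \<omega>\<^sup>2 * h s)) < 0"
      by (simp only: mult_pos_neg mult_pos_pos neg_less_0_iff_less)
    with W' show "\<exists>y. (W has_real_derivative y) (at s) \<and> y < 0" by blast
  next
    have "continuous_on {0<..d} W"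
      unfolding W_def h_def[abs_def] h'_def[abs_def]
      by (intro liouville_wronskian_continuous c0 continuous_intros)
    then show "continuous_on {d / 2..d} W" by (rule continuous_on_subset) (use d in auto)
  qed (use d in auto)
  moreover have "W (d / 2) < 0" "W d > 0"
    unfolding W_def liouville_wronskian_def h_def h'_def using d pos[of d] pos[of "d / 2"]
    by (simp_all add: \<omega>_def)
  ultimately show False by simp
qed

text \<open>By the equation, \<open>sinh\<^sup>k f'\<close> is nonincreasing from the value 0 as long as \<open>f \<ge> 0\<close>.  At an interior zero, which is a
minimum, it returns to 0, so \<open>f\<close> is constant up to there, contradicting \<open>f 0 = 1\<close>.\<close>

lemma profile_no_interior_zero:
  assumes c: "c \<ge> 1" and mu: "\<mu> \<ge> 0"
    and nonneg: "\<And>s. 0 \<le> s \<Longrightarrow> s \<le> d \<Longrightarrow> geodesic_profile c \<mu> s \<ge> 0"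
    and s: "0 \<le> s" "s < d"
  shows "geodesic_profile c \<mu> s > 0"
proof (rule ccontr)
  assume "\<not> ?thesis"
  with nonneg[of s] s have z: "geodesic_profile c \<mu> s = 0" by force
  then have s0: "s > 0" using s by (cases "s = 0") auto
  have c0: "c > 0" using c by simp
  define Q where "Q s = sinh s powr (2 * c - 1) * geodesic_profile' c \<mu> s" for s
  have Q': "(Q has_real_derivative - \<mu> * geodesic_profile c \<mu> x * sinh x powr (2 * c - 1)) (at x)"
    if x: "x > 0" for x
  proof -
    have S: "sinh x > 0" using x by simp
    have "((\<lambda>s. sinh s powr (2 * c - 1)) has_real_derivative
        (2 * c - 1) * sinh x powr (2 * c - 1 - 1) * cosh x) (at x)"
      by (rule DERIV_chain2[OF has_real_derivative_powr])
        (use x in \<open>auto intro!: derivative_eq_intros\<close>)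
    moreover have "sinh x powr (2 * c - 1 - 1) = sinh x powr (2 * c - 1) / sinh x"
      using S powr_diff[of "sinh x" "2 * c - 1" 1] by simp
    ultimately have p: "((\<lambda>s. sinh s powr (2 * c - 1)) has_real_derivative
        (2 * c - 1) * (sinh x powr (2 * c - 1) / sinh x) * cosh x) (at x)" by simp
    have eq: "P * (- K * (C / S) * g - \<mu> * y) + K * (P / S) * C * g = - \<mu> * y * P" for P K C S g y :: real
    proof -
      define q where "q = C / S"
      have "K * (P / S) * C * g = P * K * q * g" by (simp add: q_def)
      then show ?thesis unfolding q_def[symmetric] by (simp add: algebra_simps)
    qed
    have "x \<noteq> 0" using x by simp
    from DERIV_mult'[OF p geodesic_profile'_deriv[OF c0 this, of \<mu>]] show ?thesis
      unfolding Q_def[abs_def] eq .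
  qed
  have Qc: "continuous_on {0..d} Q"
    unfolding Q_def using c
    by (intro continuous_intros continuous_on_powr' continuous_on_geodesic_profile) auto
  have Q_anti: "Q y \<le> Q x" if "0 \<le> x" "x \<le> y" "y \<le> d" for x y
  proof (rule DERIV_nonpos_imp_decreasing_open[where f = Q, OF that(2)])
    fix t assume "x < t" "t < y"
    then have t: "0 < t" "t \<le> d" using that by auto
    have "0 \<le> \<mu> * (geodesic_profile c \<mu> t * sinh t powr (2 * c - 1))"
      using nonneg[of t] t mu by (intro mult_nonneg_nonneg) auto
    with Q'[OF t(1)] show "\<exists>y. (Q has_real_derivative y) (at t) \<and> y \<le> 0"
      by (intro exI[of _ "- \<mu> * geodesic_profile c \<mu> t * sinh t powr (2 * c - 1)"]) (simp add: mult.assoc)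
  next
    show "continuous_on {x..y} Q" by (rule continuous_on_subset[OF Qc]) (use that in auto)
  qed
  have "geodesic_profile' c \<mu> s = 0"
    by (rule DERIV_local_min[OF geodesic_profile_deriv[OF c0], where d = "min s (d - s)"])
      (use s s0 nonneg z in \<open>auto simp: abs_less_iff\<close>)
  then have "Q s = 0" by (simp add: Q_def)
  moreover have "Q 0 = 0" by (simp add: Q_def)
  ultimately have Q0: "Q x = 0" if "0 \<le> x" "x \<le> s" for x
    using Q_anti[of 0 x] Q_anti[of x s] that s by auto
  have f'0: "geodesic_profile' c \<mu> x = 0" if "0 < x" "x < s" for x
    using Q0[of x] that by (simp add: Q_def)
  have flat: "(geodesic_profile c \<mu> has_real_derivative 0) (at x)" if "0 < x" "x < s" for x
    using geodesic_profile_deriv[OF c0, of \<mu> x] f'0[OF that] by simp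
  have "geodesic_profile c \<mu> s = geodesic_profile c \<mu> 0"
    by (rule DERIV_isconst_end[OF s0 continuous_on_geodesic_profile(1)[OF c0] flat])
  then show False using z by simp
qed

text \<open>Take the supremum of the parameters with a positive solution on \<open>[0, d]\<close>.  In the limit the
solution is nonnegative, hence positive before \<open>d\<close>; were it positive at \<open>d\<close> as well, uniform continuity in
both variables would allow a larger parameter.\<close>

lemma exists_first_dirichlet_profile:
  assumes c: "c \<ge> 1" and d: "d > 0"
  obtains \<mu> where "geodesic_profile c \<mu> d = 0"
    "\<And>s. 0 \<le> s \<Longrightarrow> s < d \<Longrightarrow> geodesic_profile c \<mu> s > 0"
    "\<And>\<nu>. \<nu> < \<mu> \<Longrightarrow> \<exists>\<theta>>\<nu>. \<forall>s\<in>{0..d}. geodesic_profile c \<theta> s > 0"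
proof -
  have c0: "c > 0" using c by simp
  define A where "A = {\<theta>. \<forall>s\<in>{0..d}. geodesic_profile c \<theta> s > 0}"
  define \<mu> where "\<mu> = Sup A"
  have A0: "0 \<in> A" by (simp add: A_def)
  have bdd: "bdd_above A"
    by (rule bdd_aboveI[of _ "(2 * c - 1)\<^sup>2 / 4 + (2 * pi / d)\<^sup>2 + (2 * c - 1)\<^sup>2 / (4 * (sinh (d / 2))\<^sup>2)"])
      (use positive_profile_eigenvalue_bound[OF c refl d] in \<open>auto simp: A_def\<close>)
  have mu0: "\<mu> \<ge> 0" unfolding \<mu>_def using A0 bdd by (rule cSup_upper)
  have below: "\<exists>\<theta>>\<nu>. \<theta> \<in> A" if "\<nu> < \<mu>" for \<nu>
    using less_cSup_iff[of A \<nu>] that A0 bdd by (auto simp: \<mu>_def)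
  define L where "L = \<mu> + 1"
  have cont: "continuous_on ({- L..L} \<times> {0..d}) (\<lambda>(\<theta>, s). geodesic_profile c \<theta> s)"
    by (rule continuous_on_geodesic_profile2[OF c0])
  have nonneg: "geodesic_profile c \<mu> s \<ge> 0" if s: "0 \<le> s" "s \<le> d" for s
  proof (rule ccontr)
    assume neg: "\<not> ?thesis"
    have "continuous_on {- L..L} (\<lambda>\<theta>. (\<lambda>(\<theta>, s). geodesic_profile c \<theta> s) (\<theta>, s))"
      by (rule continuous_on_compose2[OF cont]) (use s in \<open>auto intro!: continuous_intros\<close>)
    then have "continuous_on {- L..L} (\<lambda>\<theta>. geodesic_profile c \<theta> s)" by simp
    moreover have "\<mu> \<in> {- L<..<L}" using mu0 by (simp add: L_def)
    ultimately have "isCont (\<lambda>\<theta>. geodesic_profile c \<theta> s) \<mu>"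
      using continuous_on_interior[of "{- L..L}"] by simp
    then have "eventually (\<lambda>\<theta>. geodesic_profile c \<theta> s < 0) (at \<mu>)"
      using neg by (intro order_tendstoD(2)) (auto simp: isCont_def)
    then obtain e where e: "e > 0" "\<And>\<theta>. \<theta> \<noteq> \<mu> \<Longrightarrow> dist \<theta> \<mu> < e \<Longrightarrow> geodesic_profile c \<theta> s < 0"
      by (auto simp: eventually_at)
    obtain \<theta> where l: "\<theta> > \<mu> - e" "\<theta> \<in> A" using below[of "\<mu> - e"] e(1) by auto
    then have "\<theta> \<le> \<mu>" unfolding \<mu>_def using bdd by (intro cSup_upper)
    then have "geodesic_profile c \<theta> s < 0"
      using l e(2)[of \<theta>] neg by (cases "\<theta> = \<mu>") (auto simp: dist_real_def)
    with l(2) s show False by (force simp: A_def)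
  qed
  have inner: "geodesic_profile c \<mu> s > 0" if "0 \<le> s" "s < d" for s
    using profile_no_interior_zero[OF c mu0 nonneg that] by blast
  have "geodesic_profile c \<mu> d = 0"
  proof (rule ccontr)
    assume "geodesic_profile c \<mu> d \<noteq> 0"
    then have "geodesic_profile c \<mu> d > 0" using nonneg[of d] d by simp
    then have pos: "geodesic_profile c \<mu> s > 0" if "0 \<le> s" "s \<le> d" for s
      using inner[of s] that by (cases "s = d") auto
    have "\<exists>s0\<in>{0..d}. \<forall>s\<in>{0..d}. geodesic_profile c \<mu> s0 \<le> geodesic_profile c \<mu> s"
      using d by (intro continuous_attains_inf continuous_on_geodesic_profile c0) auto
    then obtain s0 where s0: "s0 \<in> {0..d}"
      "\<And>s. s \<in> {0..d} \<Longrightarrow> geodesic_profile c \<mu> s0 \<le> geodesic_profile c \<mu> s" by blast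
    define m where "m = geodesic_profile c \<mu> s0"
    have m: "m > 0" unfolding m_def using s0(1) pos by simp
    have "uniformly_continuous_on ({- L..L} \<times> {0..d}) (\<lambda>(\<theta>, s). geodesic_profile c \<theta> s)"
      by (intro compact_uniformly_continuous[OF cont] compact_Times) auto
    then obtain e where e: "e > 0" "\<And>x y. x \<in> {- L..L} \<times> {0..d} \<Longrightarrow> y \<in> {- L..L} \<times> {0..d} \<Longrightarrow>
        dist y x < e \<Longrightarrow> dist (case y of (\<theta>, s) \<Rightarrow> geodesic_profile c \<theta> s)
          (case x of (\<theta>, s) \<Rightarrow> geodesic_profile c \<theta> s) < m"
      using m unfolding uniformly_continuous_on_def by meson
    define \<theta> where "\<theta> = \<mu> + min (e / 2) 1"
    have "\<theta> \<in> A" unfolding A_def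
    proof safe
      fix s assume s: "s \<in> {0..d}"
      have "dist (geodesic_profile c \<theta> s) (geodesic_profile c \<mu> s) < m"
        using e(2)[of "(\<mu>, s)" "(\<theta>, s)"] s mu0 e(1)
        by (auto simp: L_def \<theta>_def dist_Pair_Pair dist_real_def)
      then show "geodesic_profile c \<theta> s > 0"
        using s0(2)[OF s] by (auto simp: m_def dist_real_def)
    qed
    then have "\<theta> \<le> \<mu>" unfolding \<mu>_def using bdd by (intro cSup_upper)
    then show False using e(1) by (simp add: \<theta>_def)
  qed
  then show thesis using that inner below by (fastforce simp: A_def)
qed

lemma first_dirichlet_profile_bounds:
  assumes c: "c \<ge> 1" and k: "k = 2 * c - 1" and d: "d > 0"
    and pos: "\<And>s. 0 \<le> s \<Longrightarrow> s < d \<Longrightarrow> geodesic_profile c \<mu> s > 0"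
    and zero: "geodesic_profile c \<mu> d = 0"
  shows "k = 1 \<Longrightarrow> 1 / 4 + (pi / (2 * d))\<^sup>2 < \<mu> \<and> \<mu> < 1 / 4 + (pi / d)\<^sup>2"
    and "k = 2 \<Longrightarrow> \<mu> = 1 + (pi / d)\<^sup>2"
    and "k > 2 \<Longrightarrow> \<mu> > k\<^sup>2 / 4 + (pi / d)\<^sup>2"
proof -
  have pos0: "geodesic_profile c \<mu> s > 0" if "0 < s" "s < d" for s using pos that by simp
  obtain s where s: "0 < s" "s < d" "k\<^sup>2 / 4 + (pi / d)\<^sup>2 - \<mu> + k * (k - 2) / (4 * (sinh s)\<^sup>2) \<le> 0"
    using dirichlet_comparison_sin[OF c k d pos0 zero, of 1] by auto
  obtain s0 where s0: "0 < s0" "s0 < d" "k\<^sup>2 / 4 + (pi / d)\<^sup>2 - \<mu> + k * (k - 2) / (4 * (sinh s0)\<^sup>2) \<ge> 0"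
    using dirichlet_comparison_sin[OF c k d pos0 zero, of "-1"] by auto
  show "1 / 4 + (pi / (2 * d))\<^sup>2 < \<mu> \<and> \<mu> < 1 / 4 + (pi / d)\<^sup>2" if k1: "k = 1"
  proof
    have "c = 1" using k k1 by simp
    then show "1 / 4 + (pi / (2 * d))\<^sup>2 < \<mu>"
      using dirichlet_planar_lower_bound[OF d, of \<mu>] pos zero by simp
    have "1 / (4 * (sinh s0)\<^sup>2) > 0" using s0(1) by simp
    moreover have "1 / (4 * (sinh s0)\<^sup>2) \<le> 1 / 4 + (pi / d)\<^sup>2 - \<mu>" using s0(3) by (simp add: k1)
    ultimately show "\<mu> < 1 / 4 + (pi / d)\<^sup>2" by linarith
  qed
  show "\<mu> = 1 + (pi / d)\<^sup>2" if "k = 2" using s(3) s0(3) by (simp add: that)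
  show "\<mu> > k\<^sup>2 / 4 + (pi / d)\<^sup>2" if "k > 2"
  proof -
    have "k * (k - 2) / (4 * (sinh s)\<^sup>2) > 0" using s(1) that by simp
    then show ?thesis using s(3) by simp
  qed
qed

section \<open>Radial modes and minimality of the first eigenvalue\<close>

definition radial_mode :: "real \<Rightarrow> real \<Rightarrow> real ^ 'n::finite \<Rightarrow> real" where
  "radial_mode \<rho> \<mu> x = ball_profile (real CARD('n) / 2) \<mu> ((norm x)\<^sup>2 / \<rho>\<^sup>2)"

lemma norm_ratio_less_1:
  assumes "\<rho> > 0" "norm x < \<rho>"
  shows "\<bar>(norm x)\<^sup>2 / \<rho>\<^sup>2\<bar> < 1"
proof -
  have "(norm x)\<^sup>2 < \<rho>\<^sup>2" using assms by (intro power_strict_mono) auto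
  then show ?thesis using assms by simp
qed

lemma C2_on_radial_mode:
  assumes \<rho>: "\<rho> > 0"
  shows "C2_on (ball 0 \<rho>) (radial_mode \<rho> \<mu> :: real ^ 'n::finite \<Rightarrow> real)"
proof -
  define c where "c = real CARD('n) / 2"
  have c: "c > 0" by (simp add: c_def)
  define u :: "real ^ 'n \<Rightarrow> real" where "u = radial_mode \<rho> \<mu>"
  have u: "u y = ball_profile c \<mu> ((norm y)\<^sup>2 / \<rho>\<^sup>2)" for y
    by (simp add: u_def radial_mode_def c_def)
  have t: "\<bar>(norm y)\<^sup>2 / \<rho>\<^sup>2\<bar> < 1" if "y \<in> ball 0 \<rho>" for y :: "real ^ 'n"
    using norm_ratio_less_1[OF \<rho>] that by simp
  note F = ball_profile_has_derivative(1)[OF c t]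
  note F' = ball_profile_has_derivative(2)[OF c t]
  have du: "u differentiable (at x)" if "x \<in> ball 0 \<rho>" for x
    using radial_function_partial(1)[OF open_ball that u F[OF that]] unfolding differentiable_def by blast
  have dpu: "partial_deriv j u differentiable (at x)" if "x \<in> ball 0 \<rho>" for x j
    by (rule radial_function_second_partial(1)[OF open_ball that u F F'[OF that]])
  have t': "(norm x)\<^sup>2 / \<rho>\<^sup>2 \<in> {-1<..<1}" if "x \<in> ball 0 \<rho>" for x :: "real ^ 'n"
    using t[OF that] unfolding abs_less_iff by simp
  have "continuous_on (ball 0 \<rho>) (partial_deriv i (partial_deriv j u))" for i j
  proof -
    have t_cont: "continuous_on (ball 0 \<rho>) (\<lambda>x :: real ^ 'n. (norm x)\<^sup>2 / \<rho>\<^sup>2)"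
      using \<rho> by (intro continuous_intros) auto
    have "continuous_on {-1<..<1} (ball_profile' c \<mu>)"
      by (intro continuous_at_imp_continuous_on ballI DERIV_isCont)
        (rule ball_profile_has_derivative(2)[OF c], auto)
    then have c1: "continuous_on (ball 0 \<rho>) (\<lambda>x :: real ^ 'n. ball_profile' c \<mu> ((norm x)\<^sup>2 / \<rho>\<^sup>2))"
      by (rule continuous_on_compose2[OF _ t_cont]) (rule image_subsetI, rule t')
    have "continuous_on {-1<..<1} (ball_profile'' c \<mu>)"
      by (intro continuous_at_imp_continuous_on ballI)
        (rule ball_profile_has_derivative(3)[OF c], auto)
    then have c2: "continuous_on (ball 0 \<rho>) (\<lambda>x :: real ^ 'n. ball_profile'' c \<mu> ((norm x)\<^sup>2 / \<rho>\<^sup>2))"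
      by (rule continuous_on_compose2[OF _ t_cont]) (rule image_subsetI, rule t')
    have "continuous_on (ball 0 \<rho>) (\<lambda>x. ball_profile'' c \<mu> ((norm x)\<^sup>2 / \<rho>\<^sup>2) * (4 * x $ i * x $ j / \<rho>^4)
        + ball_profile' c \<mu> ((norm x)\<^sup>2 / \<rho>\<^sup>2) * (if i = j then 2 / \<rho>\<^sup>2 else 0))"
      unfolding divide_inverse[of _ "\<rho> ^ 4"] by (intro continuous_intros c1 c2)
    then show ?thesis
      by (rule continuous_on_eq)
        (rule radial_function_second_partial(2)[OF open_ball _ u F F', symmetric])
  qed
  then show ?thesis
    unfolding C2_on_def C1_on_def u_def[symmetric]
    using du dpu by (auto simp: differentiable_on_eq_differentiable_at
        intro!: continuous_at_imp_continuous_on differentiable_imp_continuous_within)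
qed

lemma hyp_laplacian_radial_mode:
  fixes x :: "real ^ 'n::finite"
  assumes \<rho>: "\<rho> > 0" and n: "CARD('n) \<ge> 2" and x: "norm x < \<rho>"
  shows "hyp_laplacian \<rho> (radial_mode \<rho> \<mu>) x + \<mu> / \<rho>\<^sup>2 * radial_mode \<rho> \<mu> x = 0"
proof -
  define c where "c = real CARD('n) / 2"
  have c: "c > 0" by (simp add: c_def)
  define t where "t = (norm x)\<^sup>2 / \<rho>\<^sup>2"
  have t: "\<bar>(norm y)\<^sup>2 / \<rho>\<^sup>2\<bar> < 1" if "y \<in> ball 0 \<rho>" for y :: "real ^ 'n"
    using norm_ratio_less_1[OF \<rho>] that by simp
  have xb: "x \<in> ball 0 \<rho>" using x by simp
  have "hyp_laplacian \<rho> (radial_mode \<rho> \<mu>) x = (t * (1 - t)\<^sup>2 * ball_profile'' c \<mu> t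
      + (c - 2 * t - (c - 2) * t\<^sup>2) * ball_profile' c \<mu> t) / \<rho>\<^sup>2"
    unfolding c_def t_def
    by (rule hyp_laplacian_radial[OF \<rho> n open_ball order_refl C2_on_radial_mode[OF \<rho>] open_ball order_refl xb])
      (use c t xb in \<open>auto simp: radial_mode_def c_def intro!: ball_profile_has_derivative\<close>)
  also have "t * (1 - t)\<^sup>2 * ball_profile'' c \<mu> t
      + (c - 2 * t - (c - 2) * t\<^sup>2) * ball_profile' c \<mu> t = - (\<mu> * ball_profile c \<mu> t)"
    using ball_profile_ode[OF c, of t \<mu>] t[OF xb] unfolding t_def[symmetric] by linarith
  finally show ?thesis by (simp add: radial_mode_def[of \<rho> \<mu> x] c_def t_def)
qed

lemma radial_mode_eq_geodesic_profile:
  fixes x :: "real ^ 'n::finite"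
  assumes "\<rho> > 0" "norm x < \<rho>"
  shows "radial_mode \<rho> \<mu> x = geodesic_profile (real CARD('n) / 2) \<mu> (hyp_dist \<rho> 0 x / \<rho>)"
  using norm_eq_tanh_hyp_dist[OF assms] assms
  by (simp add: radial_mode_def geodesic_profile_def power_mult_distrib mult.commute)

lemma hyp_disc_dist_bounds:
  fixes m :: "real ^ 'n::finite"
  assumes \<rho>: "\<rho> > 0"
  shows "m \<in> hyp_disc \<rho> \<delta> \<Longrightarrow> norm m < \<rho> \<and> 0 \<le> hyp_dist \<rho> 0 m \<and> hyp_dist \<rho> 0 m \<le> \<delta>"
    and "norm m = \<rho> * tanh (\<delta> / (2 * \<rho>)) \<Longrightarrow> hyp_dist \<rho> 0 m = \<delta>"
proof -
  show "norm m < \<rho> \<and> 0 \<le> hyp_dist \<rho> 0 m \<and> hyp_dist \<rho> 0 m \<le> \<delta>" if m: "m \<in> hyp_disc \<rho> \<delta>"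
  proof -
    have m': "norm m < \<rho>" "hyp_dist \<rho> 0 m \<le> \<delta>" using m by (auto simp: hyp_disc_def)
    have "0 \<le> \<rho> * tanh (hyp_dist \<rho> 0 m / (2 * \<rho>))"
      using norm_eq_tanh_hyp_dist[OF \<rho> m'(1)] norm_ge_zero[of m] by linarith
    then have "0 \<le> hyp_dist \<rho> 0 m" using \<rho> by (simp add: zero_le_mult_iff zero_le_divide_iff)
    with m' show ?thesis by simp
  qed
  assume m: "norm m = \<rho> * tanh (\<delta> / (2 * \<rho>))"
  then have "norm m < \<rho>" using tanh_real_lt_1[of "\<delta> / (2 * \<rho>)"] \<rho> by simp
  then show "hyp_dist \<rho> 0 m = \<delta>" using \<rho> m by (simp add: hyp_dist_0 artanh_tanh_real)
qed

lemma radial_mode_eigenfunction: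
  assumes \<rho>: "\<rho> > 0" and n: "CARD('n::finite) \<ge> 2" and \<delta>: "\<delta> > 0"
    and zero: "geodesic_profile (real CARD('n) / 2) \<mu> (\<delta> / \<rho>) = 0"
  shows "dirichlet_eigenfunction \<rho> \<delta> (\<mu> / \<rho>\<^sup>2) (radial_mode \<rho> \<mu> :: real ^ 'n \<Rightarrow> real)"
  unfolding dirichlet_eigenfunction_def
proof (intro conjI)
  show "\<exists>U. open U \<and> hyp_disc \<rho> \<delta> \<subseteq> U \<and> U \<subseteq> ball 0 \<rho> \<and> C2_on U (radial_mode \<rho> \<mu> :: real ^ 'n \<Rightarrow> real)"
    using C2_on_radial_mode[OF \<rho>] by (intro exI[of _ "ball 0 \<rho>"]) (auto simp: hyp_disc_def)
  show "\<forall>m\<in>hyp_disc \<rho> \<delta>. hyp_laplacian \<rho> (radial_mode \<rho> \<mu>) m + \<mu> / \<rho>\<^sup>2 * radial_mode \<rho> \<mu> (m :: real ^ 'n) = 0"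
    using hyp_laplacian_radial_mode[OF \<rho> n] by (auto simp: hyp_disc_def)
  show "\<forall>m\<in>hyp_disc \<rho> \<delta>. hyp_dist \<rho> 0 m = \<delta> \<longrightarrow> radial_mode \<rho> \<mu> (m :: real ^ 'n) = 0"
    using zero by (auto simp: hyp_disc_def radial_mode_eq_geodesic_profile[OF \<rho>])
  show "\<exists>m\<in>hyp_disc \<rho> \<delta>. radial_mode \<rho> \<mu> (m :: real ^ 'n) \<noteq> 0"
    using \<rho> \<delta> by (intro bexI[of _ 0]) (auto simp: radial_mode_def hyp_disc_eq_cball)
qed

lemma radial_mode_radial_eigenfunction:
  assumes \<rho>: "\<rho> > 0" and n: "CARD('n::finite) \<ge> 2" and \<delta>: "\<delta> > 0"
    and zero: "geodesic_profile (real CARD('n) / 2) \<mu> (\<delta> / \<rho>) = 0"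
  shows "radial_eigenfunction \<rho> \<delta> (\<mu> / \<rho>\<^sup>2) (radial_mode \<rho> \<mu> :: real ^ 'n \<Rightarrow> real)"
  unfolding radial_eigenfunction_def
proof (intro conjI exI ballI)
  show "dirichlet_eigenfunction \<rho> \<delta> (\<mu> / \<rho>\<^sup>2) (radial_mode \<rho> \<mu> :: real ^ 'n \<Rightarrow> real)"
    by (rule radial_mode_eigenfunction[OF assms])
  fix m :: "real ^ 'n" assume "m \<in> hyp_disc \<rho> \<delta>"
  then show "radial_mode \<rho> \<mu> m = (\<lambda>r. geodesic_profile (real CARD('n) / 2) \<mu> (r / \<rho>)) (hyp_dist \<rho> 0 m)"
    using hyp_disc_dist_bounds(1)[OF \<rho>, of m \<delta>] by (simp add: radial_mode_eq_geodesic_profile[OF \<rho>])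
qed

lemma second_derivative_at_local_max:
  fixes h h' :: "real \<Rightarrow> real"
  assumes e: "e > 0" and h: "\<And>t. \<bar>t\<bar> < e \<Longrightarrow> (h has_real_derivative h' t) (at t)"
    and h': "(h' has_real_derivative l) (at 0)" and max: "\<And>t. \<bar>t\<bar> < e \<Longrightarrow> h t \<le> h 0"
  shows "h' 0 = 0" "l \<le> 0"
proof -
  show z: "h' 0 = 0" by (rule DERIV_local_max[OF h[of 0] e]) (use e max in auto)
  show "l \<le> 0"
  proof (rule ccontr)
    assume "\<not> l \<le> 0"
    then obtain d where d: "d > 0" "\<And>r. 0 < r \<Longrightarrow> r < d \<Longrightarrow> h' 0 < h' (0 + r)"
      using DERIV_pos_inc_right[OF h'] by auto
    \<comment> \<open>a positive second derivative makes \<open>h'\<close> positive, hence \<open>h\<close> increasing, to the right of 0\<close>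
    define r where "r = min d e / 2"
    have r: "0 < r" "r < d" "r < e" using d e by (auto simp: r_def)
    have "h 0 < h r"
    proof (rule DERIV_pos_imp_increasing_open[where f = h, OF r(1)])
      fix t assume t: "0 < t" "t < r"
      then show "\<exists>y. (h has_real_derivative y) (at t) \<and> y > 0"
        using h[of t] d(2)[of t] r z by auto
    next
      show "continuous_on {0..r} h"
        by (intro continuous_at_imp_continuous_on ballI, rule DERIV_isCont, rule h) (use r in auto)
    qed
    moreover have "h r \<le> h 0" using max[of r] r by auto
    ultimately show False by simp
  qed
qed

text \<open>The difference \<open>\<sigma> \<psi> - a \<phi>\<close> has a local maximum at the point, so its gradient vanishes and its pure second
derivatives are nonpositive.\<close>

lemma hyp_laplacian_at_touching_point:
  fixes \<psi> \<phi> :: "real ^ 'n::finite \<Rightarrow> real"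
  assumes \<rho>: "\<rho> > 0" and n: "CARD('n) \<ge> 2" and e: "e > 0"
    and U: "open U" "U \<subseteq> ball 0 \<rho>" "C2_on U \<psi>" "C2_on U \<phi>" and x: "ball x e \<subseteq> U"
    and le: "\<And>y. y \<in> ball x e \<Longrightarrow> \<sigma> * \<psi> y \<le> a * \<phi> y" and eq: "\<sigma> * \<psi> x = a * \<phi> x"
  shows "\<sigma> * hyp_laplacian \<rho> \<psi> x \<le> a * hyp_laplacian \<rho> \<phi> x"
proof -
  have xU: "x \<in> U" using x e by auto
  have main: "\<sigma> * partial_deriv i \<psi> x - a * partial_deriv i \<phi> x = 0 \<and>
      \<sigma> * partial_deriv i (partial_deriv i \<psi>) x - a * partial_deriv i (partial_deriv i \<phi>) x \<le> 0" for i
  proof -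
    define h where "h t = \<sigma> * \<psi> (x + t *\<^sub>R axis i 1) - a * \<phi> (x + t *\<^sub>R axis i 1)" for t
    define h' where "h' t = \<sigma> * partial_deriv i \<psi> (x + t *\<^sub>R axis i 1) - a * partial_deriv i \<phi> (x + t *\<^sub>R axis i 1)" for t
    have line: "x + t *\<^sub>R axis i 1 \<in> ball x e" if "\<bar>t\<bar> < e" for t
      using that by (simp add: dist_norm)
    have "(h has_real_derivative h' t) (at t)" if "\<bar>t\<bar> < e" for t
      unfolding h_def[abs_def] h'_def
      using line[OF that] x U
      by (intro DERIV_diff DERIV_cmult partial_deriv_axis_line C2_onD(1)[OF _ U(1)]) auto
    moreover have "(h' has_real_derivative \<sigma> * partial_deriv i (partial_deriv i \<psi>) x
        - a * partial_deriv i (partial_deriv i \<phi>) x) (at 0)"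
      unfolding h'_def[abs_def]
      using partial_deriv_axis_line[of "partial_deriv i \<psi>" x 0 i] partial_deriv_axis_line[of "partial_deriv i \<phi>" x 0 i]
        C2_onD(2)[OF U(3,1) xU] C2_onD(2)[OF U(4,1) xU]
      by (intro DERIV_diff DERIV_cmult) auto
    moreover have "h t \<le> h 0" if "\<bar>t\<bar> < e" for t
      using le[OF line[OF that]] eq by (simp add: h_def)
    ultimately have "h' 0 = 0 \<and> \<sigma> * partial_deriv i (partial_deriv i \<psi>) x - a * partial_deriv i (partial_deriv i \<phi>) x \<le> 0"
      using second_derivative_at_local_max[OF e, of h h'] by blast
    then show ?thesis by (simp add: h'_def)
  qed
  define b where "b = (real CARD('n) - 2) * (2 / (\<rho>\<^sup>2 - (norm x)\<^sup>2))"
  have s1: "\<sigma> * (\<Sum>i\<in>UNIV. partial_deriv i (partial_deriv i \<psi>) x) \<le> a * (\<Sum>i\<in>UNIV. partial_deriv i (partial_deriv i \<phi>) x)"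
    unfolding sum_distrib_left using main by (intro sum_mono) (simp add: algebra_simps)
  have s2: "\<sigma> * (\<Sum>i\<in>UNIV. x $ i * partial_deriv i \<psi> x) = a * (\<Sum>i\<in>UNIV. x $ i * partial_deriv i \<phi> x)"
    unfolding sum_distrib_left
  proof (rule sum.cong[OF refl])
    fix i :: 'n
    have "\<sigma> * partial_deriv i \<psi> x = a * partial_deriv i \<phi> x" using main[of i] by simp
    then show "\<sigma> * (x $ i * partial_deriv i \<psi> x) = a * (x $ i * partial_deriv i \<phi> x)"
      by (metis mult.left_commute)
  qed
  have "\<sigma> * (\<Sum>i\<in>UNIV. partial_deriv i (partial_deriv i \<psi>) x) + b * (\<sigma> * (\<Sum>i\<in>UNIV. x $ i * partial_deriv i \<psi> x))
      \<le> a * (\<Sum>i\<in>UNIV. partial_deriv i (partial_deriv i \<phi>) x) + b * (a * (\<Sum>i\<in>UNIV. x $ i * partial_deriv i \<phi> x))"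
    using s1 s2 by simp
  then have "1 / (conformal_factor \<rho> x)\<^sup>2 * (\<sigma> * (\<Sum>i\<in>UNIV. partial_deriv i (partial_deriv i \<psi>) x) + b * (\<sigma> * (\<Sum>i\<in>UNIV. x $ i * partial_deriv i \<psi> x)))
      \<le> 1 / (conformal_factor \<rho> x)\<^sup>2 * (a * (\<Sum>i\<in>UNIV. partial_deriv i (partial_deriv i \<phi>) x) + b * (a * (\<Sum>i\<in>UNIV. x $ i * partial_deriv i \<phi> x)))"
    by (intro mult_left_mono) auto
  then show ?thesis
    unfolding hyp_laplacian_ball[OF \<rho> n U(1,2,3) xU] hyp_laplacian_ball[OF \<rho> n U(1,2,4) xU] b_def
    by (simp add: algebra_simps)
qed

text \<open>Let \<open>a\<close> be the maximum of \<open>\<sigma> \<psi> / \<phi>\<close> on the closed disc, \<open>\<phi>\<close> being the positive radial mode for \<open>\<mu>\<close>.  If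
\<open>a > 0\<close>, it is attained in the interior, as \<open>\<psi>\<close> vanishes on the boundary.  There the Laplacians of
\<open>\<sigma> \<psi>\<close> and \<open>a \<phi>\<close> are ordered, which contradicts \<open>\<nu> < \<mu> / \<rho>\<^sup>2\<close> since both functions have the same positive value.\<close>

lemma eigenfunction_nonpositive:
  fixes \<psi> :: "real ^ 'n::finite \<Rightarrow> real"
  assumes \<rho>: "\<rho> > 0" and n: "CARD('n) \<ge> 2" and \<delta>: "\<delta> > 0"
    and ef: "dirichlet_eigenfunction \<rho> \<delta> \<nu> \<psi>"
    and pos: "\<forall>s\<in>{0..\<delta> / \<rho>}. geodesic_profile (real CARD('n) / 2) \<mu> s > 0"
    and lt: "\<nu> < \<mu> / \<rho>\<^sup>2" and m: "m \<in> hyp_disc \<rho> \<delta>"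
  shows "\<sigma> * \<psi> m \<le> 0"
proof (rule ccontr)
  assume "\<not> ?thesis"
  then have mpos: "\<sigma> * \<psi> m > 0" by simp
  define R where "R = \<rho> * tanh (\<delta> / (2 * \<rho>))"
  have R0: "R \<ge> 0" using \<rho> \<delta> by (simp add: R_def)
  have disc: "hyp_disc \<rho> \<delta> = (cball 0 R :: (real ^ 'n) set)" unfolding R_def using \<rho> by (rule hyp_disc_eq_cball)
  obtain U where U: "open U" "hyp_disc \<rho> \<delta> \<subseteq> U" "U \<subseteq> ball 0 \<rho>" "C2_on U \<psi>"
    and pde: "\<And>y. y \<in> hyp_disc \<rho> \<delta> \<Longrightarrow> hyp_laplacian \<rho> \<psi> y + \<nu> * \<psi> y = 0"
    and bd: "\<And>y. y \<in> hyp_disc \<rho> \<delta> \<Longrightarrow> hyp_dist \<rho> 0 y = \<delta> \<Longrightarrow> \<psi> y = 0"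
    using ef unfolding dirichlet_eigenfunction_def by auto
  define \<phi> :: "real ^ 'n \<Rightarrow> real" where "\<phi> = radial_mode \<rho> \<mu>"
  have C2\<phi>: "C2_on (ball 0 \<rho>) \<phi>" unfolding \<phi>_def by (rule C2_on_radial_mode[OF \<rho>])
  then have C2\<phi>U: "C2_on U \<phi>" using U(3) by (rule C2_on_subset)
  have \<phi>pos: "\<phi> y > 0" if "y \<in> hyp_disc \<rho> \<delta>" for y
    using hyp_disc_dist_bounds(1)[OF \<rho> that] \<rho> pos
    by (auto simp: \<phi>_def radial_mode_eq_geodesic_profile[OF \<rho>] divide_right_mono)
  have "continuous_on U \<psi>" "continuous_on U \<phi>"
    using U(4) C2\<phi>U unfolding C2_on_def C1_on_def by (simp_all add: differentiable_imp_continuous_on)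
  then have "continuous_on (hyp_disc \<rho> \<delta>) \<psi>" "continuous_on (hyp_disc \<rho> \<delta>) \<phi>"
    using U(2) by (simp_all add: continuous_on_subset)
  moreover have "\<forall>y\<in>hyp_disc \<rho> \<delta>. \<phi> y \<noteq> 0" using \<phi>pos by force
  ultimately have "continuous_on (hyp_disc \<rho> \<delta>) (\<lambda>y. \<sigma> * \<psi> y / \<phi> y)"
    by (intro continuous_intros)
  then have "\<exists>x\<in>hyp_disc \<rho> \<delta>. \<forall>y\<in>hyp_disc \<rho> \<delta>. \<sigma> * \<psi> y / \<phi> y \<le> \<sigma> * \<psi> x / \<phi> x"
    by (intro continuous_attains_sup) (use m R0 in \<open>auto simp: disc\<close>)
  then obtain x where x: "x \<in> hyp_disc \<rho> \<delta>"
    "\<And>y. y \<in> hyp_disc \<rho> \<delta> \<Longrightarrow> \<sigma> * \<psi> y / \<phi> y \<le> \<sigma> * \<psi> x / \<phi> x" by blast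
  define a where "a = \<sigma> * \<psi> x / \<phi> x"
  have "0 < \<sigma> * \<psi> m / \<phi> m" using mpos \<phi>pos[OF m] by (rule divide_pos_pos)
  also have "\<dots> \<le> a" unfolding a_def by (rule x(2)[OF m])
  finally have apos: "a > 0" .
  have le: "\<sigma> * \<psi> y \<le> a * \<phi> y" if "y \<in> hyp_disc \<rho> \<delta>" for y
    using x(2)[OF that] \<phi>pos[OF that] by (simp add: a_def[symmetric] pos_divide_le_eq)
  have eq: "\<sigma> * \<psi> x = a * \<phi> x" using \<phi>pos[OF x(1)] by (simp add: a_def)
  have "\<psi> x \<noteq> 0" using eq apos \<phi>pos[OF x(1)] by auto
  then have "norm x \<noteq> R" using bd[OF x(1)] hyp_disc_dist_bounds(2)[OF \<rho>, of x \<delta>] by (auto simp: R_def)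
  then have "norm x < R" using x(1) by (simp add: disc)
  define e where "e = R - norm x"
  have e: "e > 0" using \<open>norm x < R\<close> by (simp add: e_def)
  have "ball x e \<subseteq> hyp_disc \<rho> \<delta>"
  proof
    fix y assume "y \<in> ball x e"
    then have "norm (y - x) < e" by (simp add: dist_norm norm_minus_commute)
    then show "y \<in> hyp_disc \<rho> \<delta>"
      using norm_triangle_sub[of y x] by (simp add: disc e_def)
  qed
  then have "\<sigma> * hyp_laplacian \<rho> \<psi> x \<le> a * hyp_laplacian \<rho> \<phi> x"
    using U(2) le
    by (intro hyp_laplacian_at_touching_point[OF \<rho> n e U(1,3,4) C2\<phi>U _ _ eq]) blast+
  moreover have "hyp_laplacian \<rho> \<psi> x = - \<nu> * \<psi> x" using pde[OF x(1)] by simp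
  moreover have "hyp_laplacian \<rho> \<phi> x = - (\<mu> / \<rho>\<^sup>2) * \<phi> x"
    using hyp_laplacian_radial_mode[OF \<rho> n, of x \<mu>] hyp_disc_dist_bounds(1)[OF \<rho> x(1)] by (simp add: \<phi>_def)
  ultimately have "- \<nu> * (\<sigma> * \<psi> x) \<le> - (\<mu> / \<rho>\<^sup>2) * (a * \<phi> x)" by (simp add: algebra_simps)
  then have "(\<mu> / \<rho>\<^sup>2 - \<nu>) * (a * \<phi> x) \<le> 0" unfolding eq by (simp add: algebra_simps)
  moreover have "(\<mu> / \<rho>\<^sup>2 - \<nu>) * (a * \<phi> x) > 0"
    using lt apos \<phi>pos[OF x(1)] by (intro mult_pos_pos) auto
  ultimately show False by simp
qed

text \<open>The preceding estimate with both signs forces an eigenfunction for a smaller value to vanish on the disc.\<close>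

lemma dirichlet_eigenvalue_lower_bound:
  assumes \<rho>: "\<rho> > 0" and n: "CARD('n::finite) \<ge> 2" and \<delta>: "\<delta> > 0"
    and ev: "dirichlet_eigenvalue TYPE('n) \<rho> \<delta> \<nu>"
    and pos: "\<forall>s\<in>{0..\<delta> / \<rho>}. geodesic_profile (real CARD('n) / 2) \<mu> s > 0"
  shows "\<mu> / \<rho>\<^sup>2 \<le> \<nu>"
proof (rule ccontr)
  assume "\<not> ?thesis"
  then have lt: "\<nu> < \<mu> / \<rho>\<^sup>2" by simp
  obtain \<psi> :: "real ^ 'n \<Rightarrow> real" where ef: "dirichlet_eigenfunction \<rho> \<delta> \<nu> \<psi>"
    using ev unfolding dirichlet_eigenvalue_def by blast
  note le = eigenfunction_nonpositive[OF \<rho> n \<delta> ef pos lt]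
  obtain m where "m \<in> hyp_disc \<rho> \<delta>" "\<psi> m \<noteq> 0" using ef unfolding dirichlet_eigenfunction_def by blast
  then show False using le[of m 1] le[of m "-1"] by auto
qed

lemma is_min_eigenvalue_first_profile:
  assumes \<rho>: "\<rho> > 0" and n: "CARD('n::finite) \<ge> 2" and \<delta>: "\<delta> > 0"
    and zero: "geodesic_profile (real CARD('n) / 2) \<mu> (\<delta> / \<rho>) = 0"
    and below: "\<And>\<nu>. \<nu> < \<mu> \<Longrightarrow> \<exists>\<theta>>\<nu>. \<forall>s\<in>{0..\<delta> / \<rho>}. geodesic_profile (real CARD('n) / 2) \<theta> s > 0"
  shows "is_min_eigenvalue TYPE('n) \<rho> \<delta> (\<mu> / \<rho>\<^sup>2)"
  unfolding is_min_eigenvalue_def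
proof (intro conjI allI impI)
  show "dirichlet_eigenvalue TYPE('n) \<rho> \<delta> (\<mu> / \<rho>\<^sup>2)"
    unfolding dirichlet_eigenvalue_def using radial_mode_eigenfunction[OF \<rho> n \<delta> zero] by blast
  fix \<nu> assume ev: "dirichlet_eigenvalue TYPE('n) \<rho> \<delta> \<nu>"
  show "\<mu> / \<rho>\<^sup>2 \<le> \<nu>"
  proof (rule ccontr)
    assume "\<not> ?thesis"
    then have "\<nu> * \<rho>\<^sup>2 < \<mu>" using \<rho> by (simp add: field_simps)
    then obtain \<theta> where \<theta>: "\<theta> > \<nu> * \<rho>\<^sup>2"
      "\<forall>s\<in>{0..\<delta> / \<rho>}. geodesic_profile (real CARD('n) / 2) \<theta> s > 0" using below by blast
    have "\<theta> / \<rho>\<^sup>2 \<le> \<nu>" by (rule dirichlet_eigenvalue_lower_bound[OF \<rho> n \<delta> ev \<theta>(2)])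
    then show False using \<theta>(1) \<rho> by (simp add: field_simps)
  qed
qed

section \<open>The radial spectrum in dimension three\<close>

text \<open>The energy \<open>z\<^sup>2 + z'\<^sup>2\<close> grows at most exponentially with rate \<open>1 + |q|\<close> and starts at 0.\<close>

lemma harmonic_ode_zero_unique:
  fixes z z' :: "real \<Rightarrow> real"
  assumes cont: "continuous_on {0..d} z" "continuous_on {0..d} z'"
    and z: "\<And>s. 0 < s \<Longrightarrow> s < d \<Longrightarrow> (z has_real_derivative z' s) (at s)"
    and z': "\<And>s. 0 < s \<Longrightarrow> s < d \<Longrightarrow> (z' has_real_derivative - q * z s) (at s)"
    and init: "z 0 = 0" "z' 0 = 0"
    and s: "0 \<le> s" "s \<le> d"
  shows "z s = 0"
proof -
  \<comment> \<open>the derivative of the energy is \<open>2 (1 - q) z z'\<close>, at most \<open>|1 - q|\<close> times the energy\<close>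
  define K where "K = 1 + \<bar>q\<bar>"
  define E where "E s = exp (- K * s) * ((z s)\<^sup>2 + (z' s)\<^sup>2)" for s
  have "E s \<le> E 0"
  proof (rule DERIV_nonpos_imp_decreasing_open[OF s(1)])
    fix x assume x: "0 < x" "x < s"
    have xd: "x < d" using x s by simp
    have "(E has_real_derivative exp (- K * x) *
       (2 * (1 - q) * (z x * z' x) - K * ((z x)\<^sup>2 + (z' x)\<^sup>2))) (at x)"
      unfolding E_def[abs_def]
      by (rule derivative_eq_intros z[OF x(1) xd] z'[OF x(1) xd] refl)+ (simp add: algebra_simps)
    moreover have "2 * (1 - q) * (z x * z' x) \<le> K * ((z x)\<^sup>2 + (z' x)\<^sup>2)"
    proof -
      have "2 * \<bar>z x * z' x\<bar> \<le> (z x)\<^sup>2 + (z' x)\<^sup>2"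
        using sum_squares_bound[of "\<bar>z x\<bar>" "\<bar>z' x\<bar>"] by (simp add: abs_mult)
      then have "\<bar>1 - q\<bar> * (2 * \<bar>z x * z' x\<bar>) \<le> K * ((z x)\<^sup>2 + (z' x)\<^sup>2)"
        unfolding K_def by (intro mult_mono) auto
      moreover have "2 * (1 - q) * (z x * z' x) \<le> \<bar>1 - q\<bar> * (2 * \<bar>z x * z' x\<bar>)"
        using abs_ge_self[of "2 * (1 - q) * (z x * z' x)"] by (simp only: abs_mult abs_numeral mult_ac)
      ultimately show ?thesis by linarith
    qed
    ultimately show "\<exists>y. (E has_real_derivative y) (at x) \<and> y \<le> 0"
      by (intro exI conjI) (auto intro!: mult_nonneg_nonpos)
  next
    show "continuous_on {0..s} E"
      unfolding E_def using cont s by (auto intro!: continuous_intros elim: continuous_on_subset)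
  qed
  then have "exp (- K * s) * ((z s)\<^sup>2 + (z' s)\<^sup>2) \<le> 0" by (simp add: E_def init)
  then have "(z s)\<^sup>2 + (z' s)\<^sup>2 \<le> 0" by (simp add: mult_le_0_iff)
  then show ?thesis by (simp add: sum_power2_le_zero_iff)
qed

text \<open>In dimension three Liouville's substitution removes the singularity: \<open>sinh s f\<close> solves \<open>z'' = - (\<mu> - 1) z\<close>.\<close>

lemma sinh_times_radial_solution:
  fixes f f' :: "real \<Rightarrow> real"
  assumes s: "s > 0" and f: "(f has_real_derivative f' s) (at s)"
    and f': "(f' has_real_derivative - 2 * (cosh s / sinh s) * f' s - \<mu> * f s) (at s)"
  shows "((\<lambda>s. sinh s * f s) has_real_derivative cosh s * f s + sinh s * f' s) (at s)"
    and "((\<lambda>s. cosh s * f s + sinh s * f' s) has_real_derivative - (\<mu> - 1) * (sinh s * f s)) (at s)"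
proof -
  show "((\<lambda>s. sinh s * f s) has_real_derivative cosh s * f s + sinh s * f' s) (at s)"
    by (rule derivative_eq_intros f refl)+ simp
  show "((\<lambda>s. cosh s * f s + sinh s * f' s) has_real_derivative - (\<mu> - 1) * (sinh s * f s)) (at s)"
    by (rule derivative_eq_intros f f' refl)+ (use s in \<open>simp add: algebra_simps\<close>)
qed

lemma radial_solution_3d_unique:
  fixes f f' g g' :: "real \<Rightarrow> real"
  assumes cont: "continuous_on {0..d} f" "continuous_on {0..d} f'" "continuous_on {0..d} g" "continuous_on {0..d} g'"
    and f: "\<And>s. 0 < s \<Longrightarrow> s < d \<Longrightarrow> (f has_real_derivative f' s) (at s)"
      "\<And>s. 0 < s \<Longrightarrow> s < d \<Longrightarrow> (f' has_real_derivative - 2 * (cosh s / sinh s) * f' s - \<mu> * f s) (at s)"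
    and g: "\<And>s. 0 < s \<Longrightarrow> s < d \<Longrightarrow> (g has_real_derivative g' s) (at s)"
      "\<And>s. 0 < s \<Longrightarrow> s < d \<Longrightarrow> (g' has_real_derivative - 2 * (cosh s / sinh s) * g' s - \<mu> * g s) (at s)"
    and init: "f 0 = a * g 0" and s: "0 \<le> s" "s \<le> d"
  shows "f s = a * g s"
proof (cases "s = 0")
  case False
  have "sinh s * f s - a * (sinh s * g s) = 0"
  proof (rule harmonic_ode_zero_unique[where d = d and q = "\<mu> - 1" and z = "\<lambda>s. sinh s * f s - a * (sinh s * g s)"
        and z' = "\<lambda>s. cosh s * f s + sinh s * f' s - a * (cosh s * g s + sinh s * g' s)"])
    fix t assume t: "0 < t" "t < d"
    show "((\<lambda>s. sinh s * f s - a * (sinh s * g s)) has_real_derivative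
        cosh t * f t + sinh t * f' t - a * (cosh t * g t + sinh t * g' t)) (at t)"
      by (intro DERIV_diff DERIV_cmult sinh_times_radial_solution(1)[OF t(1) f(1)[OF t] f(2)[OF t]]
        sinh_times_radial_solution(1)[OF t(1) g(1)[OF t] g(2)[OF t]])
    have "((\<lambda>s. cosh s * f s + sinh s * f' s - a * (cosh s * g s + sinh s * g' s)) has_real_derivative
        - (\<mu> - 1) * (sinh t * f t) - a * (- (\<mu> - 1) * (sinh t * g t))) (at t)"
      by (intro DERIV_diff DERIV_cmult sinh_times_radial_solution(2)[OF t(1) f(1)[OF t] f(2)[OF t]]
        sinh_times_radial_solution(2)[OF t(1) g(1)[OF t] g(2)[OF t]])
    then show "((\<lambda>s. cosh s * f s + sinh s * f' s - a * (cosh s * g s + sinh s * g' s)) has_real_derivative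
        - (\<mu> - 1) * (sinh t * f t - a * (sinh t * g t))) (at t)"
      by (simp add: algebra_simps)
  qed (use init s in \<open>auto intro!: continuous_intros cont\<close>)
  then have "sinh s * (f s - a * g s) = 0" by (simp add: algebra_simps)
  then show ?thesis using False by simp
qed (use init in simp)

lemma sinh_times_geodesic_profile_3d:
  assumes S: "\<And>s. (S has_real_derivative S' s) (at s)" and S': "\<And>s. (S' has_real_derivative - (\<mu> - 1) * S s) (at s)"
    and init: "S 0 = 0" "S' 0 = 1" and s: "s \<ge> 0"
  shows "sinh s * geodesic_profile (3 / 2) \<mu> s = S s"
proof -
  define f f' where "f = geodesic_profile (3 / 2) \<mu>" and "f' = geodesic_profile' (3 / 2) \<mu>"
  have df: "(f has_real_derivative f' t) (at t)"
    and df': "t > 0 \<Longrightarrow> (f' has_real_derivative - 2 * (cosh t / sinh t) * f' t - \<mu> * f t) (at t)" for t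
    using geodesic_profile_deriv[of "3 / 2" \<mu> t] geodesic_profile'_deriv[of "3 / 2" t \<mu>]
    by (auto simp: f_def f'_def)
  have c: "continuous_on A f" "continuous_on A f'" "continuous_on A S" "continuous_on A S'" for A
    using continuous_on_geodesic_profile[of "3 / 2"] S S'
    by (auto simp: f_def f'_def intro!: continuous_at_imp_continuous_on DERIV_isCont)
  have f0: "f 0 = 1" by (simp add: f_def)
  have "sinh s * f s - S s = 0"
  proof (rule harmonic_ode_zero_unique[where d = s and q = "\<mu> - 1" and z = "\<lambda>s. sinh s * f s - S s"
        and z' = "\<lambda>s. cosh s * f s + sinh s * f' s - S' s"])
    fix t assume t: "0 < t" "t < s"
    show "((\<lambda>s. sinh s * f s - S s) has_real_derivative cosh t * f t + sinh t * f' t - S' t) (at t)"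
      by (intro DERIV_diff S sinh_times_radial_solution(1)[OF t(1) df df'[OF t(1)]])
    have "((\<lambda>s. cosh s * f s + sinh s * f' s - S' s) has_real_derivative
        - (\<mu> - 1) * (sinh t * f t) - (- (\<mu> - 1) * S t)) (at t)"
      by (intro DERIV_diff S' sinh_times_radial_solution(2)[OF t(1) df df'[OF t(1)]])
    then show "((\<lambda>s. cosh s * f s + sinh s * f' s - S' s) has_real_derivative
        - (\<mu> - 1) * (sinh t * f t - S t)) (at t)" by (simp add: algebra_simps)
  qed (use init s f0 in \<open>auto intro!: continuous_intros c\<close>)
  then show ?thesis by (simp add: f_def)
qed

lemma geodesic_profile_3d_oscillating:
  assumes "\<omega> > 0" "s \<ge> 0"
  shows "sinh s * geodesic_profile (3 / 2) (1 + \<omega>\<^sup>2) s = sin (\<omega> * s) / \<omega>"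
  by (rule sinh_times_geodesic_profile_3d[where S' = "\<lambda>s. cos (\<omega> * s)"])
    (use assms in \<open>auto intro!: derivative_eq_intros simp: power2_eq_square\<close>)

lemma geodesic_profile_3d_zero_iff:
  assumes d: "d > 0"
  shows "geodesic_profile (3 / 2) \<mu> d = 0 \<longleftrightarrow> (\<exists>j::nat. j \<ge> 1 \<and> \<mu> = 1 + (pi * real j / d)\<^sup>2)"
proof
  assume z: "geodesic_profile (3 / 2) \<mu> d = 0"
  consider "\<mu> < 1" | "\<mu> = 1" | "\<mu> > 1" by linarith
  then show "\<exists>j::nat. j \<ge> 1 \<and> \<mu> = 1 + (pi * real j / d)\<^sup>2"
  proof cases
    case 1
    define \<omega> where "\<omega> = sqrt (1 - \<mu>)"
    have w: "\<omega> > 0" "\<omega> * \<omega> = 1 - \<mu>" using 1 by (auto simp: \<omega>_def)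
    have "sinh d * geodesic_profile (3 / 2) \<mu> d = sinh (\<omega> * d) / \<omega>"
      by (rule sinh_times_geodesic_profile_3d[where S' = "\<lambda>s. cosh (\<omega> * s)"])
        (use w d in \<open>auto intro!: derivative_eq_intros simp: w(2)[symmetric]\<close>)
    moreover have "sinh (\<omega> * d) > 0" using w d by simp
    ultimately show ?thesis using z w by simp
  next
    case 2
    have "sinh d * geodesic_profile (3 / 2) \<mu> d = d"
      by (rule sinh_times_geodesic_profile_3d[where S' = "\<lambda>s. 1"])
        (use 2 d in \<open>auto intro!: derivative_eq_intros\<close>)
    then show ?thesis using z d by simp
  next
    case 3
    define \<omega> where "\<omega> = sqrt (\<mu> - 1)"
    have w: "\<omega> > 0" "\<mu> = 1 + \<omega>\<^sup>2" using 3 by (auto simp: \<omega>_def)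
    have "sin (\<omega> * d) = 0" using geodesic_profile_3d_oscillating[OF w(1), of d] z d w by simp
    then obtain i :: int where i: "\<omega> * d = of_int i * pi" using sin_zero_iff_int2 by auto
    have "of_int i * pi > 0" using i w(1) d by (metis mult_pos_pos)
    then have ipos: "i > 0" by (simp add: zero_less_mult_iff pi_gt_zero)
    have "\<omega> = pi * real (nat i) / d" using i d ipos by (simp add: field_simps)
    then show ?thesis using w(2) ipos by (intro exI[of _ "nat i"]) auto
  qed
next
  assume "\<exists>j::nat. j \<ge> 1 \<and> \<mu> = 1 + (pi * real j / d)\<^sup>2"
  then obtain j :: nat where j: "j \<ge> 1" "\<mu> = 1 + (pi * real j / d)\<^sup>2" by blast
  have "pi * real j / d > 0" using j d by simp
  then have "sinh d * geodesic_profile (3 / 2) \<mu> d = sin (pi * real j) / (pi * real j / d)"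
    using geodesic_profile_3d_oscillating[of "pi * real j / d" d] d j by simp
  then show "geodesic_profile (3 / 2) \<mu> d = 0" using d by (simp add: mult.commute)
qed

text \<open>Along a coordinate axis a radial eigenfunction is a twice differentiable function of the signed distance, so its
value and first derivative are continuous at the centre.  Away from the centre it solves the radial equation, and after
multiplication by \<open>sinh\<close> the initial value at the centre determines it.\<close>

lemma radial_eigenfunction_3d:
  fixes \<psi> :: "real ^ 'n::finite \<Rightarrow> real"
  assumes \<rho>: "\<rho> > 0" and n: "CARD('n) = 3" and \<delta>: "\<delta> > 0"
    and rad: "radial_eigenfunction \<rho> \<delta> \<nu> \<psi>" and m: "m \<in> hyp_disc \<rho> \<delta>"
  shows "\<psi> m = \<psi> 0 * geodesic_profile (3 / 2) (\<rho>\<^sup>2 * \<nu>) (hyp_dist \<rho> 0 m / \<rho>)"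
proof -
  define d where "d = \<delta> / \<rho>"
  define R where "R = \<rho> * tanh (d / 2)"
  define \<mu> where "\<mu> = \<rho>\<^sup>2 * \<nu>"
  have disc: "hyp_disc \<rho> \<delta> = (cball 0 R :: (real ^ 'n) set)"
    unfolding R_def d_def hyp_disc_eq_cball[OF \<rho>] by (simp add: mult.commute)
  have R\<rho>: "R < \<rho>" using \<rho> tanh_real_lt_1[of "d / 2"] by (simp add: R_def)
  obtain U where U: "open U" "hyp_disc \<rho> \<delta> \<subseteq> U" "U \<subseteq> ball 0 \<rho>" "C2_on U \<psi>"
    and pde: "\<And>y. y \<in> hyp_disc \<rho> \<delta> \<Longrightarrow> hyp_laplacian \<rho> \<psi> y + \<nu> * \<psi> y = 0"
    using rad unfolding radial_eigenfunction_def dirichlet_eigenfunction_def by auto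
  obtain f where f: "\<And>y. y \<in> hyp_disc \<rho> \<delta> \<Longrightarrow> \<psi> y = f (hyp_dist \<rho> 0 y)"
    using rad unfolding radial_eigenfunction_def by blast
  \<comment> \<open>any axis will do\<close>
  define i0 :: 'n where "i0 = undefined"
  define P P' P'' where "P x = \<psi> (x *\<^sub>R axis i0 1)" and "P' x = partial_deriv i0 \<psi> (x *\<^sub>R axis i0 1)"
    and "P'' x = partial_deriv i0 (partial_deriv i0 \<psi>) (x *\<^sub>R axis i0 1)" for x
  have line: "x *\<^sub>R axis i0 1 \<in> hyp_disc \<rho> \<delta>" if "\<bar>x\<bar> \<le> R" for x using that by (simp add: disc)
  have lineU: "x *\<^sub>R axis i0 1 \<in> U" if "\<bar>x\<bar> \<le> R" for x using line[OF that] U(2) by blast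
  have radial: "\<psi> y = P (norm y)" if "norm y \<le> R" for y
  proof -
    have "norm (norm y *\<^sub>R axis i0 1 :: real ^ 'n) = norm y" by simp
    then have "hyp_dist \<rho> 0 (norm y *\<^sub>R axis i0 1 :: real ^ 'n) = hyp_dist \<rho> 0 y"
      using that R\<rho> \<rho> by (simp add: hyp_dist_0)
    then show ?thesis using f[of y] f[OF line[of "norm y"]] that by (simp add: P_def disc)
  qed
  have dP: "(P has_real_derivative P' x) (at x)" if "\<bar>x\<bar> \<le> R" for x
    using partial_deriv_axis_line[of \<psi> 0 x i0] C2_onD(1)[OF U(4,1) lineU[OF that]]
    by (simp add: P_def[abs_def] P'_def)
  have dP': "(P' has_real_derivative P'' x) (at x)" if "\<bar>x\<bar> \<le> R" for x
    using partial_deriv_axis_line[of "partial_deriv i0 \<psi>" 0 x i0] C2_onD(2)[OF U(4,1) lineU[OF that]]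
    by (simp add: P'_def[abs_def] P''_def)
  \<comment> \<open>the eigenfunction as a function of \<open>t = |x|\<^sup>2 / \<rho>\<^sup>2\<close>, available only for \<open>t > 0\<close>\<close>
  define V V' where "V t = P (\<rho> * sqrt t)" and "V' t = P' (\<rho> * sqrt t) * (\<rho> / (2 * sqrt t))" for t
  have sqrt_le: "\<bar>\<rho> * sqrt t\<bar> \<le> R" if "0 < t" "t \<le> (R / \<rho>)\<^sup>2" for t
  proof -
    have "sqrt t \<le> \<bar>R / \<rho>\<bar>" using that(2) real_sqrt_le_mono by fastforce
    moreover have "R \<ge> 0" using \<rho> \<delta> by (simp add: R_def d_def)
    ultimately show ?thesis using \<rho> that by (simp add: abs_mult field_simps)
  qed
  have dsq: "((\<lambda>t. \<rho> * sqrt t) has_real_derivative \<rho> / (2 * sqrt t)) (at t)" if "t > 0" for t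
    using that by (auto intro!: derivative_eq_intros simp: field_simps)
  have dV: "(V has_real_derivative V' t) (at t)" if "0 < t" "t \<le> (R / \<rho>)\<^sup>2" for t
    unfolding V_def[abs_def] V'_def by (rule DERIV_chain2[OF dP[OF sqrt_le[OF that]] dsq[OF that(1)]])
  have dV': "\<exists>D. (V' has_real_derivative D) (at t)" if "0 < t" "t \<le> (R / \<rho>)\<^sup>2" for t
  proof -
    have "((\<lambda>t. P' (\<rho> * sqrt t)) has_real_derivative P'' (\<rho> * sqrt t) * (\<rho> / (2 * sqrt t))) (at t)"
      by (rule DERIV_chain2[OF dP'[OF sqrt_le[OF that]] dsq[OF that(1)]])
    moreover have "\<exists>D. ((\<lambda>t. \<rho> / (2 * sqrt t)) has_real_derivative D) (at t)"
      using that(1) by (auto intro!: exI derivative_eq_intros)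
    ultimately show ?thesis unfolding V'_def[abs_def] using DERIV_mult' by blast
  qed
  define \<Psi> \<Psi>' where "\<Psi> s = P (\<rho> * tanh (s / 2))"
    and "\<Psi>' s = P' (\<rho> * tanh (s / 2)) * (\<rho> * (1 - (tanh (s / 2))\<^sup>2) / 2)" for s
  have tanh_le: "\<bar>\<rho> * tanh (s / 2)\<bar> \<le> R" if "s \<in> {0..d}" for s
    using that \<rho> by (simp add: R_def abs_mult)
  have ode: "(\<Psi> has_real_derivative \<Psi>' s) (at s) \<and>
      (\<Psi>' has_real_derivative - 2 * (cosh s / sinh s) * \<Psi>' s - \<mu> * \<Psi> s) (at s)" if s: "0 < s" "s < d" for s
  proof -
    have V\<Psi>: "V ((tanh (t / 2))\<^sup>2) = \<Psi> t"
      "V' ((tanh (t / 2))\<^sup>2) * (tanh (t / 2) * (1 - (tanh (t / 2))\<^sup>2)) = \<Psi>' t" if "t > 0" for t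
      using that by (simp_all add: V_def V'_def \<Psi>_def \<Psi>'_def)
    define t where "t = (tanh (s / 2))\<^sup>2"
    have t0: "0 < t" using s by (simp add: t_def)
    have tR: "t < (R / \<rho>)\<^sup>2"
      unfolding t_def R_def using \<rho> s by (simp add: power_strict_mono)
    define x :: "real ^ 'n" where "x = (\<rho> * tanh (s / 2)) *\<^sub>R axis i0 1"
    have nx: "norm x = \<rho> * tanh (s / 2)" using \<rho> s by (simp add: x_def)
    then have xt: "(norm x)\<^sup>2 / \<rho>\<^sup>2 = t" using \<rho> by (simp add: t_def power_mult_distrib)
    have "norm x < R" unfolding nx R_def using \<rho> s by simp
    define B :: "(real ^ 'n) set" where "B = ball 0 R - {0}"
    have "B \<subseteq> cball 0 R" by (auto simp: B_def)
    then have B: "open B" "B \<subseteq> U" "x \<in> B"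
      using U(2) \<open>norm x < R\<close> nx \<rho> s by (auto simp: B_def disc)
    have Bt: "0 < (norm y)\<^sup>2 / \<rho>\<^sup>2 \<and> (norm y)\<^sup>2 / \<rho>\<^sup>2 \<le> (R / \<rho>)\<^sup>2" if "y \<in> B" for y
      using that \<rho> by (auto simp: B_def power_divide intro!: divide_right_mono power_mono)
    obtain D where D: "(V' has_real_derivative D) (at t)" using dV'[OF t0] tR by auto
    have lap: "hyp_laplacian \<rho> \<psi> x = (t * (1 - t)\<^sup>2 * D + (3 / 2 - 2 * t - (3 / 2 - 2) * t\<^sup>2) * V' t) / \<rho>\<^sup>2"
    proof -
      have "\<psi> y = V ((norm y)\<^sup>2 / \<rho>\<^sup>2)" if "y \<in> B" for y
        using that \<rho> radial[of y] by (simp add: V_def B_def real_sqrt_divide)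
      moreover have "(V has_real_derivative V' ((norm y)\<^sup>2 / \<rho>\<^sup>2)) (at ((norm y)\<^sup>2 / \<rho>\<^sup>2))" if "y \<in> B" for y
        using dV Bt[OF that] by blast
      moreover have "CARD('n) \<ge> 2" using n by simp
      ultimately show ?thesis
        using hyp_laplacian_radial[OF \<rho> _ U(1,3,4) B, of V V' D] D by (simp add: xt n)
    qed
    have "x \<in> hyp_disc \<rho> \<delta>" using \<open>norm x < R\<close> by (simp add: disc)
    moreover have "\<psi> x = \<Psi> s" by (simp add: x_def \<Psi>_def P_def)
    ultimately have "(t * (1 - t)\<^sup>2 * D + (3 / 2 - 2 * t - (3 / 2 - 2) * t\<^sup>2) * V' t) / \<rho>\<^sup>2 + \<nu> * \<Psi> s = 0"
      using pde[of x] lap by simp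
    then have tode: "t * (1 - t)\<^sup>2 * D + (3 / 2 - 2 * t - (3 / 2 - 2) * t\<^sup>2) * V' t + \<mu> * \<Psi> s = 0"
      using \<rho> by (simp add: \<mu>_def field_simps)
    have "((\<lambda>s. V ((tanh (s / 2))\<^sup>2)) has_real_derivative V' t * (tanh (s / 2) * (1 - t))) (at s)"
      unfolding t_def by (rule geodesic_chain_rule(1)) (use dV[OF t0] tR in \<open>simp add: t_def\<close>)
    then have "((\<lambda>s. V ((tanh (s / 2))\<^sup>2)) has_real_derivative \<Psi>' s) (at s)"
      using V\<Psi>(2)[OF s(1)] by (simp add: t_def)
    then have 1: "(\<Psi> has_real_derivative \<Psi>' s) (at s)"
      by (rule has_field_derivative_transform_within_open[of _ _ _ "{0<..}"]) (use s V\<Psi>(1) in auto)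
    have "((\<lambda>s. V' ((tanh (s / 2))\<^sup>2) * (tanh (s / 2) * (1 - (tanh (s / 2))\<^sup>2))) has_real_derivative
         - (2 * (3 / 2) - 1) * (cosh s / sinh s) * (V' t * (tanh (s / 2) * (1 - t))) - \<mu> * \<Psi> s) (at s)"
      unfolding t_def
      by (rule geodesic_chain_rule(2)) (use D tode s in \<open>simp_all add: t_def\<close>)
    then have "((\<lambda>s. V' ((tanh (s / 2))\<^sup>2) * (tanh (s / 2) * (1 - (tanh (s / 2))\<^sup>2))) has_real_derivative
         - 2 * (cosh s / sinh s) * \<Psi>' s - \<mu> * \<Psi> s) (at s)"
      using V\<Psi>(2)[OF s(1)] by (simp add: t_def)
    then have 2: "(\<Psi>' has_real_derivative - 2 * (cosh s / sinh s) * \<Psi>' s - \<mu> * \<Psi> s) (at s)"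
      by (rule has_field_derivative_transform_within_open[of _ _ _ "{0<..}"]) (use s V\<Psi>(2) in auto)
    show ?thesis using 1 2 ..
  qed
  have tanh_cont: "continuous_on {0..d} (\<lambda>s. \<rho> * tanh (s / 2))" by (intro continuous_intros) auto
  have cPR: "continuous_on {-R..R} P" "continuous_on {-R..R} P'"
    by (intro continuous_at_imp_continuous_on ballI, rule DERIV_isCont, rule dP dP', simp add: abs_le_iff)+
  have img: "(\<lambda>s. \<rho> * tanh (s / 2)) ` {0..d} \<subseteq> {-R..R}"
  proof (rule image_subsetI)
    fix s assume "s \<in> {0..d}"
    from tanh_le[OF this] show "\<rho> * tanh (s / 2) \<in> {-R..R}" unfolding abs_le_iff by auto
  qed
  have cP: "continuous_on {0..d} (\<lambda>s. P (\<rho> * tanh (s / 2)))" "continuous_on {0..d} (\<lambda>s. P' (\<rho> * tanh (s / 2)))"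
    by (rule continuous_on_compose2[OF cPR(1) tanh_cont img], rule continuous_on_compose2[OF cPR(2) tanh_cont img])
  define s where "s = hyp_dist \<rho> 0 m / \<rho>"
  have mm: "norm m < \<rho>" "0 \<le> hyp_dist \<rho> 0 m" "hyp_dist \<rho> 0 m \<le> \<delta>" using hyp_disc_dist_bounds(1)[OF \<rho> m] by auto
  have s: "0 \<le> s" "s \<le> d" using mm \<rho> by (auto simp: s_def d_def divide_right_mono)
  have "\<Psi> s = \<psi> 0 * geodesic_profile (3 / 2) \<mu> s"
  proof (rule radial_solution_3d_unique[where f = \<Psi> and f' = \<Psi>' and g = "geodesic_profile (3 / 2) \<mu>" and g' = "geodesic_profile' (3 / 2) \<mu>" and \<mu> = \<mu> and d = d])
    show "continuous_on {0..d} \<Psi>" "continuous_on {0..d} \<Psi>'"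
      unfolding \<Psi>_def[abs_def] \<Psi>'_def[abs_def] using cP by (auto intro!: continuous_intros)
    fix t :: real assume "0 < t" "t < d"
    then show "(\<Psi> has_real_derivative \<Psi>' t) (at t)"
      "(\<Psi>' has_real_derivative - 2 * (cosh t / sinh t) * \<Psi>' t - \<mu> * \<Psi> t) (at t)"
      "(geodesic_profile (3 / 2) \<mu> has_real_derivative geodesic_profile' (3 / 2) \<mu> t) (at t)"
      "(geodesic_profile' (3 / 2) \<mu> has_real_derivative
         - 2 * (cosh t / sinh t) * geodesic_profile' (3 / 2) \<mu> t - \<mu> * geodesic_profile (3 / 2) \<mu> t) (at t)"
      using ode[of t] geodesic_profile_deriv[of "3 / 2" \<mu> t] geodesic_profile'_deriv[of "3 / 2" t \<mu>] by auto
  qed (use s in \<open>auto intro!: continuous_on_geodesic_profile simp: \<Psi>_def P_def\<close>)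
  moreover have "\<Psi> s = \<psi> m"
  proof -
    have "norm m = \<rho> * tanh (s / 2)"
      using norm_eq_tanh_hyp_dist[OF \<rho> mm(1)] by (simp add: s_def mult.commute)
    then show ?thesis using radial[of m] m by (simp add: \<Psi>_def disc)
  qed
  ultimately show ?thesis by (simp add: s_def \<mu>_def)
qed

text \<open>A radial eigenfunction that does not vanish at the centre is a multiple of the radial mode, whose boundary
condition is the stated equation.\<close>

lemma radial_eigenvalue_3d_iff:
  assumes \<rho>: "\<rho> > 0" and n: "CARD('n::finite) = 3" and \<delta>: "\<delta> > 0"
  shows "radial_eigenvalue TYPE('n) \<rho> \<delta> \<nu> \<longleftrightarrow> geodesic_profile (3 / 2) (\<rho>\<^sup>2 * \<nu>) (\<delta> / \<rho>) = 0"
proof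
  assume "radial_eigenvalue TYPE('n) \<rho> \<delta> \<nu>"
  then obtain \<psi> :: "real ^ 'n \<Rightarrow> real" where \<psi>: "radial_eigenfunction \<rho> \<delta> \<nu> \<psi>" "\<psi> 0 \<noteq> 0"
    unfolding radial_eigenvalue_def by blast
  define m :: "real ^ 'n" where "m = (\<rho> * tanh (\<delta> / (2 * \<rho>))) *\<^sub>R axis undefined 1"
  have "norm m = \<rho> * tanh (\<delta> / (2 * \<rho>))" using \<rho> \<delta> by (simp add: m_def)
  then have m: "m \<in> hyp_disc \<rho> \<delta>" "hyp_dist \<rho> 0 m = \<delta>"
    using hyp_disc_dist_bounds(2)[OF \<rho>] by (simp_all add: hyp_disc_eq_cball[OF \<rho>])
  then have "\<psi> m = 0"
    using \<psi>(1) unfolding radial_eigenfunction_def dirichlet_eigenfunction_def by blast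
  then show "geodesic_profile (3 / 2) (\<rho>\<^sup>2 * \<nu>) (\<delta> / \<rho>) = 0"
    using radial_eigenfunction_3d[OF \<rho> n \<delta> \<psi>(1) m(1)] m(2) \<psi>(2) by simp
next
  assume z: "geodesic_profile (3 / 2) (\<rho>\<^sup>2 * \<nu>) (\<delta> / \<rho>) = 0"
  then show "radial_eigenvalue TYPE('n) \<rho> \<delta> \<nu>"
    unfolding radial_eigenvalue_def
    using radial_mode_radial_eigenfunction[OF \<rho> _ \<delta>, where 'n = 'n and \<mu> = "\<rho>\<^sup>2 * \<nu>"] n \<rho>
    by (intro exI[of _ "radial_mode \<rho> (\<rho>\<^sup>2 * \<nu>)"]) (simp add: radial_mode_def)
qed

lemma sinh_eq_tanh_half:
  "sinh (x :: real) = 2 * tanh (x / 2) / (1 - (tanh (x / 2))\<^sup>2)"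
proof -
  define C S where "C = cosh (x / 2)" and "S = sinh (x / 2)"
  have C: "C > 0" "C\<^sup>2 - S\<^sup>2 = 1" by (simp_all add: C_def S_def cosh_square_eq)
  have "1 - (S / C)\<^sup>2 = (C\<^sup>2 - S\<^sup>2) / C\<^sup>2"
    using C(1) by (simp add: power_divide diff_divide_distrib)
  then have "1 - (S / C)\<^sup>2 = 1 / C\<^sup>2" unfolding C(2) .
  then have "2 * (S / C) / (1 - (S / C)\<^sup>2) = 2 * S * C" using C by (simp add: power2_eq_square)
  moreover have "sinh x = 2 * S * C" using sinh_double[of "x / 2"] by (simp add: C_def S_def)
  ultimately show ?thesis by (simp add: tanh_def C_def S_def)
qed

section \<open>Eigenvalue bounds and the spectrum of the hyperbolic disc\<close>

theorem theorem6p1: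
  fixes k :: nat and \<rho> \<kappa> \<delta> :: real
  assumes "k \<ge> 1" and "CARD('n::finite) = k + 1"
    and "\<rho> > 0" and "\<kappa> = - 1 / \<rho>\<^sup>2" and "\<delta> > 0"
  shows "\<exists>lmin. is_min_eigenvalue TYPE('n) \<rho> \<delta> lmin \<and>
    (k = 1 \<longrightarrow>
       - \<kappa> * (real k)\<^sup>2 / 4 + (pi / (2 * \<delta>))\<^sup>2 < lmin \<and>
       lmin < - \<kappa> * (real k)\<^sup>2 / 4 + (pi / \<delta>)\<^sup>2) \<and>
    (k \<ge> 3 \<longrightarrow> lmin > - \<kappa> * (real k)\<^sup>2 / 4 + (pi / \<delta>)\<^sup>2) \<and>
    (k = 2 \<longrightarrow>
       lmin = - \<kappa> + (pi / \<delta>)\<^sup>2 \<and>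
       {\<mu>. radial_eigenvalue TYPE('n) \<rho> \<delta> \<mu>} =
         {- \<kappa> + (pi * real j / \<delta>)\<^sup>2 | j :: nat. j \<ge> 1} \<and>
       (\<forall>j :: nat. j \<ge> 1 \<longrightarrow>
         (\<exists>\<phi> :: real ^ 'n \<Rightarrow> real.
            radial_eigenfunction \<rho> \<delta> (- \<kappa> + (pi * real j / \<delta>)\<^sup>2) \<phi> \<and> \<phi> 0 = 1 \<and>
            (\<forall>\<psi> :: real ^ 'n \<Rightarrow> real.
               radial_eigenfunction \<rho> \<delta> (- \<kappa> + (pi * real j / \<delta>)\<^sup>2) \<psi> \<and> \<psi> 0 = 1 \<longrightarrow>
               (\<forall>m\<in>hyp_disc \<rho> \<delta>. \<psi> m = \<phi> m)) \<and>
            (\<exists>f :: real \<Rightarrow> real.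
               (\<forall>m\<in>hyp_disc \<rho> \<delta>. \<phi> m = f (hyp_dist \<rho> 0 m)) \<and>
               (f \<longlongrightarrow> f 0) (at_right 0) \<and>
               (\<forall>r. 0 < r \<and> r \<le> \<delta> \<longrightarrow>
                  (let \<eta> = \<rho> * tanh (r / (2 * \<rho>)) in
                     f r = \<delta> * (\<rho>\<^sup>2 - \<eta>\<^sup>2) / (2 * pi * \<rho>\<^sup>2 * \<eta> * real j)
                             * sin (pi * real j * r / \<delta>) \<and>
                     f r = \<delta> / (pi * real j * \<rho> * sinh (r / \<rho>))
                             * sin (pi * real j * r / \<delta>)))))))"
proof -
  define c where "c = real CARD('n) / 2"
  define d where "d = \<delta> / \<rho>"
  note \<rho> = \<open>\<rho> > 0\<close> and \<delta> = \<open>\<delta> > 0\<close>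
  have n: "CARD('n) \<ge> 2" using assms(1,2) by simp
  have c: "c \<ge> 1" "real k = 2 * c - 1" using assms(1,2) by (simp_all add: c_def field_simps)
  have d: "d > 0" using \<rho> \<delta> by (simp add: d_def)
  obtain \<mu> where \<mu>: "geodesic_profile c \<mu> d = 0"
    "\<And>s. 0 \<le> s \<Longrightarrow> s < d \<Longrightarrow> geodesic_profile c \<mu> s > 0"
    "\<And>\<nu>. \<nu> < \<mu> \<Longrightarrow> \<exists>\<theta>>\<nu>. \<forall>s\<in>{0..d}. geodesic_profile c \<theta> s > 0"
    using exists_first_dirichlet_profile[OF c(1) d] by blast
  have min: "is_min_eigenvalue TYPE('n) \<rho> \<delta> (\<mu> / \<rho>\<^sup>2)"
    using \<mu> by (intro is_min_eigenvalue_first_profile[OF \<rho> n \<delta>]) (auto simp: c_def d_def)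
  note bounds = first_dirichlet_profile_bounds[OF c d \<mu>(2,1)]
  have scale: "- \<kappa> * (real k)\<^sup>2 / 4 + (x / \<delta>)\<^sup>2 = ((real k)\<^sup>2 / 4 + (x / d)\<^sup>2) / \<rho>\<^sup>2" for x
    using \<rho> \<delta> by (simp add: \<open>\<kappa> = _\<close> d_def field_simps)
  have scale3: "- \<kappa> + (x / \<delta>)\<^sup>2 = (1 + (x / d)\<^sup>2) / \<rho>\<^sup>2" for x
    using \<rho> \<delta> by (simp add: \<open>\<kappa> = _\<close> d_def field_simps)
  have A: "- \<kappa> * (real k)\<^sup>2 / 4 + (pi / (2 * \<delta>))\<^sup>2 < \<mu> / \<rho>\<^sup>2 \<and>
      \<mu> / \<rho>\<^sup>2 < - \<kappa> * (real k)\<^sup>2 / 4 + (pi / \<delta>)\<^sup>2" if "k = 1"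
    using bounds(1) that scale[of "pi / 2"] scale[of pi] \<rho> by (simp add: divide_strict_right_mono)
  have B: "\<mu> / \<rho>\<^sup>2 > - \<kappa> * (real k)\<^sup>2 / 4 + (pi / \<delta>)\<^sup>2" if "k \<ge> 3"
    using bounds(3) that unfolding scale using \<rho> by (simp add: divide_strict_right_mono)
  have C: "\<mu> / \<rho>\<^sup>2 = - \<kappa> + (pi / \<delta>)\<^sup>2" if "k = 2"
    using bounds(2) that unfolding scale3 by simp
  have spectrum: "{\<nu>. radial_eigenvalue TYPE('n) \<rho> \<delta> \<nu>} =
      {- \<kappa> + (pi * real j / \<delta>)\<^sup>2 | j :: nat. j \<ge> 1}" if "k = 2"
  proof -
    have n3: "CARD('n) = 3" using that assms(2) by simp
    have "\<rho>\<^sup>2 * \<nu> = 1 + (pi * real j / d)\<^sup>2 \<longleftrightarrow> \<nu> = - \<kappa> + (pi * real j / \<delta>)\<^sup>2" for \<nu> and j :: nat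
      unfolding scale3 using \<rho> by (auto simp: field_simps)
    then show ?thesis
      using radial_eigenvalue_3d_iff[OF \<rho> n3 \<delta>] geodesic_profile_3d_zero_iff[OF d]
      by (auto simp: d_def)
  qed
  have mode: "\<exists>\<phi> :: real ^ 'n \<Rightarrow> real.
      radial_eigenfunction \<rho> \<delta> (- \<kappa> + (pi * real j / \<delta>)\<^sup>2) \<phi> \<and> \<phi> 0 = 1 \<and>
      (\<forall>\<psi> :: real ^ 'n \<Rightarrow> real.
         radial_eigenfunction \<rho> \<delta> (- \<kappa> + (pi * real j / \<delta>)\<^sup>2) \<psi> \<and> \<psi> 0 = 1 \<longrightarrow>
         (\<forall>m\<in>hyp_disc \<rho> \<delta>. \<psi> m = \<phi> m)) \<and>
      (\<exists>f :: real \<Rightarrow> real.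
         (\<forall>m\<in>hyp_disc \<rho> \<delta>. \<phi> m = f (hyp_dist \<rho> 0 m)) \<and>
         (f \<longlongrightarrow> f 0) (at_right 0) \<and>
         (\<forall>r. 0 < r \<and> r \<le> \<delta> \<longrightarrow>
            (let \<eta> = \<rho> * tanh (r / (2 * \<rho>)) in
               f r = \<delta> * (\<rho>\<^sup>2 - \<eta>\<^sup>2) / (2 * pi * \<rho>\<^sup>2 * \<eta> * real j) * sin (pi * real j * r / \<delta>) \<and>
               f r = \<delta> / (pi * real j * \<rho> * sinh (r / \<rho>)) * sin (pi * real j * r / \<delta>))))"
    if "k = 2" and j: "j \<ge> 1" for j :: nat
  proof -
    have n3: "CARD('n) = 3" using that assms(2) by simp
    define \<omega> where "\<omega> = pi * real j / d"
    have \<omega>: "\<omega> > 0" using j d by (simp add: \<omega>_def)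
    have ev: "- \<kappa> + (pi * real j / \<delta>)\<^sup>2 = (1 + \<omega>\<^sup>2) / \<rho>\<^sup>2" unfolding \<omega>_def by (rule scale3)
    define \<phi> :: "real ^ 'n \<Rightarrow> real" where "\<phi> = radial_mode \<rho> (1 + \<omega>\<^sup>2)"
    define f where "f r = geodesic_profile (3 / 2) (1 + \<omega>\<^sup>2) (r / \<rho>)" for r
    have zero: "geodesic_profile (3 / 2) (1 + \<omega>\<^sup>2) d = 0"
      using geodesic_profile_3d_zero_iff[OF d] j by (auto simp: \<omega>_def)
    then have ef: "radial_eigenfunction \<rho> \<delta> ((1 + \<omega>\<^sup>2) / \<rho>\<^sup>2) \<phi>"
      using radial_mode_radial_eigenfunction[OF \<rho> n \<delta>, of "1 + \<omega>\<^sup>2"] by (simp add: \<phi>_def n3 d_def)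
    have \<phi>f: "\<phi> m = f (hyp_dist \<rho> 0 m)" if "m \<in> hyp_disc \<rho> \<delta>" for m
      using hyp_disc_dist_bounds(1)[OF \<rho> that]
      by (simp add: \<phi>_def f_def radial_mode_eq_geodesic_profile[OF \<rho>] n3)
    have uniq: "\<psi> m = \<phi> m" if "radial_eigenfunction \<rho> \<delta> ((1 + \<omega>\<^sup>2) / \<rho>\<^sup>2) \<psi>" "\<psi> 0 = 1" "m \<in> hyp_disc \<rho> \<delta>"
      for \<psi> m
      using radial_eigenfunction_3d[OF \<rho> n3 \<delta> that(1,3)] that(2) \<phi>f[OF that(3)] \<rho> by (simp add: f_def)
    have "continuous_on UNIV f"
      unfolding f_def[abs_def] using \<rho>
      by (intro continuous_on_compose2[OF continuous_on_geodesic_profile(1)[of "3 / 2" UNIV]] continuous_intros) auto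
    then have lim: "(f \<longlongrightarrow> f 0) (at_right 0)"
      by (auto simp: continuous_on_def intro: tendsto_within_subset)
    have formula: "f r = \<delta> / (pi * real j * \<rho> * sinh (r / \<rho>)) * sin (pi * real j * r / \<delta>)" if "0 < r" for r
    proof -
      have phase: "\<omega> * (r / \<rho>) = pi * real j * r / \<delta>" using \<rho> by (simp add: \<omega>_def d_def)
      have "sinh (r / \<rho>) * f r = sin (pi * real j * r / \<delta>) / \<omega>"
        unfolding f_def phase[symmetric]
        by (rule geodesic_profile_3d_oscillating[OF \<omega>]) (use that \<rho> in simp)
      moreover have S: "sinh (r / \<rho>) \<noteq> 0" using that \<rho> by simp
      ultimately have "f r = sin (pi * real j * r / \<delta>) / \<omega> / sinh (r / \<rho>)"
        by (metis nonzero_mult_div_cancel_left)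
      also have "\<dots> = \<delta> / (pi * real j * \<rho> * sinh (r / \<rho>)) * sin (pi * real j * r / \<delta>)"
        using \<rho> S by (simp add: \<omega>_def d_def)
      finally show ?thesis .
    qed
    have formula': "\<delta> * (\<rho>\<^sup>2 - \<eta>\<^sup>2) / (2 * pi * \<rho>\<^sup>2 * \<eta> * real j) = \<delta> / (pi * real j * \<rho> * sinh (r / \<rho>))"
      if "0 < r" "\<eta> = \<rho> * tanh (r / (2 * \<rho>))" for r \<eta>
    proof -
      define \<tau> where "\<tau> = tanh (r / (2 * \<rho>))"
      have "\<tau> > 0" using that \<rho> by (simp add: \<tau>_def)
      have "\<tau>\<^sup>2 < 1" using tanh_square_less_1[of "r / (2 * \<rho>)"] by (simp add: \<tau>_def)
      have sh: "sinh (r / \<rho>) = 2 * \<tau> / (1 - \<tau>\<^sup>2)"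
        using sinh_eq_tanh_half[of "r / \<rho>"] by (simp add: \<tau>_def mult.commute)
      show ?thesis
        unfolding that(2) \<tau>_def[symmetric] sh using \<rho> j \<open>\<tau> > 0\<close> \<open>\<tau>\<^sup>2 < 1\<close>
        by (simp add: divide_simps) (simp add: algebra_simps power2_eq_square)
    qed
    have formulas: "let \<eta> = \<rho> * tanh (r / (2 * \<rho>)) in
        f r = \<delta> * (\<rho>\<^sup>2 - \<eta>\<^sup>2) / (2 * pi * \<rho>\<^sup>2 * \<eta> * real j) * sin (pi * real j * r / \<delta>) \<and>
        f r = \<delta> / (pi * real j * \<rho> * sinh (r / \<rho>)) * sin (pi * real j * r / \<delta>)"
      if "0 < r" for r
      unfolding Let_def formula'[OF that refl] using formula[OF that] by blast
    show ?thesis unfolding ev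
    proof (intro exI[of _ \<phi>] conjI)
      show "radial_eigenfunction \<rho> \<delta> ((1 + \<omega>\<^sup>2) / \<rho>\<^sup>2) \<phi>" by (rule ef)
      show "\<phi> 0 = 1" by (simp add: \<phi>_def radial_mode_def)
      show "\<forall>\<psi>. radial_eigenfunction \<rho> \<delta> ((1 + \<omega>\<^sup>2) / \<rho>\<^sup>2) \<psi> \<and> \<psi> 0 = 1 \<longrightarrow>
          (\<forall>m\<in>hyp_disc \<rho> \<delta>. \<psi> m = \<phi> m)"
        using uniq by blast
    qed (use \<phi>f lim formulas in \<open>intro exI[of _ f] conjI ballI allI impI, blast+\<close>)
  qed
  show ?thesis
    by (rule exI[of _ "\<mu> / \<rho>\<^sup>2"], intro conjI impI allI)
      (use min A B C spectrum mode in \<open>simp_all only: refl\<close>)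
qed

end
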